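(* Let $P=(X,\prec)$ be a finite poset, let $x,y,z\in X$ be distinct, let $A=\{x,y,z\}$, and let $t\ge 1$ be an integer. Suppose that $P$ is either $t$-thin with respect to $A$ or $t$-flat with respect to $A$. Then for all integers $k,\ell\ge1$, $$\mathrm{F}(k+1,\ell)\,\mathrm{F}(k,\ell+1)\ \ge\ \Big(\tfrac12+\tfrac{1}{16\,t\,(t+1)^3}\Big)\,\mathrm{F}(k,\ell)\,\mathrm{F}(k+1,\ell+1),$$ where $\mathrm{F}(a,b)$ denotes the number of linear extensions $L$ of $P$ with $L(y)-L(x)=a$ and $L(z)-L(y)=b$.
   Context: A linear extension of a finite poset $P=(X,\prec)$ with $|X|=n$ is a bijection $L:X\to\{1,\dots,n\}$ with $L(u)<L(v)$ whenever $u\prec v$. For $A\subseteq X$, $P$ is $t$-thin with respect to $A$ if every $u\in X\setminus A$ is incomparable to at most $t$ elements of $X$; $P$ is $t$-flat with respect to $A$ if every $u\in A$ is comparable to at most $t$ elements of $X$. *)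

theory Defs
  imports Complex_Main "HOL-Library.FuncSet"
begin

definition comparable :: "('a \<Rightarrow> 'a \<Rightarrow> bool) \<Rightarrow> 'a \<Rightarrow> 'a \<Rightarrow> bool" where
  "comparable prec u v \<longleftrightarrow> prec u v \<or> prec v u"

text \<open>Both relations are between distinct elements: for a strict order an element is
  neither comparable nor incomparable to itself.\<close>

definition incomparable :: "('a \<Rightarrow> 'a \<Rightarrow> bool) \<Rightarrow> 'a \<Rightarrow> 'a \<Rightarrow> bool" where
  "incomparable prec u v \<longleftrightarrow> u \<noteq> v \<and> \<not> comparable prec u v"

definition thin_wrt :: "'a set \<Rightarrow> ('a \<Rightarrow> 'a \<Rightarrow> bool) \<Rightarrow> nat \<Rightarrow> 'a set \<Rightarrow> bool" where
  "thin_wrt X prec t A \<longleftrightarrow> (\<forall>u\<in>X - A. card {v\<in>X. incomparable prec u v} \<le> t)"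

definition flat_wrt :: "'a set \<Rightarrow> ('a \<Rightarrow> 'a \<Rightarrow> bool) \<Rightarrow> nat \<Rightarrow> 'a set \<Rightarrow> bool" where
  "flat_wrt X prec t A \<longleftrightarrow> (\<forall>u\<in>A. card {v\<in>X. comparable prec u v} \<le> t)"

text \<open>Maps on \<open>X\<close> are represented by functions that are \<open>undefined\<close> outside \<open>X\<close>, so
  that the cardinality of the set of linear extensions is their number.\<close>

definition linear_extensions :: "'a set \<Rightarrow> ('a \<Rightarrow> 'a \<Rightarrow> bool) \<Rightarrow> ('a \<Rightarrow> nat) set" where
  "linear_extensions X prec =
     {L \<in> extensional X. bij_betw L X {1..card X} \<and>
        (\<forall>u\<in>X. \<forall>v\<in>X. prec u v \<longrightarrow> L u < L v)}"

definition F :: "'a set \<Rightarrow> ('a \<Rightarrow> 'a \<Rightarrow> bool) \<Rightarrow> 'a \<Rightarrow> 'a \<Rightarrow> 'a \<Rightarrow> int \<Rightarrow> int \<Rightarrow> nat" where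
  "F X prec x y z a b =
     card {L \<in> linear_extensions X prec.
        int (L y) - int (L x) = a \<and> int (L z) - int (L y) = b}"

end

theory Submission
  imports Defs
begin

text \<open>
  A linear extension with \<open>x\<close>, \<open>y\<close>, \<open>z\<close> in this order is a word \<open>A x B y D z E\<close>; the number \<open>F(k, l)\<close> counts the
  words with \<open>|B| = k - 1\<close> and \<open>|D| = l - 1\<close>. Write \<open>f\<^sub>i\<^sub>j = F(k + i, l + j)\<close>. The proof has two halves.

  The first half is an inequality of Alexandrov--Fenchel type,
  \<open>(a\<^sup>2 f\<^sub>2\<^sub>0 + 2 a b f\<^sub>1\<^sub>1 + b\<^sup>2 f\<^sub>0\<^sub>2) f\<^sub>0\<^sub>0 \<le> (a f\<^sub>1\<^sub>0 + b f\<^sub>0\<^sub>1)\<^sup>2\<close> for all real \<open>a\<close>, \<open>b\<close>. It is proved by peeling minimal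
  elements off the beginning of a word: the quadratic form of a poset is dominated by the sum of the
  forms of the posets with one minimal element removed, and a discrete Bochner argument, which solves
  the Laplace equation of a weighted graph, shows that it is hyperbolic if those are. To make all numbers
  positive, the markers \<open>x\<close>, \<open>y\<close>, \<open>z\<close> are not elements of the poset but weights: a letter placed on the wrong side
  of a marker costs a factor \<open>\<epsilon>\<close>, and \<open>\<epsilon>\<close> tends to 0 at the end.

  The inequality says that the matrix with entries \<open>f\<^sub>1\<^sub>0\<^sup>2 - f\<^sub>2\<^sub>0 f\<^sub>0\<^sub>0\<close>, \<open>f\<^sub>1\<^sub>0 f\<^sub>0\<^sub>1 - f\<^sub>1\<^sub>1 f\<^sub>0\<^sub>0\<close>, \<open>f\<^sub>0\<^sub>1\<^sup>2 - f\<^sub>0\<^sub>2 f\<^sub>0\<^sub>0\<close> is positive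
  semidefinite, which alone gives the constant 1/2. The second half improves it by bounding
  \<open>f\<^sub>0\<^sub>1\<^sup>2 / (f\<^sub>0\<^sub>0 f\<^sub>0\<^sub>2)\<close> and \<open>f\<^sub>1\<^sub>0\<^sup>2 / (f\<^sub>0\<^sub>0 f\<^sub>2\<^sub>0)\<close>: one or two letters of a word are moved past their incomparable neighbours,
  and thinness or flatness bounds the number of words with the same image. If \<open>f\<^sub>2\<^sub>0\<close> or \<open>f\<^sub>0\<^sub>2\<close> vanishes, then the
  corresponding distance is maximal, which pins down the sets of letters in the outer blocks; if
  both vanish, exchanging the parts of two words below and above \<open>y\<close> gives the inequality with constant 1.
\<close>

section \<open>Quadratic forms and graph Laplacians\<close>

text \<open>Induction on the vertices. As in Gaussian elimination, the equation at \<open>s\<close>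
  determines the value there, and substituting it into the other equations leaves a Laplace equation
  on \<open>I\<close> whose conductances between distinct vertices are still positive.\<close>

lemma laplacian_solve:
  fixes c :: "'i \<Rightarrow> 'i \<Rightarrow> real" and k :: "'i \<Rightarrow> real"
  assumes "finite I"
    and "\<And>u v. \<lbrakk>u \<in> I; v \<in> I\<rbrakk> \<Longrightarrow> c u v = c v u"
    and "\<And>u v. \<lbrakk>u \<in> I; v \<in> I; u \<noteq> v\<rbrakk> \<Longrightarrow> 0 < c u v"
    and "(\<Sum>u\<in>I. k u) = 0"
  shows "\<exists>g. \<forall>u\<in>I. (\<Sum>v\<in>I. c u v * (g u - g v)) = k u"
  using assms
proof (induction I arbitrary: c k rule: finite_induct)
  case empty
  then show ?case by simp
next
  case (insert s I)
  show ?case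
  proof (cases "I = {}")
    case True
    then show ?thesis using insert.prems by auto
  next
    case False
    define \<sigma> where "\<sigma> = (\<Sum>v\<in>I. c s v)"
    have \<sigma>: "\<sigma> > 0"
      unfolding \<sigma>_def
    proof (rule sum_pos)
      show "0 < c s v" if "v \<in> I" for v using insert.prems(2)[of s v] insert.hyps that by auto
    qed (use False insert.hyps in auto)
    have sym: "c v s = c s v" if "v \<in> I" for v using insert.prems(1) that by simp
    \<comment> \<open>Star-mesh transformation: removing \<open>s\<close> joins any two of its
      neighbours by an additional conductance and distributes the source \<open>k s\<close> in
      proportion to the conductances, which preserves the total source.\<close>
    define c' where "c' u v = c u v + c u s * c s v / \<sigma>" for u v
    define k' where "k' u = k u + c u s * k s / \<sigma>" for u
    have "(\<Sum>u\<in>I. k' u) = (\<Sum>u\<in>I. k u) + (\<Sum>u\<in>I. c s u) * k s / \<sigma>"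
      by (simp add: k'_def sum.distrib sum_distrib_right sum_divide_distrib sym)
    also have "\<dots> = (\<Sum>u\<in>I. k u) + k s" using \<sigma> by (simp flip: \<sigma>_def)
    also have "\<dots> = 0" using insert.prems(3) insert.hyps by simp
    finally have "(\<Sum>u\<in>I. k' u) = 0" .
    moreover have "c' u v = c' v u" if "u \<in> I" "v \<in> I" for u v
      using insert.prems(1) that by (simp add: c'_def mult.commute)
    moreover have "0 < c' u v" if "u \<in> I" "v \<in> I" "u \<noteq> v" for u v
    proof -
      have "s \<noteq> u" "s \<noteq> v" using that insert.hyps by auto
      then have "0 < c u v" "0 < c u s" "0 < c s v" using insert.prems(2) that by auto
      then show ?thesis using \<sigma> by (simp add: c'_def add_pos_pos)
    qed
    ultimately obtain g where g: "\<And>u. u \<in> I \<Longrightarrow> (\<Sum>v\<in>I. c' u v * (g u - g v)) = k' u"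
      using insert.IH[of c' k'] by blast
    define gs where "gs = (k s + (\<Sum>v\<in>I. c s v * g v)) / \<sigma>"
    define f where "f = g(s := gs)"
    have fI: "f v = g v" if "v \<in> I" for v using that insert.hyps by (auto simp: f_def)
    have fs: "f s = gs" by (simp add: f_def)
    have "(\<Sum>v\<in>insert s I. c s v * (f s - f v)) = (\<Sum>v\<in>I. c s v * (gs - g v))"
      using insert.hyps by (simp add: fI fs)
    also have "\<dots> = \<sigma> * gs - (\<Sum>v\<in>I. c s v * g v)"
      by (simp add: right_diff_distrib sum_subtractf \<sigma>_def sum_distrib_right)
    also have "\<dots> = k s" using \<sigma> by (simp add: gs_def)
    finally have 1: "(\<Sum>v\<in>insert s I. c s v * (f s - f v)) = k s" .
    have 2: "(\<Sum>v\<in>insert s I. c u v * (f u - f v)) = k u" if u: "u \<in> I" for u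
    proof -
      have "k' u = (\<Sum>v\<in>I. c u v * (g u - g v)) + c u s / \<sigma> * (\<Sum>v\<in>I. c s v * (g u - g v))"
        unfolding g[OF u, symmetric]
        by (simp add: c'_def distrib_right sum.distrib sum_distrib_left mult.assoc)
      also have "(\<Sum>v\<in>I. c s v * (g u - g v)) = \<sigma> * g u - (\<Sum>v\<in>I. c s v * g v)"
        by (simp add: right_diff_distrib sum_subtractf \<sigma>_def sum_distrib_right)
      also have "(\<Sum>v\<in>I. c s v * g v) = \<sigma> * gs - k s" using \<sigma> by (simp add: gs_def)
      also have "c u s / \<sigma> * (\<sigma> * g u - (\<sigma> * gs - k s)) = c u s * (g u - gs) + c u s * k s / \<sigma>"
        using \<sigma> by (simp add: field_simps)
      finally have "(\<Sum>v\<in>I. c u v * (g u - g v)) + c u s * (g u - gs) = k u"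
        by (simp add: k'_def)
      then show ?thesis using insert.hyps u by (simp add: fI fs)
    qed
    show ?thesis using 1 2 by (intro exI[of _ f]) auto
  qed
qed

text \<open>The right side minus the left side is half of the energy, the sum of
  \<open>M u v * (g u - g v)^2\<close>, in which the terms with \<open>u = v\<close> vanish.\<close>

lemma quadratic_form_le_row_sums:
  fixes M :: "'i \<Rightarrow> 'i \<Rightarrow> real"
  assumes "finite I"
    and sym: "\<And>u v. \<lbrakk>u \<in> I; v \<in> I\<rbrakk> \<Longrightarrow> M u v = M v u"
    and pos: "\<And>u v. \<lbrakk>u \<in> I; v \<in> I; u \<noteq> v\<rbrakk> \<Longrightarrow> 0 \<le> M u v"
  shows "(\<Sum>u\<in>I. \<Sum>v\<in>I. M u v * g u * g v) \<le> (\<Sum>u\<in>I. (\<Sum>v\<in>I. M u v) * (g u)\<^sup>2)"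
proof -
  have "0 \<le> (\<Sum>u\<in>I. \<Sum>v\<in>I. M u v * (g u - g v)\<^sup>2)"
    using pos by (intro sum_nonneg) (metis diff_self mult_zero_right order_refl power_zero_numeral zero_le_mult_iff zero_le_power2)
  also have "\<dots> = (\<Sum>u\<in>I. \<Sum>v\<in>I. M u v * (g u)\<^sup>2) + (\<Sum>u\<in>I. \<Sum>v\<in>I. M u v * (g v)\<^sup>2)
      - 2 * (\<Sum>u\<in>I. \<Sum>v\<in>I. M u v * g u * g v)"
    by (simp add: power2_diff algebra_simps sum.distrib sum_subtractf sum_distrib_left)
  also have "(\<Sum>u\<in>I. \<Sum>v\<in>I. M u v * (g v)\<^sup>2) = (\<Sum>u\<in>I. \<Sum>v\<in>I. M u v * (g u)\<^sup>2)"
    by (subst sum.swap, intro sum.cong refl) (simp add: sym)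
  finally show ?thesis by (simp add: sum_distrib_right)
qed

text \<open>The vector \<open>g\<close> solving the Laplace equation makes the image of \<open>h + g\<close> proportional to \<open>g + t\<close>, so
  that the assumed inequality, applied to \<open>h + g\<close> alone, yields the claim. The data \<open>m\<close>, \<open>bx\<close>, \<open>Wx\<close>
  belong to one additional vertex, whose coordinate has been normalized to 0; it is absent if
  \<open>Wx = 0\<close>, in which case the last summand of the assumed inequality is 0 as \<open>0 / 0 = 0\<close>.\<close>

lemma bochner:
  fixes M :: "'i \<Rightarrow> 'i \<Rightarrow> real" and b m :: "'i \<Rightarrow> real" and r bx Wx :: real and I :: "'i set"
  defines "q \<equiv> \<lambda>h. (\<Sum>u\<in>I. \<Sum>v\<in>I. M u v * h u * h v) + 2 * (\<Sum>u\<in>I. b u * h u) + r"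
    and "k \<equiv> \<lambda>h u. (\<Sum>v\<in>I. M u v * h v) + b u"
    and "kx \<equiv> \<lambda>h. (\<Sum>u\<in>I. m u * h u) + bx"
    and "W \<equiv> \<lambda>u. (\<Sum>v\<in>I. M u v) + m u"
  assumes fin: "finite I"
    and sym: "\<And>u v. \<lbrakk>u \<in> I; v \<in> I\<rbrakk> \<Longrightarrow> M u v = M v u"
    and pos: "\<And>u v. \<lbrakk>u \<in> I; v \<in> I; u \<noteq> v\<rbrakk> \<Longrightarrow> 0 < M u v"
    and W: "\<And>u. u \<in> I \<Longrightarrow> 0 < W u"
    and x: "(Wx = 0 \<and> bx = 0 \<and> (\<forall>u\<in>I. m u = 0)) \<or> (0 < Wx \<and> (\<forall>u\<in>I. 0 < m u))"
    and le: "\<And>h. q h \<le> (\<Sum>u\<in>I. (k h u)\<^sup>2 / W u) + (kx h)\<^sup>2 / Wx"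
  shows "q h * ((\<Sum>u\<in>I. W u) + Wx) \<le> ((\<Sum>u\<in>I. k h u) + kx h)\<^sup>2"
proof (cases "(\<Sum>u\<in>I. W u) + Wx = 0")
  case True
  then show ?thesis by simp
next
  case False
  define \<Omega> where "\<Omega> = (\<Sum>u\<in>I. W u) + Wx"
  have "(\<Sum>u\<in>I. W u) \<ge> 0" using W by (intro sum_nonneg) (auto simp: less_imp_le)
  then have \<Omega>: "\<Omega> > 0" using False x by (auto simp: \<Omega>_def)
  \<comment> \<open>This \<open>t\<close> makes the numbers \<open>k h u - t * W u\<close> and
    \<open>kx h - t * Wx\<close> add up to 0, the solvability condition of the Laplace
    equation.\<close>
  define t where "t = ((\<Sum>u\<in>I. k h u) + kx h) / \<Omega>"
  have t\<Omega>: "(\<Sum>u\<in>I. k h u) + kx h = t * \<Omega>" using \<Omega> by (simp add: t_def)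
  have "\<exists>g. (\<forall>u\<in>I. W u * g u - (\<Sum>v\<in>I. M u v * g v) = k h u - t * W u)
      \<and> - (\<Sum>u\<in>I. m u * g u) = kx h - t * Wx"
    using x
  proof
    assume x: "Wx = 0 \<and> bx = 0 \<and> (\<forall>u\<in>I. m u = 0)"
    then have kx: "kx h = 0" by (simp add: kx_def)
    have "(\<Sum>u\<in>I. k h u - t * W u) = 0"
      using t\<Omega> x kx by (simp add: sum_subtractf \<Omega>_def flip: sum_distrib_left)
    then obtain g where g: "\<forall>u\<in>I. (\<Sum>v\<in>I. M u v * (g u - g v)) = k h u - t * W u"
      using laplacian_solve[of I M "\<lambda>u. k h u - t * W u"] fin sym pos by blast
    have "W u * g u - (\<Sum>v\<in>I. M u v * g v) = k h u - t * W u" if "u \<in> I" for u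
      using g[rule_format, OF that] x that
      by (simp add: W_def right_diff_distrib sum_subtractf sum_distrib_right)
    then show ?thesis using x kx by (intro exI[of _ g]) simp
  next
    assume x: "0 < Wx \<and> (\<forall>u\<in>I. 0 < m u)"
    \<comment> \<open>The additional vertex is \<open>None\<close>, joined to each \<open>u\<close>
      with conductance \<open>m u\<close>.\<close>
    define J where "J = insert None (Some ` I)"
    define c where "c i j = (case i of None \<Rightarrow> (case j of None \<Rightarrow> 0 | Some v \<Rightarrow> m v)
       | Some u \<Rightarrow> (case j of None \<Rightarrow> m u | Some v \<Rightarrow> M u v))" for i j
    define K where "K i = (case i of None \<Rightarrow> kx h - t * Wx | Some u \<Rightarrow> k h u - t * W u)" for i
    have sumJ: "(\<Sum>i\<in>J. f i) = f None + (\<Sum>u\<in>I. f (Some u))" for f :: "'i option \<Rightarrow> real"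
      unfolding J_def using fin by (subst sum.insert) (auto simp: sum.reindex)
    have "\<exists>g. \<forall>i\<in>J. (\<Sum>j\<in>J. c i j * (g i - g j)) = K i"
    proof (rule laplacian_solve)
      show "finite J" using fin by (simp add: J_def)
      show "c i j = c j i" if "i \<in> J" "j \<in> J" for i j
        using that sym by (auto simp: J_def c_def)
      show "0 < c i j" if "i \<in> J" "j \<in> J" "i \<noteq> j" for i j
        using that x by (cases i; cases j) (auto simp: J_def c_def intro: pos)
      show "(\<Sum>i\<in>J. K i) = 0"
        using t\<Omega> unfolding sumJ
        by (simp add: K_def sum_subtractf \<Omega>_def algebra_simps flip: sum_distrib_left)
    qed
    then obtain g where g: "\<forall>i\<in>J. (\<Sum>j\<in>J. c i j * (g i - g j)) = K i" by blast
    \<comment> \<open>Adding a constant preserves the equations, so the value at \<open>None\<close>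
      can be moved to 0.\<close>
    define g' where "g' u = g (Some u) - g None" for u
    have "W u * g' u - (\<Sum>v\<in>I. M u v * g' v) = k h u - t * W u" if "u \<in> I" for u
    proof -
      have "(\<Sum>j\<in>J. c (Some u) j * (g (Some u) - g j)) = k h u - t * W u"
        using g that by (auto simp: J_def K_def)
      moreover have "g (Some u) - g (Some v) = g' u - g' v" for v by (simp add: g'_def)
      ultimately have "m u * g' u + (\<Sum>v\<in>I. M u v * (g' u - g' v)) = k h u - t * W u"
        by (simp add: sumJ c_def flip: g'_def)
      then show ?thesis
        by (simp add: W_def right_diff_distrib sum_subtractf sum_distrib_right distrib_right)
    qed
    moreover have "(\<Sum>j\<in>J. c None j * (g None - g j)) = kx h - t * Wx"
      using g by (auto simp: J_def K_def)
    then have "- (\<Sum>u\<in>I. m u * g' u) = kx h - t * Wx"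
      by (simp add: sumJ c_def g'_def sum_negf[symmetric] algebra_simps)
    ultimately show ?thesis by blast
  qed
  then obtain g where g: "\<And>u. u \<in> I \<Longrightarrow> W u * g u - (\<Sum>v\<in>I. M u v * g v) = k h u - t * W u"
    and gx: "- (\<Sum>u\<in>I. m u * g u) = kx h - t * Wx" by blast
  define h' where "h' u = h u + g u" for u
  have k': "k h' u = W u * (g u + t)" if "u \<in> I" for u
    using g[OF that] by (simp add: k_def h'_def algebra_simps sum.distrib)
  have kx': "kx h' = t * Wx"
    using gx by (simp add: kx_def h'_def algebra_simps sum.distrib)
  have swap: "(\<Sum>u\<in>I. \<Sum>v\<in>I. M u v * h' u * g v) = (\<Sum>u\<in>I. \<Sum>v\<in>I. M u v * g u * h' v)"
    by (subst sum.swap, intro sum.cong refl) (simp add: sym)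
  \<comment> \<open>Expansion around \<open>h'\<close>, where the gradient of \<open>q\<close> is
    known from \<open>k'\<close>. Once the remaining terms are bounded, everything containing
    \<open>g\<close> cancels and only \<open>t\<close> squared times \<Omega> is left.\<close>
  have "q h = q (\<lambda>u. h' u - g u)" by (simp add: h'_def)
  also have "\<dots> = q h' - 2 * (\<Sum>u\<in>I. g u * k h' u) + (\<Sum>u\<in>I. \<Sum>v\<in>I. M u v * g u * g v)"
    using swap unfolding q_def k_def
    by (simp add: algebra_simps sum.distrib sum_subtractf sum_distrib_left)
  also have "(\<Sum>u\<in>I. g u * k h' u) = (\<Sum>u\<in>I. g u * (W u * (g u + t)))"
    using k' by (intro sum.cong) auto
  also have "(\<Sum>u\<in>I. \<Sum>v\<in>I. M u v * g u * g v) \<le> (\<Sum>u\<in>I. (\<Sum>v\<in>I. M u v) * (g u)\<^sup>2)"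
    using fin sym pos by (intro quadratic_form_le_row_sums) (auto simp: less_imp_le)
  also have "\<dots> \<le> (\<Sum>u\<in>I. W u * (g u)\<^sup>2)"
    using x by (intro sum_mono mult_right_mono) (auto simp: W_def less_imp_le)
  also have "q h' \<le> (\<Sum>u\<in>I. (W u * (g u + t))\<^sup>2 / W u) + (t * Wx)\<^sup>2 / Wx"
    using le[of h'] k' kx' by simp
  also have "(\<Sum>u\<in>I. (W u * (g u + t))\<^sup>2 / W u) = (\<Sum>u\<in>I. W u * (g u + t)\<^sup>2)"
    using W by (intro sum.cong) (auto simp: power2_eq_square less_imp_neq[THEN not_sym])
  \<comment> \<open>This includes the case \<open>Wx = 0\<close>, where both sides are 0.\<close>
  also have "(t * Wx)\<^sup>2 / Wx = t\<^sup>2 * Wx" by (simp add: power2_eq_square)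
  finally have "q h \<le> (\<Sum>u\<in>I. W u * (g u + t)\<^sup>2) + t\<^sup>2 * Wx
      - 2 * (\<Sum>u\<in>I. g u * (W u * (g u + t))) + (\<Sum>u\<in>I. W u * (g u)\<^sup>2)" by simp
  also have "\<dots> = t\<^sup>2 * \<Omega>"
    by (simp add: \<Omega>_def power2_eq_square algebra_simps sum.distrib sum_distrib_left)
  finally have "q h * \<Omega> \<le> t\<^sup>2 * \<Omega> * \<Omega>" using \<Omega> by (intro mult_right_mono) auto
  also have "\<dots> = ((\<Sum>u\<in>I. k h u) + kx h)\<^sup>2" unfolding t\<Omega> by (simp add: power2_eq_square)
  finally show ?thesis by (simp add: \<Omega>_def)
qed

text \<open>The left side is a quadratic polynomial in \<tau> with leading coefficient
  \<open>G\<close>. For \<open>G > 0\<close> it is nonpositive at the root of the affine function on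
  the right, so its discriminant is nonnegative. The slope \<open>p\<close> cannot vanish, since the
  polynomial would then be bounded above.\<close>

lemma discriminant_of_majorization:
  fixes q l G f p :: real
  assumes le: "\<And>\<tau>. q - 2 * \<tau> * l + \<tau>\<^sup>2 * G \<le> (f - \<tau> * p)\<^sup>2" and G: "0 \<le> G"
  shows "q * G \<le> l\<^sup>2"
proof (cases "G = 0")
  case False
  then have G: "G > 0" using G by simp
  have sq: "(G * \<tau> - l)\<^sup>2 = G * (q - 2 * \<tau> * l + \<tau>\<^sup>2 * G) + l\<^sup>2 - q * G" for \<tau>
    by (simp add: power2_eq_square algebra_simps)
  have p: "p \<noteq> 0"
  proof
    assume p: "p = 0"
    define c where "c = G * f\<^sup>2 + l\<^sup>2 - q * G"
    have "(G * \<tau> - l)\<^sup>2 \<le> c" for \<tau>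
      unfolding sq c_def using le[of \<tau>] G p by simp
    from this[of "(l + (\<bar>c\<bar> + 1)) / G"] have "(\<bar>c\<bar> + 1)\<^sup>2 \<le> c" using G by simp
    moreover have "(\<bar>c\<bar> + 1)\<^sup>2 > \<bar>c\<bar>" by (simp add: power2_eq_square algebra_simps) (smt (verit) zero_le_mult_iff)
    ultimately show False by linarith
  qed
  have "q - 2 * (f / p) * l + (f / p)\<^sup>2 * G \<le> 0" using le[of "f / p"] p by simp
  then have "G * (q - 2 * (f / p) * l + (f / p)\<^sup>2 * G) \<le> 0" using G by (simp add: mult_le_0_iff)
  moreover have "0 \<le> (G * (f / p) - l)\<^sup>2" by simp
  ultimately show ?thesis unfolding sq by linarith
qed simp

section \<open>Peeling minimal elements\<close>

locale peeling =
  fixes prec :: "'a \<Rightarrow> 'a \<Rightarrow> bool"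
begin

definition mins :: "'a set \<Rightarrow> 'a set" where
  "mins S = {u \<in> S. \<forall>v\<in>S. \<not> prec v u}"

text \<open>A vector on the minimal elements of \<open>S\<close> is transported to \<open>S - {u}\<close>: an element that becomes minimal
  by the removal of \<open>u\<close> takes the value at \<open>u\<close>. Geometrically, the vector perturbs the lower bounds
  of the coordinates, and on the facet where \<open>u\<close> attains its bound that bound is passed on.\<close>

definition inherit :: "'a set \<Rightarrow> 'a \<Rightarrow> ('a \<Rightarrow> real) \<Rightarrow> 'a \<Rightarrow> real" where
  "inherit S u h v = (if v \<in> mins S then h v else h u)"

text \<open>\<open>g0\<close>, \<open>g1\<close>, \<open>g2\<close> count words of which two, one or no letters have been peeled; the values \<open>g1\<close>, \<open>g2\<close>
  already contain the coordinates in the remaining directions (those lengthening another arc).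
  \<open>lform\<close> is the pairing of the vector with the direction that lengthens the first arc, that is,
  with the vector that is constantly 1.\<close>

definition qform :: "('a \<Rightarrow> real) \<Rightarrow> ('a set \<Rightarrow> real) \<Rightarrow> ('a set \<Rightarrow> real) \<Rightarrow> ('a set \<Rightarrow> real)
    \<Rightarrow> 'a set \<Rightarrow> ('a \<Rightarrow> real) \<Rightarrow> real" where
  "qform w g0 g1 g2 S h =
     (\<Sum>u\<in>mins S. \<Sum>v\<in>mins (S - {u}). w u * w v * h u * inherit S u h v * g0 (S - {u} - {v}))
     + 2 * (\<Sum>u\<in>mins S. w u * h u * g1 (S - {u})) + g2 S"

definition lform :: "('a \<Rightarrow> real) \<Rightarrow> ('a set \<Rightarrow> real) \<Rightarrow> ('a set \<Rightarrow> real)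
    \<Rightarrow> 'a set \<Rightarrow> ('a \<Rightarrow> real) \<Rightarrow> real" where
  "lform w g0 g1 S h = (\<Sum>u\<in>mins S. w u * h u * g0 (S - {u})) + g1 S"

lemma mins_subset: "mins S \<subseteq> S"
  by (auto simp: mins_def)

lemma finite_mins [simp]: "finite S \<Longrightarrow> finite (mins S)"
  using mins_subset finite_subset by blast

lemma mins_Diff: "\<lbrakk>v \<in> mins S; v \<noteq> u\<rbrakk> \<Longrightarrow> v \<in> mins (S - {u})"
  by (auto simp: mins_def)

lemma new_minsD: "\<lbrakk>v \<in> mins (S - {u}); v \<notin> mins S\<rbrakk> \<Longrightarrow> prec u v"
  by (auto simp: mins_def)

lemma sum_mins_Diff:
  fixes f :: "'a \<Rightarrow> real"
  assumes "finite S"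
  shows "(\<Sum>v\<in>mins (S - {u}). f v) = (\<Sum>v\<in>mins S - {u}. f v) + (\<Sum>v\<in>mins (S - {u}) - mins S. f v)"
proof -
  have "mins (S - {u}) = (mins S - {u}) \<union> (mins (S - {u}) - mins S)"
    using mins_Diff mins_subset by fastforce
  then show ?thesis
    using assms by (subst sum.union_disjoint[symmetric]) auto
qed

lemma sum_off_diagonal:
  fixes f :: "'b \<Rightarrow> 'b \<Rightarrow> real"
  assumes "finite I"
  shows "(\<Sum>u\<in>I. \<Sum>v\<in>I - {u}. f u v) = (\<Sum>u\<in>I. \<Sum>v\<in>I. if u = v then 0 else f u v)"
  by (intro sum.cong refl sum.mono_neutral_cong_left) (use assms in auto)

text \<open>Two minimal elements can be removed in either order, so their two terms are considered
  together; an element that becomes minimal only after \<open>u\<close> is gone occurs in a single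
  order.\<close>

lemma sum_pairs_nonneg:
  fixes \<phi> :: "'a \<Rightarrow> 'a \<Rightarrow> real"
  assumes "finite S"
    and swap: "\<And>u v. \<lbrakk>u \<in> mins S; v \<in> mins S; u \<noteq> v\<rbrakk> \<Longrightarrow> 0 \<le> \<phi> u v + \<phi> v u"
    and new: "\<And>u v. \<lbrakk>u \<in> mins S; v \<in> mins (S - {u}); v \<notin> mins S\<rbrakk> \<Longrightarrow> 0 \<le> \<phi> u v"
  shows "0 \<le> (\<Sum>u\<in>mins S. \<Sum>v\<in>mins (S - {u}). \<phi> u v)"
proof -
  let ?\<psi> = "\<lambda>u v. if u = v then 0 else \<phi> u v"
  have "2 * (\<Sum>u\<in>mins S. \<Sum>v\<in>mins S - {u}. \<phi> u v)
      = (\<Sum>u\<in>mins S. \<Sum>v\<in>mins S. ?\<psi> u v) + (\<Sum>u\<in>mins S. \<Sum>v\<in>mins S. ?\<psi> v u)"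
    using sum.swap[of ?\<psi> "mins S" "mins S"] assms(1) by (simp add: sum_off_diagonal)
  also have "\<dots> = (\<Sum>u\<in>mins S. \<Sum>v\<in>mins S. ?\<psi> u v + ?\<psi> v u)"
    by (simp add: sum.distrib)
  also have "\<dots> \<ge> 0"
    using swap by (intro sum_nonneg) auto
  finally have "0 \<le> (\<Sum>u\<in>mins S. \<Sum>v\<in>mins S - {u}. \<phi> u v)" by simp
  moreover have "0 \<le> (\<Sum>u\<in>mins S. \<Sum>v\<in>mins (S - {u}) - mins S. \<phi> u v)"
    using new by (intro sum_nonneg) auto
  ultimately show ?thesis
    using assms(1) by (simp add: sum_mins_Diff[OF assms(1)] sum.distrib)
qed

text \<open>The difference of the summands is antisymmetric on pairs of minimal elements and
  vanishes at new ones, where the value at \<open>u\<close> is inherited. Thus the pairing of a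
  vector with the vector that is constantly 1 does not depend on the order of the two.\<close>

lemma inherit_exchange:
  assumes "finite S"
  shows "(\<Sum>u\<in>mins S. \<Sum>v\<in>mins (S - {u}). w u * w v * inherit S u h v * f (S - {u} - {v}))
    = (\<Sum>u\<in>mins S. \<Sum>v\<in>mins (S - {u}). w u * w v * h u * f (S - {u} - {v}))"
proof -
  have *: "S - {u} - {v} = S - {v} - {u}" for u v by blast
  have "0 \<le> (\<Sum>u\<in>mins S. \<Sum>v\<in>mins (S - {u}).
      c * (w u * w v * (inherit S u h v - h u) * f (S - {u} - {v})))" for c :: real
    using assms
  proof (rule sum_pairs_nonneg)
    show "0 \<le> c * (w u * w v * (inherit S u h v - h u) * f (S - {u} - {v}))
      + c * (w v * w u * (inherit S v h u - h v) * f (S - {v} - {u}))"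
      if "u \<in> mins S" "v \<in> mins S" for u v
      using that by (simp add: inherit_def *[of v u] algebra_simps)
  qed (simp add: inherit_def)
  \<comment> \<open>Nonnegativity for both signs of \<open>c\<close> gives equality.\<close>
  from this[of 1] this[of "-1"]
  have "(\<Sum>u\<in>mins S. \<Sum>v\<in>mins (S - {u}).
      (w u * w v * (inherit S u h v - h u) * f (S - {u} - {v}))) = 0"
    by (simp add: sum_negf)
  then show ?thesis by (simp add: algebra_simps sum_subtractf)
qed

text \<open>The two sides differ only for triples in which \<open>z\<close> becomes minimal after both \<open>u\<close> and \<open>v\<close> have been
  removed, and there by the square of \<open>h u - h v\<close>.\<close>

lemma inherit_cubic:
  assumes "finite S" and w: "\<And>u. 0 \<le> w u" and f: "\<And>R. 0 \<le> f R"
  shows "(\<Sum>u\<in>mins S. \<Sum>v\<in>mins (S - {u}). \<Sum>z\<in>mins (S - {u} - {v}).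
        w u * w v * w z * h u * inherit S u h v * f (S - {u} - {v} - {z}))
    \<le> (\<Sum>u\<in>mins S. \<Sum>v\<in>mins (S - {u}). \<Sum>z\<in>mins (S - {u} - {v}).
        w u * w v * w z * inherit S u h v * inherit (S - {u}) v (inherit S u h) z * f (S - {u} - {v} - {z}))"
proof -
  define Y where "Y u v = (\<Sum>z\<in>mins (S - {u} - {v}).
      w z * inherit (S - {u}) v (inherit S u h) z * f (S - {u} - {v} - {z}))" for u v
  have *: "S - {u} - {v} = S - {v} - {u}" for u v by blast
  \<comment> \<open>For fixed \<open>u\<close>, \<open>inherit_exchange\<close> is applied to
    \<open>S - {u}\<close> and the transported vector; it shifts the value from the second letter to
    the third.\<close>
  have 1: "(\<Sum>v\<in>mins (S - {u}). \<Sum>z\<in>mins (S - {u} - {v}).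
        w u * w v * w z * h u * inherit S u h v * f (S - {u} - {v} - {z}))
      = (\<Sum>v\<in>mins (S - {u}). w u * w v * h u * Y u v)" for u
  proof -
    have "(\<Sum>v\<in>mins (S - {u}). \<Sum>z\<in>mins (S - {u} - {v}).
        w v * w z * inherit (S - {u}) v (inherit S u h) z * f (S - {u} - {v} - {z}))
      = (\<Sum>v\<in>mins (S - {u}). \<Sum>z\<in>mins (S - {u} - {v}).
        w v * w z * inherit S u h v * f (S - {u} - {v} - {z}))"
      by (rule inherit_exchange) (use assms(1) in simp)
    from arg_cong[OF this, of "\<lambda>s. w u * h u * s"] show ?thesis
      by (simp add: Y_def sum_distrib_left mult_ac)
  qed
  have "0 \<le> (\<Sum>u\<in>mins S. \<Sum>v\<in>mins (S - {u}). w u * w v * (inherit S u h v - h u) * Y u v)"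
    using assms(1)
  proof (rule sum_pairs_nonneg)
    fix u v assume uv: "u \<in> mins S" "v \<in> mins S" "u \<noteq> v"
    let ?d = "\<lambda>z. inherit (S - {u}) v (inherit S u h) z - inherit (S - {v}) u (inherit S v h) z"
    have "(h v - h u) * ?d z \<ge> 0" for z
      using uv mins_Diff[of u S v] mins_Diff[of v S u] new_minsD[of z S u] new_minsD[of z S v]
      by (auto simp: inherit_def mins_def)
    then have "0 \<le> (\<Sum>z\<in>mins (S - {u} - {v}). w z * f (S - {u} - {v} - {z}) * ((h v - h u) * ?d z))"
      by (intro sum_nonneg mult_nonneg_nonneg[OF mult_nonneg_nonneg[OF w f]])
    then have "0 \<le> w u * w v * (\<Sum>z\<in>mins (S - {u} - {v}). w z * f (S - {u} - {v} - {z}) * ((h v - h u) * ?d z))"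
      by (rule mult_nonneg_nonneg[OF mult_nonneg_nonneg[OF w w]])
    also have "(\<Sum>z\<in>mins (S - {u} - {v}). w z * f (S - {u} - {v} - {z}) * ((h v - h u) * ?d z))
        = (h v - h u) * (Y u v - Y v u)"
      unfolding Y_def *[of v u] sum_subtractf[symmetric] sum_distrib_left
      by (intro sum.cong refl) (simp add: algebra_simps)
    also have "w u * w v * ((h v - h u) * (Y u v - Y v u)) = w u * w v * (inherit S u h v - h u) * Y u v + w v * w u * (inherit S v h u - h v) * Y v u"
      using uv by (simp add: inherit_def algebra_simps)
    finally show "0 \<le> \<dots>" .
  qed (simp add: inherit_def)
  then have "(\<Sum>u\<in>mins S. \<Sum>v\<in>mins (S - {u}). w u * w v * h u * Y u v)
      \<le> (\<Sum>u\<in>mins S. \<Sum>v\<in>mins (S - {u}). w u * w v * inherit S u h v * Y u v)"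
    by (simp add: algebra_simps sum_subtractf)
  then show ?thesis
    unfolding 1 by (simp add: Y_def sum_distrib_left mult_ac)
qed

text \<open>The three parts of the form behave differently: the constant part is the recursion
  itself, the linear part is rewritten by \<open>inherit_exchange\<close>, and the quadratic part
  loses something by \<open>inherit_cubic\<close>. The functions \<open>h0\<close>,
  \<open>h1\<close>, \<open>h2\<close> are the remainders of the recursions, stemming from words
  whose first arc is empty.\<close>

lemma qform_pull:
  assumes "finite S" and w: "\<And>u. 0 \<le> w u" and g0: "\<And>R. 0 \<le> g0 R"
    and G0: "\<And>R. finite R \<Longrightarrow> G0 R = (\<Sum>u\<in>mins R. w u * g0 (R - {u})) + h0 R"
    and G1: "\<And>R. finite R \<Longrightarrow> G1 R = (\<Sum>u\<in>mins R. w u * g1 (R - {u})) + h1 R"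
    and G2: "\<And>R. finite R \<Longrightarrow> G2 R = (\<Sum>u\<in>mins R. w u * g2 (R - {u})) + h2 R"
  shows "qform w G0 G1 G2 S h
    \<le> (\<Sum>u\<in>mins S. w u * qform w g0 g1 g2 (S - {u}) (inherit S u h)) + qform w h0 h1 h2 S h"
proof -
  have fin: "finite (S - {u})" "finite (S - {u} - {v})" for u v using assms(1) by auto
  have "qform w G0 G1 G2 S h - qform w h0 h1 h2 S h
    = (\<Sum>u\<in>mins S. \<Sum>v\<in>mins (S - {u}). \<Sum>z\<in>mins (S - {u} - {v}).
        w u * w v * w z * h u * inherit S u h v * g0 (S - {u} - {v} - {z}))
      + 2 * (\<Sum>u\<in>mins S. \<Sum>v\<in>mins (S - {u}). w u * w v * h u * g1 (S - {u} - {v}))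
      + (\<Sum>u\<in>mins S. w u * g2 (S - {u}))"
    unfolding qform_def G0[OF fin(2)] G1[OF fin(1)] G2[OF assms(1)]
    by (simp add: distrib_left sum.distrib sum_distrib_left mult_ac)
  also have "\<dots> \<le> (\<Sum>u\<in>mins S. \<Sum>v\<in>mins (S - {u}). \<Sum>z\<in>mins (S - {u} - {v}).
        w u * w v * w z * inherit S u h v * inherit (S - {u}) v (inherit S u h) z * g0 (S - {u} - {v} - {z}))
      + 2 * (\<Sum>u\<in>mins S. \<Sum>v\<in>mins (S - {u}). w u * w v * inherit S u h v * g1 (S - {u} - {v}))
      + (\<Sum>u\<in>mins S. w u * g2 (S - {u}))"
    using inherit_cubic[OF assms(1) w g0, where h = h] inherit_exchange[OF assms(1), where w = w and h = h and f = g1] by simp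
  also have "\<dots> = (\<Sum>u\<in>mins S. w u * qform w g0 g1 g2 (S - {u}) (inherit S u h))"
    unfolding qform_def
    by (simp add: distrib_left sum.distrib sum_distrib_left mult_ac)
  finally show ?thesis by simp
qed

text \<open>All new minimal elements carry the value at \<open>u\<close>, so their weights are
  gathered in the diagonal entry at \<open>u\<close>. This turns pairing with the transported vector
  into a row of a matrix on \<open>mins S\<close>.\<close>

lemma sum_inherit:
  assumes "finite S" "u \<in> mins S"
  shows "(\<Sum>v\<in>mins (S - {u}). f v * inherit S u h v)
    = (\<Sum>v\<in>mins S. (if u = v then \<Sum>z\<in>mins (S - {u}) - mins S. f z else f v) * h v)"
proof -
  have "(\<Sum>v\<in>mins (S - {u}). f v * inherit S u h v)
    = (\<Sum>v\<in>mins S - {u}. f v * h v) + (\<Sum>v\<in>mins (S - {u}) - mins S. f v) * h u"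
    unfolding sum_mins_Diff[OF assms(1)] by (simp add: inherit_def sum_distrib_right)
  also have "(\<Sum>v\<in>mins S - {u}. f v * h v) = (\<Sum>v\<in>mins S - {u}. (if u = v then \<Sum>z\<in>mins (S - {u}) - mins S. f z else f v) * h v)"
    by (intro sum.cong) auto
  also have "\<dots> + (\<Sum>v\<in>mins (S - {u}) - mins S. f v) * h u = (\<Sum>v\<in>mins S. (if u = v then \<Sum>z\<in>mins (S - {u}) - mins S. f z else f v) * h v)"
    using assms by (subst (2) sum.remove[of _ u]) auto
  finally show ?thesis .
qed

text \<open>The inequality passes from the sets \<open>S - {u}\<close> to \<open>S\<close> by
  \<open>bochner\<close>. The vertices are the minimal elements; \<open>M u v\<close> weighs the
  words beginning with \<open>u\<close>, \<open>v\<close>, its diagonal collecting the words whose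
  second letter is new. The remainders \<open>h0\<close>, \<open>h1\<close>, \<open>h2\<close>
  supply the additional vertex, which is absent in the first alternative of the last
  hypothesis.\<close>

lemma peel_step:
  fixes w :: "'a \<Rightarrow> real" and g0 g1 g2 h0 h1 h2 :: "nat \<Rightarrow> 'a set \<Rightarrow> real"
  assumes fin: "finite S" and w: "\<And>u. 0 < w u" and g0: "\<And>m R. 0 \<le> g0 m R"
    and rec0: "\<And>m R. finite R \<Longrightarrow> g0 (Suc m) R = (\<Sum>u\<in>mins R. w u * g0 m (R - {u})) + h0 m R"
    and rec1: "\<And>m R. finite R \<Longrightarrow> g1 (Suc m) R = (\<Sum>u\<in>mins R. w u * g1 m (R - {u})) + h1 m R"
    and rec2: "\<And>m R. finite R \<Longrightarrow> g2 (Suc m) R = (\<Sum>u\<in>mins R. w u * g2 m (R - {u})) + h2 m R"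
    and IH: "\<And>u f. u \<in> mins S \<Longrightarrow>
      qform w (g0 n) (g1 n) (g2 n) (S - {u}) f * g0 (Suc (Suc n)) (S - {u})
        \<le> (lform w (g0 (Suc n)) (g1 (Suc n)) (S - {u}) f)\<^sup>2"
    and pos1: "\<And>u. u \<in> mins S \<Longrightarrow> 0 < g0 (Suc (Suc n)) (S - {u})"
    and pos2: "\<And>u v. \<lbrakk>u \<in> mins S; v \<in> mins S; u \<noteq> v\<rbrakk> \<Longrightarrow> 0 < g0 (Suc n) (S - {u} - {v})"
    and x: "(h0 (Suc (Suc n)) S = 0 \<and> h1 (Suc n) S = 0 \<and> (\<forall>u\<in>mins S. h0 (Suc n) (S - {u}) = 0)
        \<and> (\<forall>f. qform w (h0 n) (h1 n) (h2 n) S f \<le> 0))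
      \<or> (0 < h0 (Suc (Suc n)) S \<and> (\<forall>u\<in>mins S. 0 < h0 (Suc n) (S - {u}))
        \<and> (\<forall>f. qform w (h0 n) (h1 n) (h2 n) S f * h0 (Suc (Suc n)) S
              \<le> (lform w (h0 (Suc n)) (h1 (Suc n)) S f)\<^sup>2))"
  shows "qform w (g0 (Suc n)) (g1 (Suc n)) (g2 (Suc n)) S f * g0 (Suc (Suc (Suc n))) S
    \<le> (lform w (g0 (Suc (Suc n))) (g1 (Suc (Suc n))) S f)\<^sup>2"
proof -
  define M where "M u v = (if u = v then w u * (\<Sum>z\<in>mins (S - {u}) - mins S. w z * g0 (Suc n) (S - {u} - {z}))
      else w u * w v * g0 (Suc n) (S - {u} - {v}))" for u v
  define b where "b u = w u * g1 (Suc n) (S - {u})" for u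
  define m where "m u = w u * h0 (Suc n) (S - {u})" for u
  have finD: "finite (S - {u})" for u using fin by simp
  have M: "w u * (\<Sum>v\<in>mins (S - {u}). w v * inherit S u h v * g0 (Suc n) (S - {u} - {v})) = (\<Sum>v\<in>mins S. M u v * h v)"
    if "u \<in> mins S" for u h
  proof -
    have "(\<Sum>v\<in>mins (S - {u}). w v * inherit S u h v * g0 (Suc n) (S - {u} - {v}))
        = (\<Sum>v\<in>mins (S - {u}). w v * g0 (Suc n) (S - {u} - {v}) * inherit S u h v)"
      by (simp add: mult_ac)
    then show ?thesis
      unfolding sum_inherit[OF fin that]
      by (simp add: sum_distrib_left M_def) (intro sum.cong, auto simp: sum_distrib_left sum_distrib_right mult_ac)
  qed
  have k: "(\<Sum>v\<in>mins S. M u v * h v) + b u = w u * lform w (g0 (Suc n)) (g1 (Suc n)) (S - {u}) (inherit S u h)"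
    if "u \<in> mins S" for u h
    unfolding lform_def M[OF that, symmetric] b_def by (simp add: distrib_left)
  \<comment> \<open>Row sums are the image of the vector that is constantly 1, and transport leaves
    that vector unchanged.\<close>
  have W: "(\<Sum>v\<in>mins S. M u v) + m u = w u * g0 (Suc (Suc n)) (S - {u})" if "u \<in> mins S" for u
  proof -
    have "(\<Sum>v\<in>mins (S - {u}). w v * inherit S u (\<lambda>_. 1) v * g0 (Suc n) (S - {u} - {v}))
       = (\<Sum>v\<in>mins (S - {u}). w v * g0 (Suc n) (S - {u} - {v}))" by (simp add: inherit_def)
    then show ?thesis
      using M[OF that, of "\<lambda>_. 1"] unfolding rec0[of "S - {u}" "Suc n", OF finD] m_def by (simp add: distrib_left)
  qed
  have q: "(\<Sum>u\<in>mins S. \<Sum>v\<in>mins S. M u v * h u * h v) + 2 * (\<Sum>u\<in>mins S. b u * h u) + g2 (Suc n) S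
      = qform w (g0 (Suc n)) (g1 (Suc n)) (g2 (Suc n)) S h" for h
  proof -
    have "(\<Sum>v\<in>mins S. M u v * h u * h v)
        = (\<Sum>v\<in>mins (S - {u}). w u * w v * h u * inherit S u h v * g0 (Suc n) (S - {u} - {v}))"
      if "u \<in> mins S" for u
      using arg_cong[OF M[OF that, of h], of "\<lambda>s. h u * s"] by (simp add: sum_distrib_left mult_ac)
    then show ?thesis unfolding qform_def b_def by (simp add: mult_ac)
  qed
  have kx: "(\<Sum>u\<in>mins S. m u * h u) + h1 (Suc n) S = lform w (h0 (Suc n)) (h1 (Suc n)) S h" for h
    unfolding lform_def m_def by (simp add: mult_ac)
  have tot: "(\<Sum>u\<in>mins S. (\<Sum>v\<in>mins S. M u v) + m u) + h0 (Suc (Suc n)) S = g0 (Suc (Suc (Suc n))) S"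
    using W fin by (simp add: rec0)
  have ktot: "(\<Sum>u\<in>mins S. (\<Sum>v\<in>mins S. M u v * h v) + b u) + ((\<Sum>u\<in>mins S. m u * h u) + h1 (Suc n) S)
      = lform w (g0 (Suc (Suc n))) (g1 (Suc (Suc n))) S h" for h
  proof -
    have "(\<Sum>u\<in>mins S. (\<Sum>v\<in>mins S. M u v * h v) + b u)
        = (\<Sum>u\<in>mins S. \<Sum>v\<in>mins (S - {u}). w u * w v * inherit S u h v * g0 (Suc n) (S - {u} - {v})) + (\<Sum>u\<in>mins S. b u)"
      using M by (simp add: sum.distrib sum_distrib_left mult_ac)
    also have "\<dots> = (\<Sum>u\<in>mins S. \<Sum>v\<in>mins (S - {u}). w u * w v * h u * g0 (Suc n) (S - {u} - {v})) + (\<Sum>u\<in>mins S. b u)"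
      by (simp add: inherit_exchange[OF fin])
    finally show ?thesis
      unfolding kx unfolding lform_def rec0[of _ "Suc n", OF finD] rec1[of _ "Suc n", OF fin] b_def
      by (simp add: distrib_left sum.distrib sum_distrib_left mult_ac)
  qed
  have "((\<Sum>u\<in>mins S. \<Sum>v\<in>mins S. M u v * f u * f v) + 2 * (\<Sum>u\<in>mins S. b u * f u) + g2 (Suc n) S)
      * ((\<Sum>u\<in>mins S. (\<Sum>v\<in>mins S. M u v) + m u) + h0 (Suc (Suc n)) S)
    \<le> ((\<Sum>u\<in>mins S. (\<Sum>v\<in>mins S. M u v * f v) + b u) + ((\<Sum>u\<in>mins S. m u * f u) + h1 (Suc n) S))\<^sup>2"
  proof (rule bochner)
    show "finite (mins S)" using fin by simp
    show "M u v = M v u" for u v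
    proof -
      have "S - {u} - {v} = S - {v} - {u}" by blast
      then show ?thesis by (simp add: M_def)
    qed
    show "0 < M u v" if "u \<in> mins S" "v \<in> mins S" "u \<noteq> v" for u v
      using that w pos2 by (simp add: M_def)
    show "0 < (\<Sum>v\<in>mins S. M u v) + m u" if "u \<in> mins S" for u
      using that w pos1 by (simp add: W)
    show "h0 (Suc (Suc n)) S = 0 \<and> h1 (Suc n) S = 0 \<and> (\<forall>u\<in>mins S. m u = 0)
        \<or> 0 < h0 (Suc (Suc n)) S \<and> (\<forall>u\<in>mins S. 0 < m u)"
      using x w by (auto simp: m_def)
    show "(\<Sum>u\<in>mins S. \<Sum>v\<in>mins S. M u v * h u * h v) + 2 * (\<Sum>u\<in>mins S. b u * h u) + g2 (Suc n) S
      \<le> (\<Sum>u\<in>mins S. ((\<Sum>v\<in>mins S. M u v * h v) + b u)\<^sup>2 / ((\<Sum>v\<in>mins S. M u v) + m u))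
        + ((\<Sum>u\<in>mins S. m u * h u) + h1 (Suc n) S)\<^sup>2 / h0 (Suc (Suc n)) S" for h
    proof -
      \<comment> \<open>This is \<open>IH\<close> for the transported vector, divided by the
        positive number \<open>g0 (Suc (Suc n)) (S - {u})\<close>.\<close>
      have "w u * qform w (g0 n) (g1 n) (g2 n) (S - {u}) (inherit S u h)
          \<le> ((\<Sum>v\<in>mins S. M u v * h v) + b u)\<^sup>2 / ((\<Sum>v\<in>mins S. M u v) + m u)"
        if u: "u \<in> mins S" for u
        using IH[OF u, of "inherit S u h"] pos1[OF u] w[of u]
        unfolding k[OF u] W[OF u] by (simp add: field_simps power2_eq_square)
      moreover have "qform w (h0 n) (h1 n) (h2 n) S h
          \<le> ((\<Sum>u\<in>mins S. m u * h u) + h1 (Suc n) S)\<^sup>2 / h0 (Suc (Suc n)) S"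
        using x unfolding kx by (auto simp: field_simps)
      moreover have "qform w (g0 (Suc n)) (g1 (Suc n)) (g2 (Suc n)) S h
          \<le> (\<Sum>u\<in>mins S. w u * qform w (g0 n) (g1 n) (g2 n) (S - {u}) (inherit S u h))
            + qform w (h0 n) (h1 n) (h2 n) S h"
        using fin w g0 rec0 rec1 rec2 by (intro qform_pull) (auto simp: less_imp_le)
      ultimately show ?thesis unfolding q by (smt (verit) sum_mono)
    qed
  qed
  then show ?thesis unfolding q tot ktot .
qed

end

section \<open>Words divided into arcs of prescribed length\<close>

context peeling begin

text \<open>The vector that is constantly 1 lengthens the first arc. Hence the coefficients of
  \<tau> and its square count words with one and two more letters there, and
  \<open>inherit_exchange\<close> makes the two mixed terms equal.\<close>

lemma qform_shift:
  assumes fin: "finite S"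
    and G0: "\<And>R. finite R \<Longrightarrow> G0 R = (\<Sum>u\<in>mins R. w u * g0 (R - {u}))"
    and G0': "\<And>R. finite R \<Longrightarrow> G0' R = (\<Sum>u\<in>mins R. w u * G0 (R - {u}))"
    and G1: "\<And>R. finite R \<Longrightarrow> G1 R = (\<Sum>u\<in>mins R. w u * g1 (R - {u}))"
  shows "qform w g0 g1 g2 S (\<lambda>u. h u - \<tau>) = qform w g0 g1 g2 S h - 2 * \<tau> * lform w G0 G1 S h + \<tau>\<^sup>2 * G0' S"
proof -
  have finD: "finite (S - {u})" for u using fin by simp
  have "qform w g0 g1 g2 S (\<lambda>u. h u - \<tau>) = qform w g0 g1 g2 S h
     - \<tau> * (\<Sum>u\<in>mins S. \<Sum>v\<in>mins (S - {u}). w u * w v * inherit S u h v * g0 (S - {u} - {v}))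
     - \<tau> * (\<Sum>u\<in>mins S. \<Sum>v\<in>mins (S - {u}). w u * w v * h u * g0 (S - {u} - {v}))
     + \<tau>\<^sup>2 * (\<Sum>u\<in>mins S. \<Sum>v\<in>mins (S - {u}). w u * w v * g0 (S - {u} - {v}))
     - 2 * \<tau> * (\<Sum>u\<in>mins S. w u * g1 (S - {u}))"
  proof -
    have "inherit S u (\<lambda>u. h u - \<tau>) v = inherit S u h v - \<tau>" for u v by (simp add: inherit_def)
    then show ?thesis
      unfolding qform_def
      by (simp only:) (simp add: algebra_simps sum.distrib sum_subtractf sum_distrib_left power2_eq_square)
  qed
  then show ?thesis
    unfolding inherit_exchange[OF fin] lform_def G0'[OF fin] G1[OF fin] G0[OF finD]
    by (simp add: sum_distrib_left algebra_simps)
qed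

text \<open>When the first arc is exhausted, its vectors are rescaled to vectors on the next arc. For two minimal
  elements nothing changes, and for \<open>u\<close> below a new element \<open>v\<close> the form increases by the ratio condition.\<close>

lemma qform_collapse:
  assumes fin: "finite S"
    and pos: "\<And>u. 0 < w u" "\<And>u. 0 < w1 u" and g0: "\<And>R. 0 \<le> g0 R"
    and ratio: "\<And>u v. prec u v \<Longrightarrow> w v * w1 u \<le> w u * w1 v"
    and G0: "\<And>R. finite R \<Longrightarrow> G0 R = (\<Sum>u\<in>mins R. w1 u * g0 (R - {u}))"
    and G0': "\<And>R. finite R \<Longrightarrow> G0' R = (\<Sum>u\<in>mins R. w1 u * G0 (R - {u}))"
    and G1: "\<And>R. finite R \<Longrightarrow> G1 R = (\<Sum>u\<in>mins R. w1 u * g1 (R - {u}))"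
  shows "qform w g0 (\<lambda>R. a * G0 R + g1 R) (\<lambda>R. a\<^sup>2 * G0' R + 2 * a * G1 R + g2 R) S h
    \<le> qform w1 g0 g1 g2 S (\<lambda>u. w u / w1 u * h u + a)"
proof -
  define g where "g u = w u / w1 u * h u" for u
  have g: "w1 u * g u = w u * h u" for u using pos(2)[of u] by (simp add: g_def)
  have "w u * w v * h u * inherit S u h v \<le> w1 u * w1 v * g u * inherit S u g v"
    if "u \<in> mins S" "v \<in> mins (S - {u})" for u v
  proof (cases "v \<in> mins S")
    case True
    then have "w u * w v * h u * inherit S u h v = (w u * h u) * (w v * h v)" by (simp add: inherit_def)
    also have "\<dots> = w1 u * w1 v * g u * inherit S u g v"
      using True unfolding g[symmetric] by (simp add: inherit_def)
    finally show ?thesis by simp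
  next
    case False
    then have "w v * w1 u \<le> w u * w1 v" using new_minsD that ratio by blast
    then have "(w v * w1 u) * (w u * (h u)\<^sup>2 / w1 u) \<le> (w u * w1 v) * (w u * (h u)\<^sup>2 / w1 u)"
      using pos[of u] by (intro mult_right_mono) (auto simp: less_imp_le)
    then show ?thesis using False pos(2)[of u]
      by (simp add: inherit_def g_def power2_eq_square mult_ac)
  qed
  then have le: "(\<Sum>u\<in>mins S. \<Sum>v\<in>mins (S - {u}). w u * w v * h u * inherit S u h v * g0 (S - {u} - {v}))
    \<le> (\<Sum>u\<in>mins S. \<Sum>v\<in>mins (S - {u}). w1 u * w1 v * g u * inherit S u g v * g0 (S - {u} - {v}))"
    using g0 by (intro sum_mono mult_right_mono) auto
  \<comment> \<open>The coordinate \<open>a\<close> of the arc that has become the first one acts as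
    a shift along the constant vector.\<close>
  have "qform w1 g0 g1 g2 S (\<lambda>u. w u / w1 u * h u + a)
      = qform w1 g0 g1 g2 S g + 2 * a * lform w1 G0 G1 S g + a\<^sup>2 * G0' S"
    using qform_shift[where h = g and \<tau> = "- a", OF fin G0 G0' G1] by (simp add: g_def)
  then show ?thesis
    using le unfolding qform_def lform_def g
    by (simp add: algebra_simps sum.distrib sum_distrib_left)
qed

section \<open>Weighted sums over words and arcs of letters\<close>

text \<open>Unfolded, this is a sum over the linear extensions of \<open>S\<close>, each
  contributing the product of its letters' weights, where the weight function depends on the place
  of the letter.\<close>

primrec peel_sum :: "('a \<Rightarrow> real) list \<Rightarrow> 'a set \<Rightarrow> real" where
  "peel_sum [] S = (if S = {} then 1 else 0)"
| "peel_sum (w # ws) S = (\<Sum>u\<in>mins S. w u * peel_sum ws (S - {u}))"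

lemma peel_sum_nonneg: "\<forall>w\<in>set ws. \<forall>u. 0 \<le> w u \<Longrightarrow> 0 \<le> peel_sum ws S"
  by (induction ws arbitrary: S) (auto intro!: sum_nonneg)

lemma peel_sum_eq_0: "finite S \<Longrightarrow> card S \<noteq> length ws \<Longrightarrow> peel_sum ws S = 0"
proof (induction ws arbitrary: S)
  case (Cons w ws)
  show ?case
    unfolding peel_sum.simps
  proof (intro sum.neutral ballI)
    fix u assume "u \<in> mins S"
    then have "u \<in> S" using mins_subset by blast
    then have "card (S - {u}) \<noteq> length ws" using Cons.prems card_Suc_Diff1[of S u] by auto
    then show "w u * peel_sum ws (S - {u}) = 0" using Cons by simp
  qed
qed auto

definition arcs :: "(('a \<Rightarrow> real) \<times> nat) list \<Rightarrow> ('a \<Rightarrow> real) list" where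
  "arcs ps = concat (map (\<lambda>(w, n). replicate n w) ps)"

definition bump :: "nat \<Rightarrow> (('a \<Rightarrow> real) \<times> nat) list \<Rightarrow> (('a \<Rightarrow> real) \<times> nat) list" where
  "bump s ps = ps[s := (fst (ps ! s), Suc (snd (ps ! s)))]"

lemma arcs_simps [simp]: "arcs [] = []" "arcs ((w, n) # ps) = replicate n w @ arcs ps"
  by (simp_all add: arcs_def)

lemma bump_simps [simp]: "bump 0 ((w, n) # ps) = (w, Suc n) # ps"
  "bump (Suc s) (p # ps) = p # bump s ps"
  by (simp_all add: bump_def)

lemma length_bump [simp]: "length (bump s ps) = length ps"
  by (simp add: bump_def)

lemma in_set_arcsD: "w \<in> set (arcs ps) \<Longrightarrow> \<exists>p\<in>set ps. w = fst p"
  by (force simp: arcs_def)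

lemma length_arcs_bump: "s < length ps \<Longrightarrow> length (arcs (bump s ps)) = Suc (length (arcs ps))"
proof (induction ps arbitrary: s)
  case (Cons p ps)
  then show ?case by (cases s; cases p) auto
qed simp

text \<open>The first arc has \<open>n\<close> letters of weight \<open>w\<close>; \<open>\<alpha> s\<close> is the coordinate of the direction that lengthens
  the arc with index \<open>s\<close> in \<open>ps\<close>.\<close>

definition rigid0 where
  "rigid0 w ps n S = peel_sum (replicate n w @ arcs ps) S"

definition rigid1 where
  "rigid1 w ps \<alpha> n S = (\<Sum>s<length ps. \<alpha> s * rigid0 w (bump s ps) n S)"

definition rigid2 where
  "rigid2 w ps \<alpha> n S = (\<Sum>s<length ps. \<Sum>t<length ps. \<alpha> s * \<alpha> t * rigid0 w (bump s (bump t ps)) n S)"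

lemma rigid0_nonneg:
  assumes "\<And>u. 0 < w u" "\<forall>p\<in>set ps. \<forall>u. 0 < fst p u"
  shows "0 \<le> rigid0 w ps n S"
  unfolding rigid0_def
proof (rule peel_sum_nonneg, intro ballI allI)
  fix w' u assume "w' \<in> set (replicate n w @ arcs ps)"
  then show "0 \<le> w' u" using assms in_set_arcsD[of w' ps] less_imp_le
    by (metis Un_iff in_set_replicate set_append)
qed

lemma rigid0_Suc: "rigid0 w ps (Suc n) S = (\<Sum>u\<in>mins S. w u * rigid0 w ps n (S - {u}))"
  by (simp add: rigid0_def)

lemma rigid1_Suc: "rigid1 w ps \<alpha> (Suc n) S = (\<Sum>u\<in>mins S. w u * rigid1 w ps \<alpha> n (S - {u}))"
  unfolding rigid1_def rigid0_Suc sum_distrib_left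
  by (subst sum.swap) (simp add: mult_ac)

lemma rigid2_Suc: "rigid2 w ps \<alpha> (Suc n) S = (\<Sum>u\<in>mins S. w u * rigid2 w ps \<alpha> n (S - {u}))"
proof -
  have "rigid2 w ps \<alpha> (Suc n) S = (\<Sum>s<length ps. \<Sum>u\<in>mins S. \<Sum>t<length ps. w u * (\<alpha> s * \<alpha> t * rigid0 w (bump s (bump t ps)) n (S - {u})))"
    unfolding rigid2_def rigid0_Suc sum_distrib_left
    by (rule sum.cong[OF refl], subst sum.swap) (simp add: mult_ac)
  also have "\<dots> = (\<Sum>u\<in>mins S. \<Sum>s<length ps. \<Sum>t<length ps. w u * (\<alpha> s * \<alpha> t * rigid0 w (bump s (bump t ps)) n (S - {u})))"
    by (rule sum.swap)
  finally show ?thesis by (simp add: rigid2_def sum_distrib_left)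
qed

text \<open>An empty first arc leaves the next one in its place. The index 0 is split off from the
  sums because its direction is now expressed by a larger length \<open>m\<close>.\<close>

lemma rigid_collapse:
  shows "rigid0 w ((w1, m) # ps) 0 = rigid0 w1 ps m"
    and "rigid1 w ((w1, m) # ps) \<alpha> 0 = (\<lambda>R. \<alpha> 0 * rigid0 w1 ps (Suc m) R + rigid1 w1 ps (\<lambda>s. \<alpha> (Suc s)) m R)"
    and "rigid2 w ((w1, m) # ps) \<alpha> 0 = (\<lambda>R. (\<alpha> 0)\<^sup>2 * rigid0 w1 ps (Suc (Suc m)) R
       + 2 * \<alpha> 0 * rigid1 w1 ps (\<lambda>s. \<alpha> (Suc s)) (Suc m) R + rigid2 w1 ps (\<lambda>s. \<alpha> (Suc s)) m R)"
proof -
  show "rigid0 w ((w1, m) # ps) 0 = rigid0 w1 ps m"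
    by (simp add: rigid0_def fun_eq_iff)
  have 0: "rigid0 w ((w1, k) # qs) 0 R = rigid0 w1 qs k R" for k qs R by (simp add: rigid0_def)
  show "rigid1 w ((w1, m) # ps) \<alpha> 0 = (\<lambda>R. \<alpha> 0 * rigid0 w1 ps (Suc m) R + rigid1 w1 ps (\<lambda>s. \<alpha> (Suc s)) m R)"
    by (simp only: rigid1_def fun_eq_iff length_Cons sum.lessThan_Suc_shift bump_simps 0) simp
  show "rigid2 w ((w1, m) # ps) \<alpha> 0 = (\<lambda>R. (\<alpha> 0)\<^sup>2 * rigid0 w1 ps (Suc (Suc m)) R
       + 2 * \<alpha> 0 * rigid1 w1 ps (\<lambda>s. \<alpha> (Suc s)) (Suc m) R + rigid2 w1 ps (\<lambda>s. \<alpha> (Suc s)) m R)"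
    by (simp only: rigid1_def rigid2_def fun_eq_iff length_Cons sum.lessThan_Suc_shift bump_simps 0)
      (simp add: sum.distrib sum_distrib_left power2_eq_square mult_ac)
qed

end

locale strict_poset = peeling +
  assumes irrefl: "\<not> prec u u"
    and trans: "\<lbrakk>prec u v; prec v w\<rbrakk> \<Longrightarrow> prec u w"
begin

section \<open>Hyperbolicity for words with arcs of prescribed length\<close>

lemma mins_nonempty: "\<lbrakk>finite S; S \<noteq> {}\<rbrakk> \<Longrightarrow> mins S \<noteq> {}"
proof (induction S rule: finite_ne_induct)
  case (singleton x)
  then show ?case using irrefl by (auto simp: mins_def)
next
  case (insert x S)
  then obtain m where m: "m \<in> S" "\<forall>v\<in>S. \<not> prec v m" by (auto simp: mins_def)
  show ?case
  proof (cases "prec x m")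
    case True
    then have "x \<in> mins (insert x S)"
      using m irrefl trans by (auto simp: mins_def)
    then show ?thesis by blast
  next
    case False
    then have "m \<in> mins (insert x S)" using m by (auto simp: mins_def)
    then show ?thesis by blast
  qed
qed

lemma peel_sum_pos:
  "\<lbrakk>finite S; card S = length ws; \<forall>w\<in>set ws. \<forall>u. 0 < w u\<rbrakk> \<Longrightarrow> 0 < peel_sum ws S"
proof (induction ws arbitrary: S)
  case (Cons w ws)
  have "S \<noteq> {}" using Cons.prems by auto
  then have "mins S \<noteq> {}" using Cons.prems mins_nonempty by blast
  moreover have "0 < w u * peel_sum ws (S - {u})" if "u \<in> mins S" for u
  proof -
    have "u \<in> S" using that mins_subset by blast
    then show ?thesis using Cons by auto
  qed
  ultimately show ?case using Cons.prems by (auto intro!: sum_pos)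
qed auto

text \<open>Being bounded by the square of a linear form is equivalent to having at most one positive eigenvalue,
  and is visibly stable under linear substitutions and under decreasing the form.\<close>

definition majorized where
  "majorized w ps n S \<longleftrightarrow> (\<exists>c d. \<forall>h \<alpha>.
     qform w (rigid0 w ps n) (rigid1 w ps \<alpha> n) (rigid2 w ps \<alpha> n) S h
       \<le> ((\<Sum>u\<in>mins S. c u * h u) + (\<Sum>s<length ps. d s * \<alpha> s))\<^sup>2)"

text \<open>For two letters the form is explicit: \<open>w a * w b\<close> times the square of
  \<open>h a\<close> if \<open>a\<close> is below \<open>b\<close>, and times
  \<open>2 * h a * h b\<close> if they are incomparable, which is at most the square of the
  sum.\<close>

lemma majorized_pair:
  assumes "finite S" "card S = 2" "\<And>u. 0 < w u"
  shows "majorized w [] 0 S"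
proof -
  have "S \<noteq> {}" using assms(2) by auto
  then have "mins S \<noteq> {}" using assms(1) mins_nonempty by blast
  then obtain a where a: "a \<in> mins S" by blast
  then have aS: "a \<in> S" "\<forall>v\<in>S. \<not> prec v a" by (auto simp: mins_def)
  then have "card (S - {a}) = 1" using assms by simp
  then obtain b where b: "S - {a} = {b}" by (auto simp: card_1_singleton_iff)
  then have S: "S = {a, b}" "a \<noteq> b" using aS by auto
  have sg: "mins {v} = {v}" for v using irrefl by (auto simp: mins_def)
  have ab: "{a, b} - {a} = {b}" "{a, b} - {b} = {a}" using S by auto
  have r: "rigid0 w [] 0 R = (if R = {} then 1 else 0)" "rigid1 w [] \<alpha> 0 R = 0" "rigid2 w [] \<alpha> 0 R = 0" for R \<alpha>
    by (auto simp: rigid0_def rigid1_def rigid2_def)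
  define k where "k = sqrt (w a * w b)"
  have k: "w a * w b = k * k"
    using assms(3)[of a] assms(3)[of b] by (simp add: k_def)
  show ?thesis
  proof (cases "prec a b")
    case True
    then have m: "mins S = {a}" using S aS irrefl by (auto simp: mins_def)
    have "qform w (rigid0 w [] 0) (rigid1 w [] \<alpha> 0) (rigid2 w [] \<alpha> 0) S h = (k * h a)\<^sup>2" for h \<alpha>
    proof -
      have "qform w (rigid0 w [] 0) (rigid1 w [] \<alpha> 0) (rigid2 w [] \<alpha> 0) S h = w a * w b * (h a * h a)"
        using S unfolding qform_def m by (simp add: ab sg r inherit_def m[unfolded S(1)])
      then show ?thesis by (simp add: k power2_eq_square)
    qed
    then show ?thesis unfolding majorized_def m
      by (intro exI[of _ "\<lambda>_. k"]) simp
  next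
    case False
    then have m: "mins S = {a, b}" using S aS irrefl by (auto simp: mins_def)
    have "qform w (rigid0 w [] 0) (rigid1 w [] \<alpha> 0) (rigid2 w [] \<alpha> 0) S h \<le> (k * h a + k * h b)\<^sup>2" for h \<alpha>
    proof -
      have "qform w (rigid0 w [] 0) (rigid1 w [] \<alpha> 0) (rigid2 w [] \<alpha> 0) S h = w a * w b * (2 * (h a * h b))"
        using S unfolding qform_def m by (simp add: ab sg r inherit_def m[unfolded S(1)])
      also have "\<dots> \<le> w a * w b * (h a + h b)\<^sup>2"
        using assms(3)[of a] assms(3)[of b]
        by (intro mult_left_mono) (auto simp: power2_sum)
      finally show ?thesis by (simp add: k power2_eq_square algebra_simps)
    qed
    then show ?thesis unfolding majorized_def m using S
      by (intro exI[of _ "\<lambda>_. k"]) simp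
  qed
qed

text \<open>The square for the shorter list is pulled back along the substitution of
  \<open>qform_collapse\<close>. There \<alpha> at 0 is added to every entry of the vector, so its
  coefficient is the sum of all \<open>c u\<close>.\<close>

lemma majorized_collapse:
  assumes fin: "finite S" and pos: "\<And>u. 0 < w u" "\<And>u. 0 < w1 u" "\<forall>p\<in>set ps. \<forall>u. 0 < fst p u"
    and ratio: "\<And>u v. prec u v \<Longrightarrow> w v * w1 u \<le> w u * w1 v"
    and maj: "majorized w1 ps m S"
  shows "majorized w ((w1, m) # ps) 0 S"
proof -
  obtain c d where cd: "\<And>h \<alpha>. qform w1 (rigid0 w1 ps m) (rigid1 w1 ps \<alpha> m) (rigid2 w1 ps \<alpha> m) S h
       \<le> ((\<Sum>u\<in>mins S. c u * h u) + (\<Sum>s<length ps. d s * \<alpha> s))\<^sup>2"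
    using maj unfolding majorized_def by blast
  have nn: "0 \<le> rigid0 w1 ps m R" for R
    using pos(2,3) by (rule rigid0_nonneg)
  have "qform w (rigid0 w ((w1, m) # ps) 0) (rigid1 w ((w1, m) # ps) \<alpha> 0) (rigid2 w ((w1, m) # ps) \<alpha> 0) S h
    \<le> ((\<Sum>u\<in>mins S. c u * (w u / w1 u) * h u)
      + (\<Sum>s<length ((w1, m) # ps). (case s of 0 \<Rightarrow> (\<Sum>u\<in>mins S. c u) | Suc s \<Rightarrow> d s) * \<alpha> s))\<^sup>2" for h \<alpha>
  proof -
    have "qform w (rigid0 w ((w1, m) # ps) 0) (rigid1 w ((w1, m) # ps) \<alpha> 0) (rigid2 w ((w1, m) # ps) \<alpha> 0) S h
      \<le> qform w1 (rigid0 w1 ps m) (rigid1 w1 ps (\<lambda>s. \<alpha> (Suc s)) m) (rigid2 w1 ps (\<lambda>s. \<alpha> (Suc s)) m) S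
         (\<lambda>u. w u / w1 u * h u + \<alpha> 0)"
      unfolding rigid_collapse
      by (rule qform_collapse[OF fin pos(1,2) nn ratio rigid0_Suc rigid0_Suc rigid1_Suc])
    also have "\<dots> \<le> ((\<Sum>u\<in>mins S. c u * (w u / w1 u * h u + \<alpha> 0)) + (\<Sum>s<length ps. d s * \<alpha> (Suc s)))\<^sup>2"
      by (rule cd)
    also have "(\<Sum>u\<in>mins S. c u * (w u / w1 u * h u + \<alpha> 0))
        = (\<Sum>u\<in>mins S. c u * (w u / w1 u) * h u) + (\<Sum>u\<in>mins S. c u) * \<alpha> 0"
      by (simp only: distrib_left sum.distrib sum_distrib_right mult.assoc)
    finally show ?thesis
      by (simp add: sum.lessThan_Suc_shift add_ac del: sum.lessThan_Suc)
  qed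
  then show ?thesis unfolding majorized_def
    by (intro exI[of _ "\<lambda>u. c u * (w u / w1 u)"] exI[of _ "case_nat (\<Sum>u\<in>mins S. c u) d"] allI)
qed

text \<open>Subtracting a constant \<tau> from \<open>h\<close> makes the form a quadratic
  polynomial and the majorizing linear form an affine function of \<tau>; the discriminant of the
  polynomial is the claim.\<close>

lemma majorizedD:
  assumes fin: "finite S" and maj: "majorized w ps n S" and nn: "0 \<le> rigid0 w ps (Suc (Suc n)) S"
  shows "qform w (rigid0 w ps n) (rigid1 w ps \<alpha> n) (rigid2 w ps \<alpha> n) S h * rigid0 w ps (Suc (Suc n)) S
    \<le> (lform w (rigid0 w ps (Suc n)) (rigid1 w ps \<alpha> (Suc n)) S h)\<^sup>2"
proof -
  obtain c d where cd: "\<And>h \<alpha>. qform w (rigid0 w ps n) (rigid1 w ps \<alpha> n) (rigid2 w ps \<alpha> n) S h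
       \<le> ((\<Sum>u\<in>mins S. c u * h u) + (\<Sum>s<length ps. d s * \<alpha> s))\<^sup>2"
    using maj unfolding majorized_def by blast
  show ?thesis
  proof (rule discriminant_of_majorization[OF _ nn])
    fix \<tau>
    have "qform w (rigid0 w ps n) (rigid1 w ps \<alpha> n) (rigid2 w ps \<alpha> n) S h
        - 2 * \<tau> * lform w (rigid0 w ps (Suc n)) (rigid1 w ps \<alpha> (Suc n)) S h + \<tau>\<^sup>2 * rigid0 w ps (Suc (Suc n)) S
      = qform w (rigid0 w ps n) (rigid1 w ps \<alpha> n) (rigid2 w ps \<alpha> n) S (\<lambda>u. h u - \<tau>)"
      by (rule qform_shift[symmetric, OF fin rigid0_Suc rigid0_Suc rigid1_Suc])
    also have "\<dots> \<le> ((\<Sum>u\<in>mins S. c u * (h u - \<tau>)) + (\<Sum>s<length ps. d s * \<alpha> s))\<^sup>2"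
      by (rule cd)
    also have "\<dots> = (((\<Sum>u\<in>mins S. c u * h u) + (\<Sum>s<length ps. d s * \<alpha> s)) - \<tau> * (\<Sum>u\<in>mins S. c u))\<^sup>2"
    proof -
      have "(\<Sum>u\<in>mins S. c u * (h u - \<tau>)) = (\<Sum>u\<in>mins S. c u * h u) - \<tau> * (\<Sum>u\<in>mins S. c u)"
        by (simp add: right_diff_distrib sum_subtractf sum_distrib_left mult_ac)
      then show ?thesis by (simp only: diff_add_eq)
    qed
    finally show "qform w (rigid0 w ps n) (rigid1 w ps \<alpha> n) (rigid2 w ps \<alpha> n) S h
        - 2 * \<tau> * lform w (rigid0 w ps (Suc n)) (rigid1 w ps \<alpha> (Suc n)) S h + \<tau>\<^sup>2 * rigid0 w ps (Suc (Suc n)) S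
      \<le> (((\<Sum>u\<in>mins S. c u * h u) + (\<Sum>s<length ps. d s * \<alpha> s)) - \<tau> * (\<Sum>u\<in>mins S. c u))\<^sup>2" .
  qed
qed

text \<open>Majorization of the smaller sets gives the inequalities that \<open>peel_step\<close>
  consumes. Its conclusion is again a majorization, after division by the positive number
  \<open>G\<close>.\<close>

lemma majorized_step:
  assumes fin: "finite S" and card: "card S = n + length (arcs ps) + 3"
    and pos: "\<And>u. 0 < w u" "\<forall>p\<in>set ps. \<forall>u. 0 < fst p u"
    and IH: "\<And>u. u \<in> mins S \<Longrightarrow> majorized w ps n (S - {u})"
  shows "majorized w ps (Suc n) S"
proof -
  have posr: "0 < rigid0 w ps m R" if "finite R" "card R = m + length (arcs ps)" for m R
    unfolding rigid0_def
  proof (rule peel_sum_pos)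
    show "\<forall>w'\<in>set (replicate m w @ arcs ps). \<forall>u. 0 < w' u"
    proof (intro ballI allI)
      fix w' u assume "w' \<in> set (replicate m w @ arcs ps)"
      then show "0 < w' u" using pos in_set_arcsD[of w' ps] by auto
    qed
  qed (use that in auto)
  have nn: "0 \<le> rigid0 w ps m R" for m R
    using pos by (rule rigid0_nonneg)
  define G where "G = rigid0 w ps (Suc (Suc (Suc n))) S"
  have G: "G > 0" unfolding G_def using fin card by (intro posr) auto
  have card1: "card (S - {u}) = n + length (arcs ps) + 2" if "u \<in> mins S" for u
  proof -
    have "u \<in> S" using that mins_subset by blast
    then show ?thesis using card fin by simp
  qed
  have card2: "card (S - {u} - {v}) = n + length (arcs ps) + 1" if "u \<in> mins S" "v \<in> mins S" "u \<noteq> v" for u v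
  proof -
    have "v \<in> S - {u}" using that mins_subset by blast
    then show ?thesis using card1[OF that(1)] card_Diff_singleton[of v "S - {u}"] by simp
  qed
  have claim: "qform w (rigid0 w ps (Suc n)) (rigid1 w ps \<alpha> (Suc n)) (rigid2 w ps \<alpha> (Suc n)) S h * G
    \<le> (lform w (rigid0 w ps (Suc (Suc n))) (rigid1 w ps \<alpha> (Suc (Suc n))) S h)\<^sup>2" for h \<alpha>
    unfolding G_def
  \<comment> \<open>The first arc is not empty, so every word loses a letter of it and the
    recursions have no remainder.\<close>
  proof (rule peel_step[where ?h0.0 = "\<lambda>_ _. 0" and ?h1.0 = "\<lambda>_ _. 0" and ?h2.0 = "\<lambda>_ _. 0"])
    show "qform w (rigid0 w ps n) (rigid1 w ps \<alpha> n) (rigid2 w ps \<alpha> n) (S - {u}) f * rigid0 w ps (Suc (Suc n)) (S - {u})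
       \<le> (lform w (rigid0 w ps (Suc n)) (rigid1 w ps \<alpha> (Suc n)) (S - {u}) f)\<^sup>2" if "u \<in> mins S" for u f
      using fin by (intro majorizedD IH that nn) auto
    show "0 < rigid0 w ps (Suc (Suc n)) (S - {u})" if "u \<in> mins S" for u
      using fin card1[OF that] by (intro posr) auto
    show "0 < rigid0 w ps (Suc n) (S - {u} - {v})" if "u \<in> mins S" "v \<in> mins S" "u \<noteq> v" for u v
      using fin card2[OF that] by (intro posr) auto
    show "finite S" by (rule fin)
    show "0 < w u" for u by (rule pos)
    show "0 \<le> rigid0 w ps m R" for m R by (rule nn)
    show "rigid0 w ps (Suc m) R = (\<Sum>u\<in>mins R. w u * rigid0 w ps m (R - {u})) + 0" for m R by (simp add: rigid0_Suc)
    show "rigid1 w ps \<alpha> (Suc m) R = (\<Sum>u\<in>mins R. w u * rigid1 w ps \<alpha> m (R - {u})) + 0" for m R by (simp add: rigid1_Suc)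
    show "rigid2 w ps \<alpha> (Suc m) R = (\<Sum>u\<in>mins R. w u * rigid2 w ps \<alpha> m (R - {u})) + 0" for m R by (simp add: rigid2_Suc)
  qed (simp_all add: qform_def)
  have "qform w (rigid0 w ps (Suc n)) (rigid1 w ps \<alpha> (Suc n)) (rigid2 w ps \<alpha> (Suc n)) S h
    \<le> ((\<Sum>u\<in>mins S. w u * rigid0 w ps (Suc (Suc n)) (S - {u}) / sqrt G * h u)
      + (\<Sum>s<length ps. rigid0 w (bump s ps) (Suc (Suc n)) S / sqrt G * \<alpha> s))\<^sup>2" for h \<alpha>
  proof -
    have "qform w (rigid0 w ps (Suc n)) (rigid1 w ps \<alpha> (Suc n)) (rigid2 w ps \<alpha> (Suc n)) S h
      \<le> (lform w (rigid0 w ps (Suc (Suc n))) (rigid1 w ps \<alpha> (Suc (Suc n))) S h / sqrt G)\<^sup>2"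
      using claim[of \<alpha> h] G by (simp add: power_divide pos_le_divide_eq)
    also have "lform w (rigid0 w ps (Suc (Suc n))) (rigid1 w ps \<alpha> (Suc (Suc n))) S h / sqrt G
      = (\<Sum>u\<in>mins S. w u * rigid0 w ps (Suc (Suc n)) (S - {u}) / sqrt G * h u)
      + (\<Sum>s<length ps. rigid0 w (bump s ps) (Suc (Suc n)) S / sqrt G * \<alpha> s)"
      by (simp add: lform_def rigid1_def add_divide_distrib sum_divide_distrib mult_ac)
    finally show ?thesis .
  qed
  then show ?thesis unfolding majorized_def
    by (intro exI[of _ "\<lambda>u. w u * rigid0 w ps (Suc (Suc n)) (S - {u}) / sqrt G"]
        exI[of _ "\<lambda>s. rigid0 w (bump s ps) (Suc (Suc n)) S / sqrt G"] allI)
qed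

text \<open>The form counts words with two letters more than \<open>n\<close> and \<open>ps\<close>
  prescribe; for any other cardinality all its coefficients vanish.\<close>

lemma majorized_degenerate:
  assumes fin: "finite S" and card: "card S \<noteq> n + length (arcs ps) + 2"
  shows "majorized w ps n S"
proof -
  have z: "rigid0 w ps n (S - {u} - {v}) = 0" if "u \<in> mins S" "v \<in> mins (S - {u})" for u v
  proof -
    have "u \<in> S" "v \<in> S - {u}" using that mins_subset by blast+
    then have "card (S - {u} - {v}) + 2 = card S"
      using fin card_Suc_Diff1[of S u] card_Suc_Diff1[of "S - {u}" v] by simp
    then show ?thesis using fin card unfolding rigid0_def by (intro peel_sum_eq_0) auto
  qed
  have z1: "rigid0 w (bump s ps) n (S - {u}) = 0" if "u \<in> mins S" "s < length ps" for u s
  proof -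
    have "u \<in> S" using that mins_subset by blast
    then have "card (S - {u}) + 1 = card S" using fin card_Suc_Diff1[of S u] by simp
    then show ?thesis using fin card that unfolding rigid0_def by (intro peel_sum_eq_0) (auto simp: length_arcs_bump)
  qed
  have z2: "rigid0 w (bump s (bump t ps)) n S = 0" if "s < length ps" "t < length ps" for s t
    using fin card that unfolding rigid0_def by (intro peel_sum_eq_0) (auto simp: length_arcs_bump)
  have "qform w (rigid0 w ps n) (rigid1 w ps \<alpha> n) (rigid2 w ps \<alpha> n) S h = 0" for h \<alpha>
    by (simp add: qform_def rigid1_def rigid2_def z z1 z2)
  then show ?thesis unfolding majorized_def by (intro exI[of _ "\<lambda>_. 0"]) simp
qed

text \<open>Outer induction on the list of arcs, inner induction on the length of the first arc. A
  letter is removed by \<open>majorized_step\<close>, an exhausted arc by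
  \<open>majorized_collapse\<close>, and a single exhausted arc is the case of two letters.\<close>

theorem rigid_majorized:
  assumes "finite S" "\<And>u. 0 < w u" "\<forall>p\<in>set ps. \<forall>u. 0 < fst p u"
    and "successively (\<lambda>w w'. \<forall>u v. prec u v \<longrightarrow> w v * w' u \<le> w u * w' v) (w # map fst ps)"
  shows "majorized w ps n S"
  using assms
proof (induction ps arbitrary: w n S)
  case Nil
  then show ?case
  proof (induction n arbitrary: S)
    case 0
    then show ?case using majorized_pair majorized_degenerate[of S 0 "[]" w] by fastforce
  next
    case (Suc n)
    show ?case
    proof (cases "card S = n + 3")
      case True
      then show ?thesis using Suc by (intro majorized_step) auto
    next
      case False
      then show ?thesis using Suc.prems by (intro majorized_degenerate) auto
    qed
  qed
next
  case (Cons p ps)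
  obtain w1 m where p: "p = (w1, m)" by (cases p)
  show ?case
    using Cons.prems
  proof (induction n arbitrary: S)
    case 0
    show ?case
      unfolding p
    proof (rule majorized_collapse)
      show "majorized w1 ps m S" using 0 by (intro Cons.IH) (auto simp: p)
    qed (use 0 in \<open>auto simp: p\<close>)
  next
    case (Suc n)
    show ?case
    proof (cases "card S = n + length (arcs (p # ps)) + 3")
      case True
      then show ?thesis using Suc by (intro majorized_step) auto
    next
      case False
      then show ?thesis using Suc.prems by (intro majorized_degenerate) auto
    qed
  qed
qed

end

section \<open>The first arc without prescribed length\<close>

context peeling
begin

definition three_arcs where
  "three_arcs w1 w2 w3 a b n S = peel_sum (replicate a w1 @ replicate b w2 @ replicate n w3) S"

text \<open>Words whose first and last arcs have \<open>n - 1\<close> letters in total. Cyclically these arcs form a single arc,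
  interrupted by the cut between the end and the beginning of the word; the cut is counted as a letter, so
  that the arc has length \<open>n\<close>. Peeling a word whose first arc is empty merges the cut with the first
  marker and leaves a word with three arcs.\<close>

definition sliding where
  "sliding w0 w1 w2 w3 a b n S =
     (\<Sum>i<n. peel_sum (replicate i w0 @ replicate a w1 @ replicate b w2 @ replicate (n - 1 - i) w3) S)"

text \<open>Words with an empty first arc are the summand \<open>i = 0\<close>; they lose the cut
  instead of a letter, which is why a remainder appears.\<close>

lemma sliding_Suc:
  "sliding w0 w1 w2 w3 a b (Suc n) S
    = (\<Sum>u\<in>mins S. w0 u * sliding w0 w1 w2 w3 a b n (S - {u})) + three_arcs w1 w2 w3 a b n S"
proof -
  have "sliding w0 w1 w2 w3 a b (Suc n) S
    = three_arcs w1 w2 w3 a b n S + (\<Sum>i<n. \<Sum>u\<in>mins S. w0 u *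
        peel_sum (replicate i w0 @ replicate a w1 @ replicate b w2 @ replicate (n - 1 - i) w3) (S - {u}))"
    unfolding sliding_def sum.lessThan_Suc_shift by (simp add: three_arcs_def)
  also have "(\<Sum>i<n. \<Sum>u\<in>mins S. w0 u *
        peel_sum (replicate i w0 @ replicate a w1 @ replicate b w2 @ replicate (n - 1 - i) w3) (S - {u}))
    = (\<Sum>u\<in>mins S. w0 u * sliding w0 w1 w2 w3 a b n (S - {u}))"
    unfolding sliding_def sum_distrib_left by (rule sum.swap)
  finally show ?thesis by simp
qed

lemma three_arcs_rigid:
  shows "rigid0 w0 [(w1, a), (w2, b), (w3, n)] 0 = three_arcs w1 w2 w3 a b n"
    and "rigid1 w0 [(w1, a), (w2, b), (w3, n)] \<alpha> 0 S = \<alpha> 0 * three_arcs w1 w2 w3 (Suc a) b n S + \<alpha> 1 * three_arcs w1 w2 w3 a (Suc b) n S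
       + \<alpha> 2 * three_arcs w1 w2 w3 a b (Suc n) S"
    and "rigid2 w0 [(w1, a), (w2, b), (w3, n)] \<alpha> 0 S = (\<alpha> 0)\<^sup>2 * three_arcs w1 w2 w3 (Suc (Suc a)) b n S
       + 2 * \<alpha> 0 * \<alpha> 1 * three_arcs w1 w2 w3 (Suc a) (Suc b) n S + (\<alpha> 1)\<^sup>2 * three_arcs w1 w2 w3 a (Suc (Suc b)) n S
       + 2 * \<alpha> 2 * (\<alpha> 0 * three_arcs w1 w2 w3 (Suc a) b (Suc n) S + \<alpha> 1 * three_arcs w1 w2 w3 a (Suc b) (Suc n) S)
       + (\<alpha> 2)\<^sup>2 * three_arcs w1 w2 w3 a b (Suc (Suc n)) S"
proof -
  have r: "rigid0 w0 [(w1, i), (w2, j), (w3, k)] 0 S = three_arcs w1 w2 w3 i j k S" for i j k S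
    by (simp add: rigid0_def three_arcs_def)
  have len: "length [(w1, a), (w2, b), (w3, n)] = Suc (Suc (Suc 0))" by simp
  show "rigid0 w0 [(w1, a), (w2, b), (w3, n)] 0 = three_arcs w1 w2 w3 a b n"
    by (simp add: r fun_eq_iff)
  show "rigid1 w0 [(w1, a), (w2, b), (w3, n)] \<alpha> 0 S = \<alpha> 0 * three_arcs w1 w2 w3 (Suc a) b n S + \<alpha> 1 * three_arcs w1 w2 w3 a (Suc b) n S
       + \<alpha> 2 * three_arcs w1 w2 w3 a b (Suc n) S"
    unfolding rigid1_def len by (simp add: r numeral_2_eq_2)
  show "rigid2 w0 [(w1, a), (w2, b), (w3, n)] \<alpha> 0 S = (\<alpha> 0)\<^sup>2 * three_arcs w1 w2 w3 (Suc (Suc a)) b n S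
       + 2 * \<alpha> 0 * \<alpha> 1 * three_arcs w1 w2 w3 (Suc a) (Suc b) n S + (\<alpha> 1)\<^sup>2 * three_arcs w1 w2 w3 a (Suc (Suc b)) n S
       + 2 * \<alpha> 2 * (\<alpha> 0 * three_arcs w1 w2 w3 (Suc a) b (Suc n) S + \<alpha> 1 * three_arcs w1 w2 w3 a (Suc b) (Suc n) S)
       + (\<alpha> 2)\<^sup>2 * three_arcs w1 w2 w3 a b (Suc (Suc n)) S"
    unfolding rigid2_def len by (simp add: r numeral_2_eq_2 algebra_simps)
qed

end

context strict_poset
begin

context
  fixes w0 w1 w2 w3 :: "'a \<Rightarrow> real"
  assumes pos: "\<And>u. 0 < w0 u" "\<And>u. 0 < w1 u" "\<And>u. 0 < w2 u" "\<And>u. 0 < w3 u"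
    and ratio: "successively (\<lambda>w w'. \<forall>u v. prec u v \<longrightarrow> w v * w' u \<le> w u * w' v) [w0, w1, w2, w3]"
begin

private abbreviation "R \<equiv> three_arcs w1 w2 w3"
private abbreviation "N \<equiv> sliding w0 w1 w2 w3"

text \<open>This controls the remainders of \<open>sliding_Suc\<close>. The arc of weight
  \<open>w0\<close> is empty, and the sliding arc is lengthened at its other end: the polynomial in
  \<tau> arises by giving the last arc the coordinate \<open>-\<tau>\<close>.\<close>

lemma three_arcs_hyperbolic:
  fixes \<alpha> \<beta> :: real
  assumes fin: "finite S"
  shows "qform w0 (R a b n) (\<lambda>S. \<alpha> * R (Suc a) b n S + \<beta> * R a (Suc b) n S)
      (\<lambda>S. \<alpha>\<^sup>2 * R (Suc (Suc a)) b n S + 2 * \<alpha> * \<beta> * R (Suc a) (Suc b) n S + \<beta>\<^sup>2 * R a (Suc (Suc b)) n S) S h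
      * R a b (Suc (Suc n)) S
    \<le> (lform w0 (R a b (Suc n)) (\<lambda>S. \<alpha> * R (Suc a) b (Suc n) S + \<beta> * R a (Suc b) (Suc n) S) S h)\<^sup>2"
proof -
  define ps where "ps = [(w1, a), (w2, b), (w3, n)]"
  have "majorized w0 ps 0 S"
    using fin pos ratio by (intro rigid_majorized) (auto simp: ps_def)
  then obtain c d where cd: "\<And>h \<gamma>. qform w0 (rigid0 w0 ps 0) (rigid1 w0 ps \<gamma> 0) (rigid2 w0 ps \<gamma> 0) S h
       \<le> ((\<Sum>u\<in>mins S. c u * h u) + (\<Sum>s<length ps. d s * \<gamma> s))\<^sup>2"
    unfolding majorized_def by blast
  have nn: "0 \<le> R a b (Suc (Suc n)) S"
    unfolding three_arcs_def using pos by (intro peel_sum_nonneg) (auto simp: less_imp_le)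
  show ?thesis
  proof (rule discriminant_of_majorization[OF _ nn])
    fix \<tau> :: real
    define \<gamma> where "\<gamma> s = (if s = 0 then \<alpha> else if s = 1 then \<beta> else - \<tau>)" for s :: nat
    have "qform w0 (rigid0 w0 ps 0) (rigid1 w0 ps \<gamma> 0) (rigid2 w0 ps \<gamma> 0) S h
      \<le> ((\<Sum>u\<in>mins S. c u * h u) + (\<Sum>s<length ps. d s * \<gamma> s))\<^sup>2" by (rule cd)
    also have "(\<Sum>u\<in>mins S. c u * h u) + (\<Sum>s<length ps. d s * \<gamma> s)
        = ((\<Sum>u\<in>mins S. c u * h u) + d 0 * \<alpha> + d 1 * \<beta>) - \<tau> * d 2"
      by (simp add: ps_def \<gamma>_def numeral_2_eq_2)
    also have "qform w0 (rigid0 w0 ps 0) (rigid1 w0 ps \<gamma> 0) (rigid2 w0 ps \<gamma> 0) S h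
      = qform w0 (R a b n) (\<lambda>S. \<alpha> * R (Suc a) b n S + \<beta> * R a (Suc b) n S)
      (\<lambda>S. \<alpha>\<^sup>2 * R (Suc (Suc a)) b n S + 2 * \<alpha> * \<beta> * R (Suc a) (Suc b) n S + \<beta>\<^sup>2 * R a (Suc (Suc b)) n S) S h
      - 2 * \<tau> * lform w0 (R a b (Suc n)) (\<lambda>S. \<alpha> * R (Suc a) b (Suc n) S + \<beta> * R a (Suc b) (Suc n) S) S h
      + \<tau>\<^sup>2 * R a b (Suc (Suc n)) S"
      unfolding qform_def lform_def ps_def three_arcs_rigid
      by (simp add: \<gamma>_def algebra_simps sum.distrib sum_subtractf sum_distrib_left)
    finally show "qform w0 (R a b n) (\<lambda>S. \<alpha> * R (Suc a) b n S + \<beta> * R a (Suc b) n S)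
      (\<lambda>S. \<alpha>\<^sup>2 * R (Suc (Suc a)) b n S + 2 * \<alpha> * \<beta> * R (Suc a) (Suc b) n S + \<beta>\<^sup>2 * R a (Suc (Suc b)) n S) S h
      - 2 * \<tau> * lform w0 (R a b (Suc n)) (\<lambda>S. \<alpha> * R (Suc a) b (Suc n) S + \<beta> * R a (Suc b) (Suc n) S) S h
      + \<tau>\<^sup>2 * R a b (Suc (Suc n)) S
      \<le> (((\<Sum>u\<in>mins S. c u * h u) + d 0 * \<alpha> + d 1 * \<beta>) - \<tau> * d 2)\<^sup>2" .
  qed
qed

lemma sliding_nonneg: "0 \<le> N a b n S"
  unfolding sliding_def using pos by (intro sum_nonneg peel_sum_nonneg) (auto simp: less_imp_le)

lemma sliding_pos:
  assumes "finite S" "card S + 1 = a + b + n" "0 < n"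
  shows "0 < N a b n S"
  unfolding sliding_def using assms pos by (intro sum_pos peel_sum_pos) auto

lemma sliding_eq_0:
  assumes "finite S" "card S + 1 \<noteq> a + b + n"
  shows "N a b n S = 0"
  unfolding sliding_def using assms by (intro sum.neutral ballI peel_sum_eq_0) auto

text \<open>Induction on \<open>n\<close> by \<open>peel_step\<close>. The words that cannot lose a
  letter of the first arc form the additional vertex, whose inequality is
  \<open>three_arcs_hyperbolic\<close>.\<close>

lemma sliding_hyperbolic:
  fixes \<alpha> \<beta> :: real
  assumes fin: "finite S"
  shows "qform w0 (N a b n) (\<lambda>S. \<alpha> * N (Suc a) b n S + \<beta> * N a (Suc b) n S)
      (\<lambda>S. \<alpha>\<^sup>2 * N (Suc (Suc a)) b n S + 2 * \<alpha> * \<beta> * N (Suc a) (Suc b) n S + \<beta>\<^sup>2 * N a (Suc (Suc b)) n S) S h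
      * N a b (Suc (Suc n)) S
    \<le> (lform w0 (N a b (Suc n)) (\<lambda>S. \<alpha> * N (Suc a) b (Suc n) S + \<beta> * N a (Suc b) (Suc n) S) S h)\<^sup>2"
  using fin
proof (induction n arbitrary: S h)
  case 0
  \<comment> \<open>A sliding arc of length 0 has no room for the cut.\<close>
  have "N i j 0 S = 0" for i j S by (simp add: sliding_def)
  then show ?case by (simp add: qform_def)
next
  case (Suc n)
  note fin = \<open>finite S\<close>
  show ?case
  proof (cases "card S = a + b + n + 2")
    case False
    \<comment> \<open>For any other cardinality the last factor on the left vanishes.\<close>
    then show ?thesis using fin by (simp add: sliding_eq_0)
  next
    case True
    have card1: "card (S - {u}) = a + b + n + 1" if "u \<in> mins S" for u
    proof -
      have "u \<in> S" using that mins_subset by blast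
      then show ?thesis using True fin by simp
    qed
    have card2: "card (S - {u} - {v}) = a + b + n" if "u \<in> mins S" "v \<in> mins S" "u \<noteq> v" for u v
    proof -
      have "v \<in> S - {u}" using that mins_subset by blast
      then show ?thesis using card1[OF that(1)] card_Diff_singleton[of v "S - {u}"] by simp
    qed
    have R: "0 < R a b m T" if "finite T" "card T = a + b + m" for m T
      unfolding three_arcs_def using that pos by (intro peel_sum_pos) auto
    show ?thesis
    proof (rule peel_step[where ?h0.0 = "R a b"
          and ?h1.0 = "\<lambda>n S. \<alpha> * R (Suc a) b n S + \<beta> * R a (Suc b) n S"
          and ?h2.0 = "\<lambda>n S. \<alpha>\<^sup>2 * R (Suc (Suc a)) b n S + 2 * \<alpha> * \<beta> * R (Suc a) (Suc b) n S + \<beta>\<^sup>2 * R a (Suc (Suc b)) n S"])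
      show "qform w0 (N a b n) (\<lambda>S. \<alpha> * N (Suc a) b n S + \<beta> * N a (Suc b) n S)
          (\<lambda>S. \<alpha>\<^sup>2 * N (Suc (Suc a)) b n S + 2 * \<alpha> * \<beta> * N (Suc a) (Suc b) n S + \<beta>\<^sup>2 * N a (Suc (Suc b)) n S) (S - {u}) f
          * N a b (Suc (Suc n)) (S - {u})
        \<le> (lform w0 (N a b (Suc n)) (\<lambda>S. \<alpha> * N (Suc a) b (Suc n) S + \<beta> * N a (Suc b) (Suc n) S) (S - {u}) f)\<^sup>2" for u f
        using fin by (intro Suc.IH) simp
      show "0 < N a b (Suc (Suc n)) (S - {u})" if "u \<in> mins S" for u
        using fin card1[OF that] by (intro sliding_pos) auto
      show "0 < N a b (Suc n) (S - {u} - {v})" if "u \<in> mins S" "v \<in> mins S" "u \<noteq> v" for u v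
        using fin card2[OF that] by (intro sliding_pos) auto
      have "0 < R a b (Suc (Suc n)) S" using fin True by (intro R) auto
      moreover have "0 < R a b (Suc n) (S - {u})" if "u \<in> mins S" for u
        using fin card1[OF that] by (intro R) auto
      ultimately show "R a b (Suc (Suc n)) S = 0
          \<and> \<alpha> * R (Suc a) b (Suc n) S + \<beta> * R a (Suc b) (Suc n) S = 0
          \<and> (\<forall>u\<in>mins S. R a b (Suc n) (S - {u}) = 0)
          \<and> (\<forall>f. qform w0 (R a b n) (\<lambda>S. \<alpha> * R (Suc a) b n S + \<beta> * R a (Suc b) n S)
               (\<lambda>S. \<alpha>\<^sup>2 * R (Suc (Suc a)) b n S + 2 * \<alpha> * \<beta> * R (Suc a) (Suc b) n S + \<beta>\<^sup>2 * R a (Suc (Suc b)) n S) S f \<le> 0)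
        \<or> 0 < R a b (Suc (Suc n)) S \<and> (\<forall>u\<in>mins S. 0 < R a b (Suc n) (S - {u}))
          \<and> (\<forall>f. qform w0 (R a b n) (\<lambda>S. \<alpha> * R (Suc a) b n S + \<beta> * R a (Suc b) n S)
               (\<lambda>S. \<alpha>\<^sup>2 * R (Suc (Suc a)) b n S + 2 * \<alpha> * \<beta> * R (Suc a) (Suc b) n S + \<beta>\<^sup>2 * R a (Suc (Suc b)) n S) S f
             * R a b (Suc (Suc n)) S
             \<le> (lform w0 (R a b (Suc n)) (\<lambda>S. \<alpha> * R (Suc a) b (Suc n) S + \<beta> * R a (Suc b) (Suc n) S) S f)\<^sup>2)"
        using three_arcs_hyperbolic[OF fin] by blast
    qed (simp_all add: fin pos sliding_nonneg sliding_Suc sum.distrib sum_distrib_left algebra_simps)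
  qed
qed

end

end

section \<open>Words with three markers\<close>

context peeling
begin

definition linear_list :: "'a list \<Rightarrow> bool" where
  "linear_list xs \<longleftrightarrow> distinct xs \<and> sorted_wrt (\<lambda>u v. \<not> prec v u) xs"

definition admissible :: "('a \<Rightarrow> real) list \<Rightarrow> 'a set \<Rightarrow> 'a list set" where
  "admissible ws S = {xs. linear_list xs \<and> set xs = S \<and> list_all2 (\<lambda>w u. w u = 1) ws xs}"

lemma finite_admissible: "finite S \<Longrightarrow> finite (admissible ws S)"
  by (rule finite_subset[OF _ finite_lists_length_eq[of S "length ws"]])
    (auto simp: admissible_def list_all2_lengthD)

lemma peel_sum_tendsto:
  assumes "\<And>w u. w \<in> set ws \<Longrightarrow> ((\<lambda>e. w e u) \<longlongrightarrow> w e0 u) \<F>"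
  shows "((\<lambda>e. peel_sum (map (\<lambda>w. w e) ws) S) \<longlongrightarrow> peel_sum (map (\<lambda>w. w e0) ws) S) \<F>"
  using assms
  by (induction ws arbitrary: S) (auto intro!: tendsto_intros)

end

context strict_poset
begin

lemma admissible_Cons:
  "admissible (w # ws) S = (\<Union>u\<in>{u \<in> mins S. w u = 1}. (#) u ` admissible ws (S - {u}))"
proof (intro set_eqI iffI)
  fix xs assume xs: "xs \<in> admissible (w # ws) S"
  then obtain u ys where "xs = u # ys" by (cases xs) (auto simp: admissible_def)
  then show "xs \<in> (\<Union>u\<in>{u \<in> mins S. w u = 1}. (#) u ` admissible ws (S - {u}))"
    using xs irrefl by (auto simp: admissible_def linear_list_def mins_def)
next
  fix xs assume "xs \<in> (\<Union>u\<in>{u \<in> mins S. w u = 1}. (#) u ` admissible ws (S - {u}))"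
  then show "xs \<in> admissible (w # ws) S"
    by (auto simp: admissible_def linear_list_def mins_def)
qed

lemma peel_sum_eq_card:
  assumes "finite S" "\<forall>w\<in>set ws. \<forall>u. w u = 0 \<or> w u = 1"
  shows "peel_sum ws S = real (card (admissible ws S))"
  using assms
proof (induction ws arbitrary: S)
  case Nil
  have "admissible [] S = (if S = {} then {[]} else {})"
    by (auto simp: admissible_def linear_list_def)
  then show ?case by simp
next
  case (Cons w ws)
  have "card (admissible (w # ws) S) = (\<Sum>u\<in>{u \<in> mins S. w u = 1}. card ((#) u ` admissible ws (S - {u})))"
    unfolding admissible_Cons using Cons.prems
    by (intro card_UN_disjoint) (auto simp: finite_admissible)
  also have "\<dots> = (\<Sum>u\<in>{u \<in> mins S. w u = 1}. card (admissible ws (S - {u})))"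
    by (simp add: card_image)
  also have "real \<dots> = (\<Sum>u\<in>{u \<in> mins S. w u = 1}. w u * peel_sum ws (S - {u}))"
    using Cons by simp
  also have "\<dots> = (\<Sum>u\<in>mins S. w u * peel_sum ws (S - {u}))"
    using Cons.prems by (intro sum.mono_neutral_left) auto
  finally show ?case by simp
qed

end

locale marked_poset = strict_poset +
  fixes X :: "'a set" and x y z :: 'a
  assumes finX: "finite X"
    and markers: "x \<in> X" "y \<in> X" "z \<in> X" "x \<noteq> y" "y \<noteq> z" "x \<noteq> z"
begin

definition words :: "nat \<Rightarrow> nat \<Rightarrow> ('a list \<times> 'a list \<times> 'a list \<times> 'a list) set" where
  "words p q = {(A, B, D, E). linear_list (A @ x # B @ y # D @ z # E)
     \<and> set (A @ x # B @ y # D @ z # E) = X \<and> length B = p \<and> length D = q}"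

lemma finite_words: "finite (words p q)"
proof (rule finite_subset)
  let ?L = "{xs. set xs \<subseteq> X \<and> length xs \<le> card X}"
  show "words p q \<subseteq> ?L \<times> ?L \<times> ?L \<times> ?L"
  proof
    fix t assume "t \<in> words p q"
    moreover obtain A B D E where t: "t = (A, B, D, E)" by (cases t)
    ultimately have *: "distinct (A @ x # B @ y # D @ z # E)" "set (A @ x # B @ y # D @ z # E) = X"
      by (auto simp: words_def linear_list_def)
    then have "length (A @ x # B @ y # D @ z # E) = card X" using distinct_card by metis
    then show "t \<in> ?L \<times> ?L \<times> ?L \<times> ?L" using *(2) t by auto
  qed
  show "finite (?L \<times> ?L \<times> ?L \<times> ?L)"
    using finite_lists_length_le[OF finX] by blast
qed

section \<open>Weights replacing the three markers\<close>

abbreviation rest :: "'a set" where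
  "rest \<equiv> X - {x, y, z}"

text \<open>The weights of the letters before \<open>x\<close>, between \<open>x\<close> and \<open>y\<close>, between \<open>y\<close> and \<open>z\<close>, and after \<open>z\<close>. They are positive
  for \<open>e > 0\<close>, and for \<open>e = 0\<close> they are the indicators of the letters allowed there.\<close>

definition penalty :: "real \<Rightarrow> bool \<Rightarrow> real" where
  "penalty e P = (if P then e else 1)"

definition "wt0 e v = penalty e (prec x v) * penalty e (prec y v) * penalty e (prec z v)"
definition "wt1 e v = penalty e (prec v x) * penalty e (prec y v) * penalty e (prec z v)"
definition "wt2 e v = penalty e (prec v x) * penalty e (prec v y) * penalty e (prec z v)"
definition "wt3 e v = penalty e (prec v x) * penalty e (prec v y) * penalty e (prec v z)"

lemmas wt_defs = wt0_def wt1_def wt2_def wt3_def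

lemma wt_pos:
  assumes "0 < e"
  shows "0 < wt0 e v" "0 < wt1 e v" "0 < wt2 e v" "0 < wt3 e v"
  using assms by (auto simp: wt_defs penalty_def)

text \<open>By transitivity \<open>c\<close> below \<open>u\<close> implies \<open>c\<close> below
  \<open>v\<close>, and \<open>v\<close> below \<open>c\<close> implies \<open>u\<close> below
  \<open>c\<close>. Each factor \<open>e\<close> on the right is thus matched by one on the left,
  and \<open>e\<close> is at most 1.\<close>

lemma penalty_ratio:
  assumes "0 < e" "e \<le> 1" "prec u v"
  shows "penalty e (prec c v) * penalty e (prec u c) \<le> penalty e (prec c u) * penalty e (prec v c)"
proof -
  have "prec c u \<Longrightarrow> prec c v" "prec v c \<Longrightarrow> prec u c" "\<not> (prec c v \<and> prec v c)" "\<not> (prec c u \<and> prec u c)"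
    using assms(3) trans irrefl by blast+
  then show ?thesis using assms(1,2) by (auto simp: penalty_def mult_le_one)
qed

text \<open>Consecutive weights differ only in the direction of the penalty for one marker, to which
  \<open>penalty_ratio\<close> applies; the penalties for the other two markers are common
  factors.\<close>

lemma wt_ratio:
  assumes "0 < e" "e \<le> 1"
  shows "successively (\<lambda>w w'. \<forall>u v. prec u v \<longrightarrow> w v * w' u \<le> w u * w' v) [wt0 e, wt1 e, wt2 e, wt3 e]"
proof -
  have nn: "0 \<le> penalty e P" for P using assms by (simp add: penalty_def)
  have le: "(p * a) * (p' * b) \<le> (p * c) * (p' * d)"
    if "a * b \<le> c * d" "0 \<le> p" "0 \<le> p'" for a b c d p p' :: real
  proof -
    have "(p * p') * (a * b) \<le> (p * p') * (c * d)" using that by (intro mult_left_mono) auto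
    then show ?thesis by (simp add: mult_ac)
  qed
  have "wt0 e v * wt1 e u \<le> wt0 e u * wt1 e v" "wt1 e v * wt2 e u \<le> wt1 e u * wt2 e v"
    "wt2 e v * wt3 e u \<le> wt2 e u * wt3 e v" if "prec u v" for u v
  proof -
    have "(penalty e (prec y v) * penalty e (prec z v) * penalty e (prec x v))
          * (penalty e (prec y u) * penalty e (prec z u) * penalty e (prec u x))
        \<le> (penalty e (prec y u) * penalty e (prec z u) * penalty e (prec x u))
          * (penalty e (prec y v) * penalty e (prec z v) * penalty e (prec v x))"
      using le[OF penalty_ratio[OF assms that, of x], of "penalty e (prec y v) * penalty e (prec z v)" "penalty e (prec y u) * penalty e (prec z u)"] nn
      by (simp add: mult_ac)
    then show "wt0 e v * wt1 e u \<le> wt0 e u * wt1 e v" by (simp add: wt_defs mult_ac)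
    have "(penalty e (prec v x) * penalty e (prec z v) * penalty e (prec y v))
          * (penalty e (prec u x) * penalty e (prec z u) * penalty e (prec u y))
        \<le> (penalty e (prec u x) * penalty e (prec z u) * penalty e (prec y u))
          * (penalty e (prec v x) * penalty e (prec z v) * penalty e (prec v y))"
      using le[OF penalty_ratio[OF assms that, of y], of "penalty e (prec v x) * penalty e (prec z v)" "penalty e (prec u x) * penalty e (prec z u)"] nn
      by (simp add: mult_ac)
    then show "wt1 e v * wt2 e u \<le> wt1 e u * wt2 e v" by (simp add: wt_defs mult_ac)
    have "(penalty e (prec v x) * penalty e (prec v y) * penalty e (prec z v))
          * (penalty e (prec u x) * penalty e (prec u y) * penalty e (prec u z))
        \<le> (penalty e (prec u x) * penalty e (prec u y) * penalty e (prec z u))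
          * (penalty e (prec v x) * penalty e (prec v y) * penalty e (prec v z))"
      using le[OF penalty_ratio[OF assms that, of z], of "penalty e (prec v x) * penalty e (prec v y)" "penalty e (prec u x) * penalty e (prec u y)"] nn
      by (simp add: mult_ac)
    then show "wt2 e v * wt3 e u \<le> wt2 e u * wt3 e v" by (simp add: wt_defs mult_ac)
  qed
  then show ?thesis by simp
qed

abbreviation slid where
  "slid e p q n \<equiv> sliding (wt0 e) (wt1 e) (wt2 e) (wt3 e) p q n rest"

lemma slid_tendsto: "((\<lambda>e. slid e p q n) \<longlongrightarrow> slid 0 p q n) (at_right 0)"
  unfolding sliding_def
proof (rule tendsto_sum)
  fix i
  define ws where "ws = replicate i wt0 @ replicate p wt1 @ replicate q wt2 @ replicate (n - 1 - i) wt3"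
  have pen: "((\<lambda>e. penalty e P) \<longlongrightarrow> penalty 0 P) (at_right 0)" for P
    by (auto simp: penalty_def)
  have "((\<lambda>e. peel_sum (map (\<lambda>w. w e) ws) rest) \<longlongrightarrow> peel_sum (map (\<lambda>w. w 0) ws) rest) (at_right 0)"
    by (rule peel_sum_tendsto) (auto simp: ws_def wt_defs intro!: tendsto_mult pen)
  then show "((\<lambda>e. peel_sum (replicate i (wt0 e) @ replicate p (wt1 e) @ replicate q (wt2 e) @ replicate (n - 1 - i) (wt3 e)) rest)
    \<longlongrightarrow> peel_sum (replicate i (wt0 0) @ replicate p (wt1 0) @ replicate q (wt2 0) @ replicate (n - 1 - i) (wt3 0)) rest) (at_right 0)"
    by (simp add: ws_def)
qed

text \<open>For small \<open>e > 0\<close> all weights are positive and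
  \<open>sliding_hyperbolic\<close> applies to the zero vector, which leaves only the coordinates
  \<alpha> and \<beta>. The inequality survives the limit.\<close>

lemma slid_hyperbolic:
  fixes \<alpha> \<beta> :: real
  shows "(\<alpha>\<^sup>2 * slid 0 (Suc (Suc p)) q n + 2 * \<alpha> * \<beta> * slid 0 (Suc p) (Suc q) n + \<beta>\<^sup>2 * slid 0 p (Suc (Suc q)) n)
      * slid 0 p q (Suc (Suc n))
    \<le> (\<alpha> * slid 0 (Suc p) q (Suc n) + \<beta> * slid 0 p (Suc q) (Suc n))\<^sup>2"
proof (rule tendsto_le)
  show "at_right (0::real) \<noteq> bot" by simp
  show "((\<lambda>e. (\<alpha> * slid e (Suc p) q (Suc n) + \<beta> * slid e p (Suc q) (Suc n))\<^sup>2)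
    \<longlongrightarrow> (\<alpha> * slid 0 (Suc p) q (Suc n) + \<beta> * slid 0 p (Suc q) (Suc n))\<^sup>2) (at_right 0)"
    by (intro tendsto_intros slid_tendsto)
  show "((\<lambda>e. (\<alpha>\<^sup>2 * slid e (Suc (Suc p)) q n + 2 * \<alpha> * \<beta> * slid e (Suc p) (Suc q) n + \<beta>\<^sup>2 * slid e p (Suc (Suc q)) n)
      * slid e p q (Suc (Suc n)))
    \<longlongrightarrow> (\<alpha>\<^sup>2 * slid 0 (Suc (Suc p)) q n + 2 * \<alpha> * \<beta> * slid 0 (Suc p) (Suc q) n + \<beta>\<^sup>2 * slid 0 p (Suc (Suc q)) n)
      * slid 0 p q (Suc (Suc n))) (at_right 0)"
    by (intro tendsto_intros slid_tendsto)
  have "(\<alpha>\<^sup>2 * slid e (Suc (Suc p)) q n + 2 * \<alpha> * \<beta> * slid e (Suc p) (Suc q) n + \<beta>\<^sup>2 * slid e p (Suc (Suc q)) n)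
      * slid e p q (Suc (Suc n))
    \<le> (\<alpha> * slid e (Suc p) q (Suc n) + \<beta> * slid e p (Suc q) (Suc n))\<^sup>2" if e: "0 < e" "e < 1" for e
    using sliding_hyperbolic[of "wt0 e" "wt1 e" "wt2 e" "wt3 e" rest p q n \<alpha> \<beta> "\<lambda>_. 0"]
      wt_pos[OF e(1)] wt_ratio[OF e(1)] e finX
    by (simp add: qform_def lform_def inherit_def)
  then show "\<forall>\<^sub>F e in at_right 0. (\<alpha>\<^sup>2 * slid e (Suc (Suc p)) q n + 2 * \<alpha> * \<beta> * slid e (Suc p) (Suc q) n + \<beta>\<^sup>2 * slid e p (Suc (Suc q)) n)
      * slid e p q (Suc (Suc n))
    \<le> (\<alpha> * slid e (Suc p) q (Suc n) + \<beta> * slid e p (Suc q) (Suc n))\<^sup>2"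
    by (intro eventually_mono[OF eventually_at_right_real[of 0 1]]) auto
qed

text \<open>At \<open>e = 0\<close> the weights express exactly that the markers can be put back.
  The index \<open>i\<close> of the sum is the length of the first block; the two outer blocks
  together have \<open>n - 1\<close> letters, which is the equation for \<open>card X\<close> after
  removal of three markers.\<close>

lemma slid_eq_card_words:
  assumes ord: "\<not> prec y x" "\<not> prec z y" "\<not> prec z x"
    and n: "n + p + q + 2 = card X"
  shows "slid 0 p q n = real (card (words p q))"
proof -
  define ws where "ws i = replicate i (wt0 0) @ replicate p (wt1 0) @ replicate q (wt2 0) @ replicate (n - 1 - i) (wt3 0)" for i
  define f :: "'a list \<times> 'a list \<times> 'a list \<times> 'a list \<Rightarrow> 'a list" where "f = (\<lambda>(A, B, D, E). A @ B @ D @ E)"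
  define Wi where "Wi i = {t \<in> words p q. length (fst t) = i}" for i
  have card_rest: "card rest = n + p + q - 1" "card rest + 3 = card X"
  proof -
    have "card rest = card X - card {x, y, z}" using markers finX by (intro card_Diff_subset) auto
    moreover have "card {x, y, z} = 3" using markers by simp
    moreover have "card {x, y, z} \<le> card X" using markers finX by (intro card_mono) auto
    ultimately show "card rest = n + p + q - 1" "card rest + 3 = card X" using n by auto
  qed
  have w1: "wt0 0 v = 1 \<longleftrightarrow> \<not> prec x v \<and> \<not> prec y v \<and> \<not> prec z v"
    "wt1 0 v = 1 \<longleftrightarrow> \<not> prec v x \<and> \<not> prec y v \<and> \<not> prec z v"
    "wt2 0 v = 1 \<longleftrightarrow> \<not> prec v x \<and> \<not> prec v y \<and> \<not> prec z v"
    "wt3 0 v = 1 \<longleftrightarrow> \<not> prec v x \<and> \<not> prec v y \<and> \<not> prec v z" for v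
    by (auto simp: wt_defs penalty_def)
  have la: "list_all2 P (replicate k w) us \<longleftrightarrow> length us = k \<and> (\<forall>u\<in>set us. P w u)"
    for P k us and w :: "'a \<Rightarrow> real"
    by (induction k arbitrary: us) (auto simp: list_all2_Cons1 length_Suc_conv)
  have mem: "(A, B, D, E) \<in> words p q \<longleftrightarrow> linear_list (A @ B @ D @ E) \<and> set (A @ B @ D @ E) = rest
      \<and> length B = p \<and> length D = q \<and> (\<forall>u\<in>set A. wt0 0 u = 1) \<and> (\<forall>u\<in>set B. wt1 0 u = 1)
      \<and> (\<forall>u\<in>set D. wt2 0 u = 1) \<and> (\<forall>u\<in>set E. wt3 0 u = 1)" for A B D E
  proof -
    have 1: "set (A @ x # B @ y # D @ z # E) = X \<and> distinct (A @ x # B @ y # D @ z # E)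
      \<longleftrightarrow> set (A @ B @ D @ E) = rest \<and> distinct (A @ B @ D @ E)"
      using markers by auto
    have 2: "sorted_wrt (\<lambda>u v. \<not> prec v u) (A @ x # B @ y # D @ z # E)
      \<longleftrightarrow> sorted_wrt (\<lambda>u v. \<not> prec v u) (A @ B @ D @ E) \<and> (\<forall>u\<in>set A. wt0 0 u = 1) \<and> (\<forall>u\<in>set B. wt1 0 u = 1)
      \<and> (\<forall>u\<in>set D. wt2 0 u = 1) \<and> (\<forall>u\<in>set E. wt3 0 u = 1)"
      unfolding w1 using ord by (auto simp: sorted_wrt_append)
    have "(A, B, D, E) \<in> words p q \<longleftrightarrow> (set (A @ x # B @ y # D @ z # E) = X \<and> distinct (A @ x # B @ y # D @ z # E))
      \<and> sorted_wrt (\<lambda>u v. \<not> prec v u) (A @ x # B @ y # D @ z # E) \<and> length B = p \<and> length D = q"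
      unfolding words_def linear_list_def mem_Collect_eq prod.case by blast
    then show ?thesis unfolding 1 2 linear_list_def by blast
  qed
  have bij: "bij_betw f (Wi i) (admissible (ws i) rest)" if "i < n" for i
  proof (rule bij_betwI')
    show "f s = f t \<longleftrightarrow> s = t" if "s \<in> Wi i" "t \<in> Wi i" for s t
    proof -
      obtain A B D E where s: "s = (A, B, D, E)" by (cases s)
      obtain A' B' D' E' where t: "t = (A', B', D', E')" by (cases t)
      have "length A = length A'" "length B = length B'" "length D = length D'"
        using that by (auto simp: Wi_def s t mem)
      then show ?thesis by (simp add: s t f_def)
    qed
    show "f s \<in> admissible (ws i) rest" if s: "s \<in> Wi i" for s
    proof -
      obtain A B D E where sE: "s = (A, B, D, E)" by (cases s)
      have "distinct (A @ B @ D @ E)" "set (A @ B @ D @ E) = rest" "length A = i" "length B = p" "length D = q"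
        using s by (simp_all add: Wi_def sE mem linear_list_def)
      then have "length E = n - 1 - i"
        using distinct_card[of "A @ B @ D @ E"] card_rest \<open>i < n\<close> by auto
      then show ?thesis using s
        by (simp add: sE Wi_def mem admissible_def f_def ws_def list_all2_append la)
    qed
    show "\<exists>s\<in>Wi i. xs = f s" if "xs \<in> admissible (ws i) rest" for xs
    proof -
      have "list_all2 (\<lambda>w u. w u = 1) (ws i) xs" using that by (simp add: admissible_def)
      then obtain A B D E where "xs = A @ B @ D @ E" "length A = i" "length B = p" "length D = q"
        "\<forall>u\<in>set A. wt0 0 u = 1" "\<forall>u\<in>set B. wt1 0 u = 1" "\<forall>u\<in>set D. wt2 0 u = 1" "\<forall>u\<in>set E. wt3 0 u = 1"
        unfolding ws_def list_all2_append1 la by blast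
      then show ?thesis using that
        by (intro bexI[of _ "(A, B, D, E)"]) (simp_all add: f_def Wi_def mem admissible_def)
    qed
  qed
  have words_UN: "words p q = (\<Union>i\<in>{..<n}. Wi i)"
  proof -
    have "length A < n" if "(A, B, D, E) \<in> words p q" for A B D E
    proof -
      have "distinct (A @ x # B @ y # D @ z # E)" "set (A @ x # B @ y # D @ z # E) = X" "length B = p" "length D = q"
        using that by (auto simp: words_def linear_list_def)
      then show ?thesis using distinct_card[of "A @ x # B @ y # D @ z # E"] n by auto
    qed
    then show ?thesis by (fastforce simp: Wi_def)
  qed
  have "finite (Wi i)" for i using finite_words by (simp add: Wi_def)
  moreover have "i \<noteq> j \<Longrightarrow> Wi i \<inter> Wi j = {}" for i j by (auto simp: Wi_def)
  ultimately have "card (words p q) = (\<Sum>i<n. card (Wi i))"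
    unfolding words_UN by (intro card_UN_disjoint) auto
  also have "\<dots> = (\<Sum>i<n. card (admissible (ws i) rest))"
    using bij by (intro sum.cong) (auto dest: bij_betw_same_card)
  also have "real \<dots> = (\<Sum>i<n. peel_sum (ws i) rest)"
    unfolding of_nat_sum
  proof (intro sum.cong refl peel_sum_eq_card[symmetric])
    fix i
    show "\<forall>w\<in>set (ws i). \<forall>u. w u = 0 \<or> w u = 1"
      by (auto simp: ws_def wt_defs penalty_def split: if_splits)
  qed (use finX in auto)
  finally show ?thesis by (simp add: sliding_def ws_def)
qed

lemma words_empty:
  assumes "prec y x \<or> prec z y \<or> prec z x"
  shows "words p q = {}"
  using assms by (auto simp: words_def linear_list_def sorted_wrt_append)

text \<open>A letter gained by an inner arc is lost by the sliding arc, so all six counts concern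
  words over the same set. The assumed word ensures that the markers can occur in this order and
  that \<open>X\<close> is large enough.\<close>

theorem words_hyperbolic:
  fixes \<alpha> \<beta> :: real
  assumes "words (Suc p) (Suc q) \<noteq> {}"
  shows "(\<alpha>\<^sup>2 * card (words (Suc (Suc p)) q) + 2 * \<alpha> * \<beta> * card (words (Suc p) (Suc q)) + \<beta>\<^sup>2 * card (words p (Suc (Suc q))))
      * card (words p q)
    \<le> (\<alpha> * card (words (Suc p) q) + \<beta> * card (words p (Suc q)))\<^sup>2"
proof -
  have ord: "\<not> prec y x" "\<not> prec z y" "\<not> prec z x" using assms words_empty by blast+
  obtain A B D E where "(A, B, D, E) \<in> words (Suc p) (Suc q)" using assms by fastforce
  then have "distinct (A @ x # B @ y # D @ z # E)" "set (A @ x # B @ y # D @ z # E) = X" "length B = Suc p" "length D = Suc q"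
    by (auto simp: words_def linear_list_def)
  then have "p + q + 4 < card X" using distinct_card[of "A @ x # B @ y # D @ z # E"] by auto
  then obtain n where n: "n + p + q + 4 = card X" by (metis add.commute add.left_commute less_imp_add_positive)
  show ?thesis
    using slid_hyperbolic[of \<alpha> p q n \<beta>] slid_eq_card_words[OF ord] n by simp
qed

end

section \<open>Moving letters\<close>

text \<open>Choosing a pair \<open>(t, i)\<close> for each \<open>s\<close> is injective, because
  the pair determines \<open>s\<close>.\<close>

lemma card_le_by_code:
  assumes "finite T" "finite I"
    and ex: "\<And>s. s \<in> S \<Longrightarrow> \<exists>t\<in>T. \<exists>i\<in>I. R s t i"
    and uniq: "\<And>s s' t i. \<lbrakk>R s t i; R s' t i\<rbrakk> \<Longrightarrow> s = s'"
  shows "card S \<le> card I * card T"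
proof -
  have "\<exists>ti. ti \<in> T \<times> I \<and> R s (fst ti) (snd ti)" if "s \<in> S" for s
    using ex[OF that] by auto
  then obtain f where f: "\<And>s. s \<in> S \<Longrightarrow> f s \<in> T \<times> I \<and> R s (fst (f s)) (snd (f s))"
    by metis
  have "inj_on f S"
    using f uniq by (metis inj_onI)
  then have "card S \<le> card (T \<times> I)"
    using f assms(1,2) by (intro card_inj_on_le[of f] image_subsetI) auto
  then show ?thesis by (simp add: card_cartesian_product mult.commute)
qed

context peeling
begin

lemma linear_move_right:
  "\<lbrakk>linear_list (P @ u # R @ Q); \<forall>s\<in>set R. \<not> prec u s\<rbrakk> \<Longrightarrow> linear_list (P @ R @ u # Q)"
  by (auto simp: linear_list_def sorted_wrt_append)

lemma linear_move_left:
  "\<lbrakk>linear_list (P @ R @ u # Q); \<forall>s\<in>set R. \<not> prec s u\<rbrakk> \<Longrightarrow> linear_list (P @ u # R @ Q)"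
  by (auto simp: linear_list_def sorted_wrt_append)

end

context marked_poset
begin

lemma wordsI:
  "\<lbrakk>linear_list (A @ x # B @ y # D @ z # E); set (A @ x # B @ y # D @ z # E) = X; length B = p; length D = q\<rbrakk>
    \<Longrightarrow> (A, B, D, E) \<in> words p q"
  by (simp add: words_def)

lemma wordsD:
  assumes "(A, B, D, E) \<in> words p q"
  shows "linear_list (A @ x # B @ y # D @ z # E)" "set (A @ x # B @ y # D @ z # E) = X"
    "length B = p" "length D = q"
  using assms by (simp_all add: words_def)

lemma words_distinct:
  assumes "(A, B, D, E) \<in> words p q"
  shows "distinct (A @ B @ D @ E)" "set (A @ B @ D @ E) = rest"
  using wordsD(1,2)[OF assms] by (auto simp: linear_list_def)

lemma words_locate:
  assumes "(A, B, D, E) \<in> words p q"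
  shows "prec x d \<Longrightarrow> d \<notin> set A" "prec y d \<Longrightarrow> d \<notin> set A \<union> set B" "prec z d \<Longrightarrow> d \<notin> set A \<union> set B \<union> set D"
    "prec d x \<Longrightarrow> d \<notin> set B \<union> set D \<union> set E" "prec d y \<Longrightarrow> d \<notin> set D \<union> set E" "prec d z \<Longrightarrow> d \<notin> set E"
  using wordsD(1)[OF assms] by (auto simp: linear_list_def sorted_wrt_append)

lemma words_order:
  assumes "(A, B, D, E) \<in> words p q"
  shows "sorted_wrt (\<lambda>u v. \<not> prec v u) (A @ x # B @ y # D @ z # E)"
  using wordsD(1)[OF assms] by (simp add: linear_list_def)

lemma length_le_of_subset:
  "\<lbrakk>distinct xs; set xs \<subseteq> set ys\<rbrakk> \<Longrightarrow> length xs \<le> length ys"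
  by (metis card_length card_mono distinct_card finite_set order_trans)

text \<open>Letters that lie above \<open>y\<close> and below \<open>z\<close> stand between these
  markers in every word, and a word in \<open>words p' q\<close> has room for only \<open>q\<close>
  of them.\<close>

lemma not_all_between:
  assumes "(A, B, D, E) \<in> words p (Suc q)" "words p' q \<noteq> {}" "\<forall>d\<in>set D. prec d z"
  shows "\<exists>d\<in>set D. \<not> prec y d"
proof (rule ccontr)
  assume neg: "\<not> ?thesis"
  obtain A0 B0 D0 E0 where w0: "(A0, B0, D0, E0) \<in> words p' q" using assms(2) by fastforce
  have "set D \<subseteq> set D0"
    using neg assms(3) words_locate[OF w0] words_distinct(2)[OF w0] words_distinct(2)[OF assms(1)]
    by fastforce
  then have "length D \<le> length D0"
    using words_distinct(1)[OF assms(1)] by (intro length_le_of_subset) auto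
  then show False using wordsD[OF w0] wordsD[OF assms(1)] by simp
qed

text \<open>In each of the following lemmas the moved letters are chosen extremal in their block so that everything
  they pass is incomparable to them; a word is recovered from its image and from the lengths of the
  passed segments.\<close>

lemma dec_case1:
  assumes bound: "\<And>A B D1 u D2 E. \<lbrakk>(A, B, D1 @ u # D2, E) \<in> words p (Suc q); \<not> prec u z; \<forall>v\<in>set D2. prec v z\<rbrakk>
    \<Longrightarrow> length D2 < c"
  shows "card {(A, B, D, E) \<in> words p (Suc q). \<exists>u\<in>set D. \<not> prec u z} \<le> c * card (words p q)"
proof -
  have "card {(A, B, D, E) \<in> words p (Suc q). \<exists>u\<in>set D. \<not> prec u z} \<le> card {..<c} * card (words p q)"
  proof (rule card_le_by_code[OF finite_words finite_lessThan, where R = "\<lambda>s t i. \<exists>A B D1 u D2 E.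
      s = (A, B, D1 @ u # D2, E) \<and> t = (A, B, D1 @ D2, u # E) \<and> i = length D2"])
    fix s assume "s \<in> {(A, B, D, E) \<in> words p (Suc q). \<exists>u\<in>set D. \<not> prec u z}"
    moreover obtain A B D E where s: "s = (A, B, D, E)" by (cases s)
    ultimately have w: "(A, B, D, E) \<in> words p (Suc q)"
      and "\<exists>u\<in>set D. \<not> prec u z" by auto
    then obtain D1 u D2 where D: "D = D1 @ u # D2" "\<not> prec u z" "\<forall>v\<in>set D2. prec v z"
      using split_list_last_prop[of D "\<lambda>u. \<not> prec u z"] by blast
    have "linear_list ((A @ x # B @ y # D1) @ u # (D2 @ [z]) @ E)" using wordsD(1)[OF w] by (simp add: D)
    then have "linear_list ((A @ x # B @ y # D1) @ (D2 @ [z]) @ u # E)"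
      using D trans by (intro linear_move_right) auto
    then have "(A, B, D1 @ D2, u # E) \<in> words p q"
      using wordsD[OF w] by (intro wordsI) (auto simp: D)
    then show "\<exists>t\<in>words p q. \<exists>i\<in>{..<c}. \<exists>A B D1 u D2 E.
      s = (A, B, D1 @ u # D2, E) \<and> t = (A, B, D1 @ D2, u # E) \<and> i = length D2"
      using bound w D s by blast
  qed auto
  then show ?thesis by simp
qed

text \<open>Two moves keep the length of \<open>B\<close>: its first letter not above
  \<open>x\<close> goes in front of \<open>x\<close>, and the first letter of \<open>D\<close> not
  above \<open>y\<close> refills it.\<close>

lemma dec_case2:
  assumes ne: "words p q \<noteq> {}"
    and bound: "\<And>A B1 v B2 D1 u D2 E. \<lbrakk>(A, B1 @ v # B2, D1 @ u # D2, E) \<in> words p (Suc q);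
       \<forall>d\<in>set (D1 @ u # D2). prec d z; \<not> prec x v; \<forall>b\<in>set B1. prec x b; \<not> prec y u; \<forall>d\<in>set D1. prec y d\<rbrakk>
      \<Longrightarrow> length B1 < c \<and> length D1 < c'"
  shows "card {(A, B, D, E) \<in> words p (Suc q). (\<forall>d\<in>set D. prec d z) \<and> (\<exists>v\<in>set B. \<not> prec x v)}
    \<le> (c * c') * card (words p q)"
proof -
  have "card {(A, B, D, E) \<in> words p (Suc q). (\<forall>d\<in>set D. prec d z) \<and> (\<exists>v\<in>set B. \<not> prec x v)}
    \<le> card ({..<c} \<times> {..<c'}) * card (words p q)"
  proof (rule card_le_by_code[OF finite_words, where R = "\<lambda>s t i. \<exists>A B1 v B2 D1 u D2 E.
      s = (A, B1 @ v # B2, D1 @ u # D2, E) \<and> t = (A @ [v], B1 @ B2 @ [u], D1 @ D2, E) \<and> i = (length B1, length D1)"])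
    fix s assume "s \<in> {(A, B, D, E) \<in> words p (Suc q). (\<forall>d\<in>set D. prec d z) \<and> (\<exists>v\<in>set B. \<not> prec x v)}"
    moreover obtain A B D E where s: "s = (A, B, D, E)" by (cases s)
    ultimately have w: "(A, B, D, E) \<in> words p (Suc q)"
      and Dz: "\<forall>d\<in>set D. prec d z" and "\<exists>v\<in>set B. \<not> prec x v" by auto
    then obtain B1 v B2 where B: "B = B1 @ v # B2" "\<not> prec x v" "\<forall>b\<in>set B1. prec x b"
      using split_list_first_prop[of B "\<lambda>v. \<not> prec x v"] by blast
    obtain D1 u D2 where D: "D = D1 @ u # D2" "\<not> prec y u" "\<forall>d\<in>set D1. prec y d"
      using not_all_between[OF w ne Dz] split_list_first_prop[of D "\<lambda>v. \<not> prec y v"] by blast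
    have "linear_list (A @ (x # B1) @ v # (B2 @ y # D @ z # E))" using wordsD(1)[OF w] by (simp add: B)
    then have "linear_list (A @ v # (x # B1) @ (B2 @ y # D @ z # E))"
      using B trans by (intro linear_move_left) auto
    then have "linear_list ((A @ v # x # B1 @ B2) @ (y # D1) @ u # (D2 @ z # E))" by (simp add: D)
    then have "linear_list ((A @ v # x # B1 @ B2) @ u # (y # D1) @ (D2 @ z # E))"
      using D trans by (intro linear_move_left) auto
    then have "(A @ [v], B1 @ B2 @ [u], D1 @ D2, E) \<in> words p q"
      using wordsD[OF w] by (intro wordsI) (auto simp: B D)
    moreover have "length B1 < c \<and> length D1 < c'" using bound w B D Dz by blast
    ultimately show "\<exists>t\<in>words p q. \<exists>i\<in>{..<c} \<times> {..<c'}. \<exists>A B1 v B2 D1 u D2 E.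
      s = (A, B1 @ v # B2, D1 @ u # D2, E) \<and> t = (A @ [v], B1 @ B2 @ [u], D1 @ D2, E) \<and> i = (length B1, length D1)"
      using B D s by blast
  qed auto
  then show ?thesis by (simp add: card_cartesian_product)
qed

text \<open>One letter crosses both \<open>y\<close> and \<open>x\<close>. What it passes lies above
  \<open>x\<close> or \<open>y\<close>, while the letter itself lies above neither, so nothing
  passed is below it.\<close>

lemma dec_case3:
  assumes bound: "\<And>A B D1 e D2 E. \<lbrakk>(A, B, D1 @ e # D2, E) \<in> words p (Suc q);
       \<forall>d\<in>set (D1 @ e # D2). prec d z; \<forall>b\<in>set B. prec x b; \<not> prec x e; \<not> prec y e; \<forall>d\<in>set D1. prec x d \<or> prec y d\<rbrakk>
      \<Longrightarrow> length D1 < c"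
  shows "card {(A, B, D, E) \<in> words p (Suc q). (\<forall>d\<in>set D. prec d z) \<and> (\<forall>b\<in>set B. prec x b)
      \<and> (\<exists>e\<in>set D. \<not> prec x e \<and> \<not> prec y e)} \<le> c * card (words p q)"
proof -
  have "card {(A, B, D, E) \<in> words p (Suc q). (\<forall>d\<in>set D. prec d z) \<and> (\<forall>b\<in>set B. prec x b)
      \<and> (\<exists>e\<in>set D. \<not> prec x e \<and> \<not> prec y e)} \<le> card {..<c} * card (words p q)"
  proof (rule card_le_by_code[OF finite_words finite_lessThan, where R = "\<lambda>s t i. \<exists>A B D1 e D2 E.
      s = (A, B, D1 @ e # D2, E) \<and> t = (A @ [e], B, D1 @ D2, E) \<and> i = length D1"])
    fix s assume "s \<in> {(A, B, D, E) \<in> words p (Suc q). (\<forall>d\<in>set D. prec d z) \<and> (\<forall>b\<in>set B. prec x b)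
      \<and> (\<exists>e\<in>set D. \<not> prec x e \<and> \<not> prec y e)}"
    moreover obtain A B D E where s: "s = (A, B, D, E)" by (cases s)
    ultimately have w: "(A, B, D, E) \<in> words p (Suc q)"
      and Dz: "\<forall>d\<in>set D. prec d z" and Bx: "\<forall>b\<in>set B. prec x b" and "\<exists>e\<in>set D. \<not> prec x e \<and> \<not> prec y e" by auto
    then obtain D1 e D2 where D: "D = D1 @ e # D2" "\<not> prec x e" "\<not> prec y e" "\<forall>d\<in>set D1. prec x d \<or> prec y d"
      using split_list_first_prop[of D "\<lambda>e. \<not> prec x e \<and> \<not> prec y e"] by blast
    have "linear_list (A @ (x # B @ y # D1) @ e # (D2 @ z # E))" using wordsD(1)[OF w] by (simp add: D)
    then have "linear_list (A @ e # (x # B @ y # D1) @ (D2 @ z # E))"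
      using D Bx trans by (intro linear_move_left) auto
    then have "(A @ [e], B, D1 @ D2, E) \<in> words p q"
      using wordsD[OF w] by (intro wordsI) (auto simp: D)
    moreover have "length D1 < c" using bound w D Dz Bx by blast
    ultimately show "\<exists>t\<in>words p q. \<exists>i\<in>{..<c}. \<exists>A B D1 e D2 E.
      s = (A, B, D1 @ e # D2, E) \<and> t = (A @ [e], B, D1 @ D2, E) \<and> i = length D1"
      using D s by blast
  qed auto
  then show ?thesis by simp
qed

text \<open>\<open>B\<close> gives a letter to \<open>E\<close> and is refilled from
  \<open>D\<close>.\<close>

lemma dec_case4:
  assumes ne: "words p q \<noteq> {}"
    and bound: "\<And>A B1 e B2 D1 u D2 E. \<lbrakk>(A, B1 @ e # B2, D1 @ u # D2, E) \<in> words p (Suc q);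
       \<forall>d\<in>set (D1 @ u # D2). prec d z; \<forall>b\<in>set (B1 @ e # B2). prec x b; \<not> prec e z; \<not> prec e y;
       \<forall>b\<in>set B2. prec b z \<or> prec b y; \<not> prec y u; \<forall>d\<in>set D1. prec y d\<rbrakk>
      \<Longrightarrow> length B2 < c \<and> length D1 < c'"
  shows "card {(A, B, D, E) \<in> words p (Suc q). (\<forall>d\<in>set D. prec d z) \<and> (\<forall>b\<in>set B. prec x b)
      \<and> (\<forall>e\<in>set D. prec x e \<or> prec y e)} \<le> (c * c') * card (words p q)"
proof -
  have "card {(A, B, D, E) \<in> words p (Suc q). (\<forall>d\<in>set D. prec d z) \<and> (\<forall>b\<in>set B. prec x b)
      \<and> (\<forall>e\<in>set D. prec x e \<or> prec y e)} \<le> card ({..<c} \<times> {..<c'}) * card (words p q)"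
  proof (rule card_le_by_code[OF finite_words, where R = "\<lambda>s t i. \<exists>A B1 e B2 D1 u D2 E.
      s = (A, B1 @ e # B2, D1 @ u # D2, E) \<and> t = (A, B1 @ B2 @ [u], D1 @ D2, e # E) \<and> i = (length B2, length D1)"])
    fix s assume "s \<in> {(A, B, D, E) \<in> words p (Suc q). (\<forall>d\<in>set D. prec d z) \<and> (\<forall>b\<in>set B. prec x b)
      \<and> (\<forall>e\<in>set D. prec x e \<or> prec y e)}"
    moreover obtain A B D E where s: "s = (A, B, D, E)" by (cases s)
    ultimately have w: "(A, B, D, E) \<in> words p (Suc q)"
      and Dz: "\<forall>d\<in>set D. prec d z" and Bx: "\<forall>b\<in>set B. prec x b" and De: "\<forall>e\<in>set D. prec x e \<or> prec y e" by auto
    \<comment> \<open>Compared with a word in \<open>words p q\<close>, some letter \<open>e\<close>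
      of \<open>B @ D\<close> lies in an outer block there. It is not in \<open>D\<close>, whose
      letters are below \<open>z\<close> and above \<open>x\<close> or \<open>y\<close>; being in
      \<open>B\<close> it is above \<open>x\<close>, so the block is the last one.\<close>
    have "\<exists>e\<in>set B. \<not> prec e z \<and> \<not> prec e y"
    proof -
      obtain A0 B0 D0 E0 where w0: "(A0, B0, D0, E0) \<in> words p q" using ne by fastforce
      have "\<not> set (B @ D) \<subseteq> set (B0 @ D0)"
        using length_le_of_subset[of "B @ D" "B0 @ D0"] words_distinct(1)[OF w] wordsD[OF w] wordsD[OF w0] by auto
      then obtain e where e: "e \<in> set B \<union> set D" "e \<notin> set B0" "e \<notin> set D0" by auto
      then have "e \<in> set A0 \<union> set E0"
        using words_distinct(2)[OF w] words_distinct(2)[OF w0] by auto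
      then show ?thesis using e Dz Bx De words_locate[OF w0, of e] by auto
    qed
    then obtain B1 e B2 where B: "B = B1 @ e # B2" "\<not> prec e z" "\<not> prec e y" "\<forall>b\<in>set B2. prec b z \<or> prec b y"
      using split_list_last_prop[of B "\<lambda>e. \<not> prec e z \<and> \<not> prec e y"] by blast
    obtain D1 u D2 where D: "D = D1 @ u # D2" "\<not> prec y u" "\<forall>d\<in>set D1. prec y d"
      using not_all_between[OF w ne Dz] split_list_first_prop[of D "\<lambda>v. \<not> prec y v"] by blast
    have "linear_list ((A @ x # B1) @ e # (B2 @ y # D @ [z]) @ E)" using wordsD(1)[OF w] by (simp add: B)
    then have "linear_list ((A @ x # B1) @ (B2 @ y # D @ [z]) @ e # E)"
      using B Dz trans by (intro linear_move_right) auto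
    then have "linear_list ((A @ x # B1 @ B2) @ (y # D1) @ u # (D2 @ z # e # E))" by (simp add: D)
    then have "linear_list ((A @ x # B1 @ B2) @ u # (y # D1) @ (D2 @ z # e # E))"
      using D trans by (intro linear_move_left) auto
    then have "(A, B1 @ B2 @ [u], D1 @ D2, e # E) \<in> words p q"
      using wordsD[OF w] by (intro wordsI) (auto simp: B D)
    moreover have "length B2 < c \<and> length D1 < c'" using bound w B D Dz Bx by blast
    ultimately show "\<exists>t\<in>words p q. \<exists>i\<in>{..<c} \<times> {..<c'}. \<exists>A B1 e B2 D1 u D2 E.
      s = (A, B1 @ e # B2, D1 @ u # D2, E) \<and> t = (A, B1 @ B2 @ [u], D1 @ D2, e # E) \<and> i = (length B2, length D1)"
      using B D s by blast
  qed auto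
  then show ?thesis by (simp add: card_cartesian_product)
qed

section \<open>Moves that lengthen the block between \<open>y\<close> and \<open>z\<close>\<close>

lemma inc_case1:
  assumes bound: "\<And>A B D E1 u E2. \<lbrakk>(A, B, D, E1 @ u # E2) \<in> words p q; \<not> prec z u; \<forall>v\<in>set E1. prec z v\<rbrakk>
    \<Longrightarrow> length E1 < c"
  shows "card {(A, B, D, E) \<in> words p q. \<exists>u\<in>set E. \<not> prec z u} \<le> c * card (words p (Suc q))"
proof -
  have "card {(A, B, D, E) \<in> words p q. \<exists>u\<in>set E. \<not> prec z u} \<le> card {..<c} * card (words p (Suc q))"
  proof (rule card_le_by_code[OF finite_words finite_lessThan, where R = "\<lambda>s t i. \<exists>A B D E1 u E2.
      s = (A, B, D, E1 @ u # E2) \<and> t = (A, B, D @ [u], E1 @ E2) \<and> i = length E1"])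
    fix s assume "s \<in> {(A, B, D, E) \<in> words p q. \<exists>u\<in>set E. \<not> prec z u}"
    moreover obtain A B D E where s: "s = (A, B, D, E)" by (cases s)
    ultimately have w: "(A, B, D, E) \<in> words p q"
      and "\<exists>u\<in>set E. \<not> prec z u" by auto
    then obtain E1 u E2 where E: "E = E1 @ u # E2" "\<not> prec z u" "\<forall>v\<in>set E1. prec z v"
      using split_list_first_prop[of E "\<lambda>u. \<not> prec z u"] by blast
    have "linear_list ((A @ x # B @ y # D) @ (z # E1) @ u # E2)" using wordsD(1)[OF w] by (simp add: E)
    then have "linear_list ((A @ x # B @ y # D) @ u # (z # E1) @ E2)"
      using E trans by (intro linear_move_left) auto
    then have "(A, B, D @ [u], E1 @ E2) \<in> words p (Suc q)"
      using wordsD[OF w] by (intro wordsI) (auto simp: E)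
    moreover have "length E1 < c" using bound w E by blast
    ultimately show "\<exists>t\<in>words p (Suc q). \<exists>i\<in>{..<c}. \<exists>A B D E1 u E2.
      s = (A, B, D, E1 @ u # E2) \<and> t = (A, B, D @ [u], E1 @ E2) \<and> i = length E1"
      using E s by blast
  qed auto
  then show ?thesis by simp
qed

text \<open>\<open>D\<close> receives a letter of \<open>B\<close>, and \<open>B\<close> is refilled
  with a letter of \<open>A\<close>.\<close>

lemma inc_case2:
  assumes ne: "words p (Suc q) \<noteq> {}"
    and bound: "\<And>A1 a A2 B1 b B2 D E. \<lbrakk>(A1 @ a # A2, B1 @ b # B2, D, E) \<in> words p q;
       \<forall>e\<in>set E. prec z e; \<not> prec a x; \<forall>v\<in>set A2. prec v x; \<not> prec b y; \<forall>v\<in>set B2. prec v y\<rbrakk>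
      \<Longrightarrow> length A2 < c \<and> length B2 < c'"
  shows "card {(A, B, D, E) \<in> words p q. (\<forall>e\<in>set E. prec z e) \<and> (\<exists>b\<in>set B. \<not> prec b y)}
    \<le> (c * c') * card (words p (Suc q))"
proof -
  have "card {(A, B, D, E) \<in> words p q. (\<forall>e\<in>set E. prec z e) \<and> (\<exists>b\<in>set B. \<not> prec b y)}
    \<le> card ({..<c} \<times> {..<c'}) * card (words p (Suc q))"
  proof (rule card_le_by_code[OF finite_words, where R = "\<lambda>s t i. \<exists>A1 a A2 B1 b B2 D E.
      s = (A1 @ a # A2, B1 @ b # B2, D, E) \<and> t = (A1 @ A2, a # B1 @ B2, b # D, E) \<and> i = (length A2, length B2)"])
    fix s assume "s \<in> {(A, B, D, E) \<in> words p q. (\<forall>e\<in>set E. prec z e) \<and> (\<exists>b\<in>set B. \<not> prec b y)}"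
    moreover obtain A B D E where s: "s = (A, B, D, E)" by (cases s)
    ultimately have w: "(A, B, D, E) \<in> words p q"
      and Ez: "\<forall>e\<in>set E. prec z e" and "\<exists>b\<in>set B. \<not> prec b y" by auto
    then obtain B1 b B2 where B: "B = B1 @ b # B2" "\<not> prec b y" "\<forall>v\<in>set B2. prec v y"
      using split_list_last_prop[of B "\<lambda>b. \<not> prec b y"] by blast
    \<comment> \<open>A word in \<open>words p (Suc q)\<close> has more inner letters, so one of
      them lies in \<open>A\<close> or \<open>E\<close> here. Letters of \<open>E\<close> are above
      \<open>z\<close> and never inner, and an inner letter is not below \<open>x\<close>.\<close>
    have "\<exists>a\<in>set A. \<not> prec a x"
    proof -
      obtain A0 B0 D0 E0 where w0: "(A0, B0, D0, E0) \<in> words p (Suc q)" using ne by fastforce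
      have "\<not> set (B0 @ D0) \<subseteq> set (B @ D)"
        using length_le_of_subset[of "B0 @ D0" "B @ D"] words_distinct(1)[OF w0] wordsD[OF w] wordsD[OF w0] by auto
      then obtain e where e: "e \<in> set B0 \<union> set D0" "e \<notin> set B" "e \<notin> set D" by auto
      then have "e \<in> set A \<union> set E"
        using words_distinct(2)[OF w] words_distinct(2)[OF w0] by auto
      then show ?thesis using e Ez words_locate[OF w0, of e] by auto
    qed
    then obtain A1 a A2 where A: "A = A1 @ a # A2" "\<not> prec a x" "\<forall>v\<in>set A2. prec v x"
      using split_list_last_prop[of A "\<lambda>a. \<not> prec a x"] by blast
    have "linear_list ((A @ x # B1) @ b # (B2 @ [y]) @ (D @ z # E))" using wordsD(1)[OF w] by (simp add: B)
    then have "linear_list ((A @ x # B1) @ (B2 @ [y]) @ b # (D @ z # E))"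
      using B trans by (intro linear_move_right) auto
    then have "linear_list (A1 @ a # (A2 @ [x]) @ (B1 @ B2 @ y # b # D @ z # E))" by (simp add: A)
    then have "linear_list (A1 @ (A2 @ [x]) @ a # (B1 @ B2 @ y # b # D @ z # E))"
      using A trans by (intro linear_move_right) auto
    then have "(A1 @ A2, a # B1 @ B2, b # D, E) \<in> words p (Suc q)"
      using wordsD[OF w] by (intro wordsI) (auto simp: A B)
    moreover have "length A2 < c \<and> length B2 < c'" using bound w A B Ez by blast
    ultimately show "\<exists>t\<in>words p (Suc q). \<exists>i\<in>{..<c} \<times> {..<c'}. \<exists>A1 a A2 B1 b B2 D E.
      s = (A1 @ a # A2, B1 @ b # B2, D, E) \<and> t = (A1 @ A2, a # B1 @ B2, b # D, E) \<and> i = (length A2, length B2)"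
      using A B s by blast
  qed auto
  then show ?thesis by (simp add: card_cartesian_product)
qed

text \<open>A letter of \<open>A\<close> crosses \<open>x\<close>, the whole block \<open>B\<close>,
  and \<open>y\<close>.\<close>

lemma inc_case3:
  assumes ne: "words p (Suc q) \<noteq> {}"
    and bound: "\<And>A1 a A2 B D E. \<lbrakk>(A1 @ a # A2, B, D, E) \<in> words p q;
       \<forall>e\<in>set E. prec z e; \<forall>b\<in>set B. prec b y; \<not> prec a x; \<not> prec a y; \<forall>v\<in>set A2. prec v x \<or> prec v y\<rbrakk>
      \<Longrightarrow> length A2 < c"
  shows "card {(A, B, D, E) \<in> words p q. (\<forall>e\<in>set E. prec z e) \<and> (\<forall>b\<in>set B. prec b y)}
    \<le> c * card (words p (Suc q))"
proof -
  have "card {(A, B, D, E) \<in> words p q. (\<forall>e\<in>set E. prec z e) \<and> (\<forall>b\<in>set B. prec b y)}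
    \<le> card {..<c} * card (words p (Suc q))"
  proof (rule card_le_by_code[OF finite_words finite_lessThan, where R = "\<lambda>s t i. \<exists>A1 a A2 B D E.
      s = (A1 @ a # A2, B, D, E) \<and> t = (A1 @ A2, B, a # D, E) \<and> i = length A2"])
    fix s assume "s \<in> {(A, B, D, E) \<in> words p q. (\<forall>e\<in>set E. prec z e) \<and> (\<forall>b\<in>set B. prec b y)}"
    moreover obtain A B D E where s: "s = (A, B, D, E)" by (cases s)
    ultimately have w: "(A, B, D, E) \<in> words p q"
      and Ez: "\<forall>e\<in>set E. prec z e" and By: "\<forall>b\<in>set B. prec b y" by auto
    have "\<exists>a\<in>set A. \<not> prec a x \<and> \<not> prec a y"
    proof -
      obtain A0 B0 D0 E0 where w0: "(A0, B0, D0, E0) \<in> words p (Suc q)" using ne by fastforce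
      have "\<not> set D0 \<subseteq> set D"
        using length_le_of_subset[of D0 D] words_distinct(1)[OF w0] wordsD[OF w] wordsD[OF w0] by auto
      then obtain e where e: "e \<in> set D0" "e \<notin> set D" by auto
      then have "e \<in> set A \<union> set B \<union> set E"
        using words_distinct(2)[OF w] words_distinct(2)[OF w0] by auto
      then show ?thesis using e Ez By words_locate[OF w0, of e] by auto
    qed
    then obtain A1 a A2 where A: "A = A1 @ a # A2" "\<not> prec a x" "\<not> prec a y" "\<forall>v\<in>set A2. prec v x \<or> prec v y"
      using split_list_last_prop[of A "\<lambda>a. \<not> prec a x \<and> \<not> prec a y"] by blast
    have "linear_list (A1 @ a # (A2 @ x # B @ [y]) @ (D @ z # E))" using wordsD(1)[OF w] by (simp add: A)
    then have "linear_list (A1 @ (A2 @ x # B @ [y]) @ a # (D @ z # E))"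
      using A By trans by (intro linear_move_right) auto
    then have "(A1 @ A2, B, a # D, E) \<in> words p (Suc q)"
      using wordsD[OF w] by (intro wordsI) (auto simp: A)
    moreover have "length A2 < c" using bound w A Ez By by blast
    ultimately show "\<exists>t\<in>words p (Suc q). \<exists>i\<in>{..<c}. \<exists>A1 a A2 B D E.
      s = (A1 @ a # A2, B, D, E) \<and> t = (A1 @ A2, B, a # D, E) \<and> i = length A2"
      using A s by blast
  qed auto
  then show ?thesis by simp
qed

end

section \<open>Fibres of the moves\<close>

context marked_poset
begin

lemma thin_length:
  assumes "thin_wrt X prec t {x, y, z}" "(A, B, D, E) \<in> words p q"
    and "u \<in> set (A @ B @ D @ E)" "distinct xs" "set xs \<subseteq> X"
    and "\<forall>v\<in>set xs. v \<noteq> u \<and> \<not> prec u v \<and> \<not> prec v u"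
  shows "length xs \<le> t"
proof -
  have "u \<in> rest" using assms(3) unfolding words_distinct(2)[OF assms(2)] .
  then have "card {v \<in> X. incomparable prec u v} \<le> t" using assms(1) by (simp add: thin_wrt_def)
  moreover have "set xs \<subseteq> {v \<in> X. incomparable prec u v}"
    using assms(5,6) by (auto simp: incomparable_def comparable_def)
  then have "card (set xs) \<le> card {v \<in> X. incomparable prec u v}" using finX by (intro card_mono) auto
  ultimately show ?thesis using distinct_card[OF assms(4)] by simp
qed

lemma thin_length_after:
  assumes thin: "thin_wrt X prec t {x, y, z}" and w: "(A, B, D, E) \<in> words p q"
    and u: "u \<in> set (A @ B @ D @ E)" and eq: "A @ x # B @ y # D @ z # E = P @ u # xs @ Q"
    and inc: "\<forall>v\<in>set xs. \<not> prec u v"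
  shows "length xs \<le> t"
proof (rule thin_length[OF thin w u])
  have lin: "linear_list (P @ u # xs @ Q)" and X: "set (P @ u # xs @ Q) = X"
    using wordsD(1,2)[OF w] unfolding eq by auto
  show "distinct xs" using lin by (simp add: linear_list_def)
  show "set xs \<subseteq> X" unfolding X[symmetric] by auto
  show "\<forall>v\<in>set xs. v \<noteq> u \<and> \<not> prec u v \<and> \<not> prec v u"
    using lin inc by (auto simp: linear_list_def sorted_wrt_append)
qed

lemma thin_length_before:
  assumes thin: "thin_wrt X prec t {x, y, z}" and w: "(A, B, D, E) \<in> words p q"
    and u: "u \<in> set (A @ B @ D @ E)" and eq: "A @ x # B @ y # D @ z # E = P @ xs @ u # Q"
    and inc: "\<forall>v\<in>set xs. \<not> prec v u"
  shows "length xs \<le> t"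
proof (rule thin_length[OF thin w u])
  have lin: "linear_list (P @ xs @ u # Q)" and X: "set (P @ xs @ u # Q) = X"
    using wordsD(1,2)[OF w] unfolding eq by auto
  show "distinct xs" using lin by (simp add: linear_list_def)
  show "set xs \<subseteq> X" unfolding X[symmetric] by auto
  show "\<forall>v\<in>set xs. v \<noteq> u \<and> \<not> prec u v \<and> \<not> prec v u"
    using lin inc by (auto simp: linear_list_def sorted_wrt_append)
qed

lemma flat_length:
  assumes "flat_wrt X prec t {x, y, z}" "(A, B, D, E) \<in> words p q" "m \<in> {x, y, z}"
    and "distinct xs" "set xs \<subseteq> set A \<union> set B \<union> set D \<union> set E"
    and "\<forall>v\<in>set xs. prec v m \<or> prec m v"
  shows "length xs \<le> t"
proof -
  have "card {v \<in> X. comparable prec m v} \<le> t" using assms(1,3) by (auto simp: flat_wrt_def)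
  moreover have "set xs \<subseteq> set (A @ x # B @ y # D @ z # E)" using assms(5) by auto
  then have "set xs \<subseteq> {v \<in> X. comparable prec m v}"
    using assms(6) unfolding wordsD(2)[OF assms(2)] by (auto simp: comparable_def)
  then have "card (set xs) \<le> card {v \<in> X. comparable prec m v}" using finX by (intro card_mono) auto
  ultimately show ?thesis using distinct_card[OF assms(4)] by simp
qed

lemma card_words_split_dec:
  "card (words p (Suc q)) \<le>
      card {(A, B, D, E) \<in> words p (Suc q). \<exists>u\<in>set D. \<not> prec u z}
    + card {(A, B, D, E) \<in> words p (Suc q). (\<forall>d\<in>set D. prec d z) \<and> (\<exists>v\<in>set B. \<not> prec x v)}
    + card {(A, B, D, E) \<in> words p (Suc q). (\<forall>d\<in>set D. prec d z) \<and> (\<forall>b\<in>set B. prec x b)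
        \<and> (\<exists>e\<in>set D. \<not> prec x e \<and> \<not> prec y e)}
    + card {(A, B, D, E) \<in> words p (Suc q). (\<forall>d\<in>set D. prec d z) \<and> (\<forall>b\<in>set B. prec x b)
        \<and> (\<forall>e\<in>set D. prec x e \<or> prec y e)}" (is "_ \<le> card ?S1 + card ?S2 + card ?S3 + card ?S4")
proof -
  have "words p (Suc q) = ?S1 \<union> ?S2 \<union> ?S3 \<union> ?S4" by blast
  then have "card (words p (Suc q)) = card (?S1 \<union> ?S2 \<union> ?S3 \<union> ?S4)" by (rule arg_cong)
  also have "\<dots> \<le> card ?S1 + card ?S2 + card ?S3 + card ?S4"
    by (intro order_trans[OF card_Un_le] add_mono order_refl card_Un_le)
  finally show ?thesis .
qed

lemma card_words_split_inc:
  "card (words p q) \<le>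
      card {(A, B, D, E) \<in> words p q. \<exists>u\<in>set E. \<not> prec z u}
    + card {(A, B, D, E) \<in> words p q. (\<forall>e\<in>set E. prec z e) \<and> (\<exists>b\<in>set B. \<not> prec b y)}
    + card {(A, B, D, E) \<in> words p q. (\<forall>e\<in>set E. prec z e) \<and> (\<forall>b\<in>set B. prec b y)}"
  (is "_ \<le> card ?S1 + card ?S2 + card ?S3")
proof -
  have "words p q = ?S1 \<union> ?S2 \<union> ?S3" by blast
  then have "card (words p q) = card (?S1 \<union> ?S2 \<union> ?S3)" by (rule arg_cong)
  also have "\<dots> \<le> card ?S1 + card ?S2 + card ?S3"
    by (intro order_trans[OF card_Un_le] add_mono order_refl card_Un_le)
  finally show ?thesis .
qed

text \<open>The fibres in the four cases have at most \<open>t\<close>, \<open>t * t\<close>,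
  \<open>t\<close> and \<open>t * t\<close> elements.\<close>

lemma thin_dec:
  assumes thin: "thin_wrt X prec t {x, y, z}" and ne: "words p q \<noteq> {}"
  shows "card (words p (Suc q)) \<le> 2 * t * (t + 1) * card (words p q)"
proof -
  have "card {(A, B, D, E) \<in> words p (Suc q). \<exists>u\<in>set D. \<not> prec u z} \<le> t * card (words p q)"
  proof (rule dec_case1)
    fix A B D1 u D2 E assume w: "(A, B, D1 @ u # D2, E) \<in> words p (Suc q)" and *: "\<not> prec u z" "\<forall>v\<in>set D2. prec v z"
    \<comment> \<open>The marker that is passed is incomparable to \<open>u\<close> too, so fewer
      than \<open>t\<close> letters are passed.\<close>
    have "length (D2 @ [z]) \<le> t"
      by (rule thin_length_after[OF thin w, of u "A @ x # B @ y # D1" "D2 @ [z]" "E"]) (use * trans in auto)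
    then show "length D2 < t" by simp
  qed
  moreover have "card {(A, B, D, E) \<in> words p (Suc q). (\<forall>d\<in>set D. prec d z) \<and> (\<exists>v\<in>set B. \<not> prec x v)}
      \<le> (t * t) * card (words p q)"
  proof (rule dec_case2[OF ne])
    fix A B1 v B2 D1 u D2 E assume w: "(A, B1 @ v # B2, D1 @ u # D2, E) \<in> words p (Suc q)"
      and *: "\<not> prec x v" "\<forall>b\<in>set B1. prec x b" "\<not> prec y u" "\<forall>d\<in>set D1. prec y d"
    have "length (x # B1) \<le> t"
      by (rule thin_length_before[OF thin w, of v "A" "x # B1" "B2 @ y # D1 @ u # D2 @ z # E"]) (use * trans in auto)
    moreover have "length (y # D1) \<le> t"
      by (rule thin_length_before[OF thin w, of u "A @ x # B1 @ v # B2" "y # D1" "D2 @ z # E"]) (use * trans in auto)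
    ultimately show "length B1 < t \<and> length D1 < t" by simp
  qed
  moreover have "card {(A, B, D, E) \<in> words p (Suc q). (\<forall>d\<in>set D. prec d z) \<and> (\<forall>b\<in>set B. prec x b)
        \<and> (\<exists>e\<in>set D. \<not> prec x e \<and> \<not> prec y e)} \<le> t * card (words p q)"
  proof (rule dec_case3)
    fix A B D1 e D2 E assume w: "(A, B, D1 @ e # D2, E) \<in> words p (Suc q)"
      and *: "\<not> prec x e" "\<not> prec y e" "\<forall>d\<in>set D1. prec x d \<or> prec y d"
    have "length (y # D1) \<le> t"
      by (rule thin_length_before[OF thin w, of e "A @ x # B" "y # D1" "D2 @ z # E"]) (use * trans in auto)
    then show "length D1 < t" by simp
  qed
  moreover have "card {(A, B, D, E) \<in> words p (Suc q). (\<forall>d\<in>set D. prec d z) \<and> (\<forall>b\<in>set B. prec x b)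
        \<and> (\<forall>e\<in>set D. prec x e \<or> prec y e)} \<le> (t * t) * card (words p q)"
  proof (rule dec_case4[OF ne])
    fix A B1 e B2 D1 u D2 E assume w: "(A, B1 @ e # B2, D1 @ u # D2, E) \<in> words p (Suc q)"
      and *: "\<not> prec e z" "\<not> prec e y" "\<forall>b\<in>set B2. prec b z \<or> prec b y" "\<not> prec y u" "\<forall>d\<in>set D1. prec y d"
    have "length (B2 @ [y]) \<le> t"
      by (rule thin_length_after[OF thin w, of e "A @ x # B1" "B2 @ [y]" "D1 @ u # D2 @ z # E"]) (use * trans in auto)
    moreover have "length (y # D1) \<le> t"
      by (rule thin_length_before[OF thin w, of u "A @ x # B1 @ e # B2" "y # D1" "D2 @ z # E"]) (use * trans in auto)
    ultimately show "length B2 < t \<and> length D1 < t" by simp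
  qed
  ultimately have "card (words p (Suc q)) \<le> t * card (words p q) + t * t * card (words p q)
      + t * card (words p q) + t * t * card (words p q)"
    using card_words_split_dec[of p q] by linarith
  then show ?thesis by (simp add: algebra_simps)
qed

text \<open>A block with more than \<open>t\<close> letters cannot be entirely comparable to one
  marker, which excludes the cases assuming so. A block with at most \<open>t\<close> letters bounds
  the passed segments by its own length.\<close>

lemma flat_dec:
  assumes flat: "flat_wrt X prec t {x, y, z}" and t: "1 \<le> t" and ne: "words p q \<noteq> {}"
  shows "card (words p (Suc q)) \<le> 2 * t * (t + 1) * card (words p q)"
proof (cases "Suc q \<le> t")
  case False
  have "card (words p (Suc q)) = card {(A, B, D, E) \<in> words p (Suc q). \<exists>u\<in>set D. \<not> prec u z}"
  proof (intro arg_cong[where f = card] set_eqI iffI)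
    fix s assume s: "s \<in> words p (Suc q)"
    obtain A B D E where sE: "s = (A, B, D, E)" by (cases s)
    have w: "(A, B, D, E) \<in> words p (Suc q)" using s sE by simp
    have "\<not> (\<forall>d\<in>set D. prec d z)"
      using flat_length[OF flat w, of z D] words_distinct(1)[OF w] wordsD(4)[OF w] False by auto
    then show "s \<in> {(A, B, D, E) \<in> words p (Suc q). \<exists>u\<in>set D. \<not> prec u z}" using w sE by auto
  qed auto
  also have "\<dots> \<le> (t + 1) * card (words p q)"
  proof (rule dec_case1)
    fix A B D1 u D2 E assume w: "(A, B, D1 @ u # D2, E) \<in> words p (Suc q)" and *: "\<not> prec u z" "\<forall>v\<in>set D2. prec v z"
    have "length D2 \<le> t"
      by (rule flat_length[OF flat w, of z]) (use words_distinct(1)[OF w] * in auto)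
    then show "length D2 < t + 1" by simp
  qed
  also have "\<dots> \<le> 2 * t * (t + 1) * card (words p q)"
    using t by (intro mult_right_mono) auto
  finally show ?thesis .
next
  case True
  have 1: "card {(A, B, D, E) \<in> words p (Suc q). \<exists>u\<in>set D. \<not> prec u z} \<le> t * card (words p q)"
  proof (rule dec_case1)
    fix A B D1 u D2 E assume "(A, B, D1 @ u # D2, E) \<in> words p (Suc q)"
    then show "length D2 < t" using wordsD(4) True by fastforce
  qed
  have 3: "card {(A, B, D, E) \<in> words p (Suc q). (\<forall>d\<in>set D. prec d z) \<and> (\<forall>b\<in>set B. prec x b)
        \<and> (\<exists>e\<in>set D. \<not> prec x e \<and> \<not> prec y e)} \<le> t * card (words p q)"
  proof (rule dec_case3)
    fix A B D1 e D2 E assume "(A, B, D1 @ e # D2, E) \<in> words p (Suc q)"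
    then show "length D1 < t" using wordsD(4) True by fastforce
  qed
  show ?thesis
  proof (cases "p \<le> t")
    case p: True
    have 2: "card {(A, B, D, E) \<in> words p (Suc q). (\<forall>d\<in>set D. prec d z) \<and> (\<exists>v\<in>set B. \<not> prec x v)}
        \<le> (t * t) * card (words p q)"
    proof (rule dec_case2[OF ne])
      fix A B1 v B2 D1 u D2 E assume w: "(A, B1 @ v # B2, D1 @ u # D2, E) \<in> words p (Suc q)"
      show "length B1 < t \<and> length D1 < t" using wordsD(3,4)[OF w] True p by auto
    qed
    have 4: "card {(A, B, D, E) \<in> words p (Suc q). (\<forall>d\<in>set D. prec d z) \<and> (\<forall>b\<in>set B. prec x b)
          \<and> (\<forall>e\<in>set D. prec x e \<or> prec y e)} \<le> (t * t) * card (words p q)"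
    proof (rule dec_case4[OF ne])
      fix A B1 e B2 D1 u D2 E assume w: "(A, B1 @ e # B2, D1 @ u # D2, E) \<in> words p (Suc q)"
      show "length B2 < t \<and> length D1 < t" using wordsD(3,4)[OF w] True p by auto
    qed
    have "card (words p (Suc q)) \<le> t * card (words p q) + t * t * card (words p q)
        + t * card (words p q) + t * t * card (words p q)"
      using card_words_split_dec[of p q] 1 2 3 4 by linarith
    then show ?thesis by (simp add: algebra_simps)
  next
    case p: False
    have 2: "card {(A, B, D, E) \<in> words p (Suc q). (\<forall>d\<in>set D. prec d z) \<and> (\<exists>v\<in>set B. \<not> prec x v)}
        \<le> ((t + 1) * t) * card (words p q)"
    proof (rule dec_case2[OF ne])
      fix A B1 v B2 D1 u D2 E assume w: "(A, B1 @ v # B2, D1 @ u # D2, E) \<in> words p (Suc q)"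
        and *: "\<forall>b\<in>set B1. prec x b"
      have "length B1 \<le> t"
        by (rule flat_length[OF flat w, of x]) (use words_distinct(1)[OF w] * in auto)
      then show "length B1 < t + 1 \<and> length D1 < t" using wordsD(4)[OF w] True by auto
    qed
    have 4: "card {(A, B, D, E) \<in> words p (Suc q). (\<forall>d\<in>set D. prec d z) \<and> (\<forall>b\<in>set B. prec x b)
          \<and> (\<forall>e\<in>set D. prec x e \<or> prec y e)} = 0"
    proof -
      have "\<not> (\<forall>b\<in>set B. prec x b)" if w: "(A, B, D, E) \<in> words p (Suc q)" for A B D E
        using flat_length[OF flat w, of x B] words_distinct(1)[OF w] wordsD(3)[OF w] p by auto
      then have "{(A, B, D, E) \<in> words p (Suc q). (\<forall>d\<in>set D. prec d z) \<and> (\<forall>b\<in>set B. prec x b)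
          \<and> (\<forall>e\<in>set D. prec x e \<or> prec y e)} = {}" by blast
      then show ?thesis by (simp only: card.empty)
    qed
    have "card (words p (Suc q)) \<le> t * card (words p q) + (t + 1) * t * card (words p q) + t * card (words p q)"
      using card_words_split_dec[of p q] 1 2 3 4 by linarith
    also have "\<dots> = (t * t + 3 * t) * card (words p q)" by (simp add: algebra_simps)
    also have "\<dots> \<le> 2 * t * (t + 1) * card (words p q)"
      using t by (intro mult_right_mono) (simp_all add: algebra_simps)
    finally show ?thesis .
  qed
qed

lemma thin_inc:
  assumes thin: "thin_wrt X prec t {x, y, z}" and ne: "words p (Suc q) \<noteq> {}"
  shows "card (words p q) \<le> (t + 1) * (t + 1) * card (words p (Suc q))"
proof -
  have "card {(A, B, D, E) \<in> words p q. \<exists>u\<in>set E. \<not> prec z u} \<le> t * card (words p (Suc q))"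
  proof (rule inc_case1)
    fix A B D E1 u E2 assume w: "(A, B, D, E1 @ u # E2) \<in> words p q" and *: "\<not> prec z u" "\<forall>v\<in>set E1. prec z v"
    have "length (z # E1) \<le> t"
      by (rule thin_length_before[OF thin w, of u "A @ x # B @ y # D" "z # E1" "E2"]) (use * trans in auto)
    then show "length E1 < t" by simp
  qed
  moreover have "card {(A, B, D, E) \<in> words p q. (\<forall>e\<in>set E. prec z e) \<and> (\<exists>b\<in>set B. \<not> prec b y)}
      \<le> (t * t) * card (words p (Suc q))"
  proof (rule inc_case2[OF ne])
    fix A1 a A2 B1 b B2 D E assume w: "(A1 @ a # A2, B1 @ b # B2, D, E) \<in> words p q"
      and *: "\<not> prec a x" "\<forall>v\<in>set A2. prec v x" "\<not> prec b y" "\<forall>v\<in>set B2. prec v y"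
    have "length (A2 @ [x]) \<le> t"
      by (rule thin_length_after[OF thin w, of a "A1" "A2 @ [x]" "B1 @ b # B2 @ y # D @ z # E"]) (use * trans in auto)
    moreover have "length (B2 @ [y]) \<le> t"
      by (rule thin_length_after[OF thin w, of b "(A1 @ a # A2) @ x # B1" "B2 @ [y]" "D @ z # E"]) (use * trans in auto)
    ultimately show "length A2 < t \<and> length B2 < t" by simp
  qed
  moreover have "card {(A, B, D, E) \<in> words p q. (\<forall>e\<in>set E. prec z e) \<and> (\<forall>b\<in>set B. prec b y)}
      \<le> t * card (words p (Suc q))"
  proof (rule inc_case3[OF ne])
    fix A1 a A2 B D E assume w: "(A1 @ a # A2, B, D, E) \<in> words p q"
      and *: "\<not> prec a x" "\<not> prec a y" "\<forall>v\<in>set A2. prec v x \<or> prec v y"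
    have "length (A2 @ [x]) \<le> t"
      by (rule thin_length_after[OF thin w, of a "A1" "A2 @ [x]" "B @ y # D @ z # E"]) (use * trans in auto)
    then show "length A2 < t" by simp
  qed
  ultimately have "card (words p q) \<le> t * card (words p (Suc q)) + t * t * card (words p (Suc q)) + t * card (words p (Suc q))"
    using card_words_split_inc[of p q] by linarith
  then show ?thesis by (simp add: algebra_simps)
qed

lemma flat_inc_case1:
  assumes flat: "flat_wrt X prec t {x, y, z}"
  shows "card {(A, B, D, E) \<in> words p q. \<exists>u\<in>set E. \<not> prec z u} \<le> (t + 1) * card (words p (Suc q))"
proof (rule inc_case1)
  fix A B D E1 u E2 assume w: "(A, B, D, E1 @ u # E2) \<in> words p q" and *: "\<not> prec z u" "\<forall>v\<in>set E1. prec z v"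
  have "length E1 \<le> t"
    by (rule flat_length[OF flat w, of z]) (use words_distinct(1)[OF w] * in auto)
  then show "length E1 < t + 1" by simp
qed

text \<open>The three fibres have at most \<open>t + 1\<close>, \<open>(t + 1) * (t + 1)\<close> and
  \<open>2 * t\<close> elements if \<open>p > 0\<close>. For \<open>p = 0\<close> the third bound is
  \<open>2 * t + 1\<close>, but the second case is void.\<close>

lemma flat_inc:
  assumes flat: "flat_wrt X prec t {x, y, z}" and t: "1 \<le> t" and ne: "words p (Suc q) \<noteq> {}"
  shows "card (words p q) \<le> 2 * (t + 1) * (t + 1) * card (words p (Suc q))"
proof -
  note 1 = flat_inc_case1[OF flat, of p q]
  have 2: "card {(A, B, D, E) \<in> words p q. (\<forall>e\<in>set E. prec z e) \<and> (\<exists>b\<in>set B. \<not> prec b y)}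
      \<le> ((t + 1) * (t + 1)) * card (words p (Suc q))"
  proof (rule inc_case2[OF ne])
    fix A1 a A2 B1 b B2 D E assume w: "(A1 @ a # A2, B1 @ b # B2, D, E) \<in> words p q"
      and *: "\<forall>v\<in>set A2. prec v x" "\<forall>v\<in>set B2. prec v y"
    have "length A2 \<le> t"
      by (rule flat_length[OF flat w, of x]) (use words_distinct(1)[OF w] * in auto)
    moreover have "length B2 \<le> t"
      by (rule flat_length[OF flat w, of y]) (use words_distinct(1)[OF w] * in auto)
    ultimately show "length A2 < t + 1 \<and> length B2 < t + 1" by simp
  qed
  \<comment> \<open>The letters of \<open>A2\<close> below \<open>x\<close> number at most
    \<open>t\<close>, and so do the others together with \<open>B\<close>, all of which are below
    \<open>y\<close>.\<close>
  have A2: "length A2 + p \<le> 2 * t"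
    if w: "(A1 @ a # A2, B, D, E) \<in> words p q" and *: "\<forall>b\<in>set B. prec b y" "\<forall>v\<in>set A2. prec v x \<or> prec v y"
    for A1 a A2 B D E
  proof -
    have "length (filter (\<lambda>v. prec v x) A2) \<le> t"
      by (rule flat_length[OF flat w, of x]) (use words_distinct(1)[OF w] * in auto)
    moreover have "length (filter (\<lambda>v. \<not> prec v x) A2 @ B) \<le> t"
      by (rule flat_length[OF flat w, of y]) (use words_distinct(1)[OF w] * in auto)
    ultimately show ?thesis
      using sum_length_filter_compl[of "\<lambda>v. prec v x" A2] wordsD(3)[OF w] by simp
  qed
  show ?thesis
  proof (cases "p = 0")
    case True
    have 3: "card {(A, B, D, E) \<in> words p q. (\<forall>e\<in>set E. prec z e) \<and> (\<forall>b\<in>set B. prec b y)}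
        \<le> (2 * t + 1) * card (words p (Suc q))"
      using A2 by (intro inc_case3[OF ne]) fastforce
    have "{(A, B, D, E) \<in> words p q. (\<forall>e\<in>set E. prec z e) \<and> (\<exists>b\<in>set B. \<not> prec b y)} = {}"
      using True wordsD(3) by fastforce
    then have 2: "card {(A, B, D, E) \<in> words p q. (\<forall>e\<in>set E. prec z e) \<and> (\<exists>b\<in>set B. \<not> prec b y)} = 0"
      by (simp only: card.empty)
    have "card (words p q) \<le> (t + 1) * card (words p (Suc q)) + (2 * t + 1) * card (words p (Suc q))"
      using card_words_split_inc[of p q] 1 2 3 by linarith
    also have "\<dots> = (3 * t + 2) * card (words p (Suc q))" by (simp add: algebra_simps)
    also have "\<dots> \<le> 2 * (t + 1) * (t + 1) * card (words p (Suc q))"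
      by (intro mult_right_mono) (simp_all add: algebra_simps)
    finally show ?thesis .
  next
    case False
    have 3: "card {(A, B, D, E) \<in> words p q. (\<forall>e\<in>set E. prec z e) \<and> (\<forall>b\<in>set B. prec b y)}
        \<le> (2 * t) * card (words p (Suc q))"
      using A2 False by (intro inc_case3[OF ne]) fastforce
    have "card (words p q) \<le> (t + 1) * card (words p (Suc q)) + (t + 1) * (t + 1) * card (words p (Suc q))
        + 2 * t * card (words p (Suc q))"
      using card_words_split_inc[of p q] 1 2 3 by linarith
    also have "\<dots> = (t * t + 5 * t + 2) * card (words p (Suc q))" by (simp add: algebra_simps)
    also have "\<dots> \<le> 2 * (t + 1) * (t + 1) * card (words p (Suc q))"
      using t by (intro mult_right_mono) (simp_all add: algebra_simps)
    finally show ?thesis .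
  qed
qed

section \<open>Words in which the distance from \<open>x\<close> to \<open>y\<close> is
  maximal\<close>

text \<open>A letter violating one of the claims could be moved into \<open>B1\<close> without
  changing the length of \<open>D1\<close>, contrary to maximality.\<close>

lemma words_extremal:
  assumes w1: "(A1, B1, D1, E1) \<in> words (Suc p) q"
    and max: "words (Suc (Suc p)) q = {}" and ne: "words (Suc p) (Suc q) \<noteq> {}"
  shows "\<forall>a\<in>set A1. prec a x" "\<forall>d\<in>set D1. prec y d" "\<forall>e\<in>set E1. prec y e \<or> prec z e"
proof -
  show A1x: "\<forall>a\<in>set A1. prec a x"
  proof (rule ccontr)
    assume "\<not> ?thesis"
    then obtain Aa a Ab where A: "A1 = Aa @ a # Ab" "\<not> prec a x" "\<forall>v\<in>set Ab. prec v x"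
      using split_list_last_prop[of A1 "\<lambda>a. \<not> prec a x"] by blast
    have "linear_list (Aa @ a # (Ab @ [x]) @ (B1 @ y # D1 @ z # E1))" using wordsD(1)[OF w1] by (simp add: A)
    then have "linear_list (Aa @ (Ab @ [x]) @ a # (B1 @ y # D1 @ z # E1))"
      using A trans by (intro linear_move_right) auto
    then have "(Aa @ Ab, a # B1, D1, E1) \<in> words (Suc (Suc p)) q"
      using wordsD[OF w1] by (intro wordsI) (auto simp: A)
    then show False using max by simp
  qed
  show D1y: "\<forall>d\<in>set D1. prec y d"
  proof (rule ccontr)
    assume "\<not> ?thesis"
    then obtain Da d Db where D: "D1 = Da @ d # Db" "\<not> prec y d" "\<forall>v\<in>set Da. prec y v"
      using split_list_first_prop[of D1 "\<lambda>d. \<not> prec y d"] by blast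
    have lin: "linear_list ((A1 @ x # B1) @ d # (y # Da) @ (Db @ z # E1))"
    proof (rule linear_move_left)
      show "linear_list ((A1 @ x # B1) @ (y # Da) @ d # (Db @ z # E1))" using wordsD(1)[OF w1] by (simp add: D)
    qed (use D trans in auto)
    \<comment> \<open>Moving \<open>d\<close> into \<open>B1\<close> costs \<open>D1\<close> a
      letter, which a letter of \<open>E1\<close> not above \<open>z\<close> could replace.\<close>
    have E1z: "\<forall>e\<in>set E1. prec z e"
    proof (rule ccontr)
      assume "\<not> ?thesis"
      then obtain Ea e Eb where E: "E1 = Ea @ e # Eb" "\<not> prec z e" "\<forall>v\<in>set Ea. prec z v"
        using split_list_first_prop[of E1 "\<lambda>e. \<not> prec z e"] by blast
      have "linear_list ((A1 @ x # B1 @ d # y # Da @ Db) @ (z # Ea) @ e # Eb)" using lin by (simp add: E)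
      then have "linear_list ((A1 @ x # B1 @ d # y # Da @ Db) @ e # (z # Ea) @ Eb)"
        using E trans by (intro linear_move_left) auto
      then have "(A1, B1 @ [d], Da @ Db @ [e], Ea @ Eb) \<in> words (Suc (Suc p)) q"
        using wordsD[OF w1] by (intro wordsI) (auto simp: D E)
      then show False using max by simp
    qed
    obtain A B D E where w: "(A, B, D, E) \<in> words (Suc p) (Suc q)" using ne by fastforce
    \<comment> \<open>With \<open>A1\<close> below \<open>x\<close> and \<open>E1\<close> above
      \<open>z\<close>, only \<open>B1 @ D1\<close> can supply the inner letters of a word in
      \<open>words (Suc p) (Suc q)\<close>, and it is one letter too short.\<close>
    have "set (B @ D) \<subseteq> set (B1 @ D1)"
    proof
      fix v assume v: "v \<in> set (B @ D)"
      then have "v \<in> rest" unfolding words_distinct(2)[OF w, symmetric] by auto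
      then have "v \<in> set (A1 @ B1 @ D1 @ E1)" unfolding words_distinct(2)[OF w1] .
      moreover have "v \<notin> set A1" "v \<notin> set E1"
        using v A1x E1z words_locate(3,4)[OF w, of v] by auto
      ultimately show "v \<in> set (B1 @ D1)" by auto
    qed
    then have "length (B @ D) \<le> length (B1 @ D1)"
      using words_distinct(1)[OF w] by (intro length_le_of_subset) auto
    then show False using wordsD(3,4)[OF w] wordsD(3,4)[OF w1] by simp
  qed
  show "\<forall>e\<in>set E1. prec y e \<or> prec z e"
  proof (rule ccontr)
    assume "\<not> ?thesis"
    then obtain Ea e Eb where E: "E1 = Ea @ e # Eb" "\<not> prec y e" "\<not> prec z e" "\<forall>v\<in>set Ea. prec y v \<or> prec z v"
      using split_list_first_prop[of E1 "\<lambda>e. \<not> (prec y e \<or> prec z e)"] by blast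
    have "linear_list ((A1 @ x # B1) @ (y # D1 @ z # Ea) @ e # Eb)" using wordsD(1)[OF w1] by (simp add: E)
    then have "linear_list ((A1 @ x # B1) @ e # (y # D1 @ z # Ea) @ Eb)"
      using E D1y trans by (intro linear_move_left) auto
    then have "(A1, B1 @ [e], D1, Ea @ Eb) \<in> words (Suc (Suc p)) q"
      using wordsD[OF w1] by (intro wordsI) (auto simp: E)
    then show False using max by simp
  qed
qed

text \<open>The relations to the markers found in \<open>words_extremal\<close> hold for the letters
  themselves, hence fix their side in every word.\<close>

lemma words_extremal_subset:
  assumes w1: "(A1, B1, D1, E1) \<in> words (Suc p) q"
    and max: "words (Suc (Suc p)) q = {}" and ne: "words (Suc p) (Suc q) \<noteq> {}"
    and w: "(A, B, D, E) \<in> words p' q'"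
  shows "set A1 \<subseteq> set A" "set (D1 @ E1) \<subseteq> set (D @ E)"
proof -
  note ex = words_extremal[OF w1 max ne]
  have mem: "v \<in> set A1 \<union> set D1 \<union> set E1 \<Longrightarrow> v \<in> set (A @ B @ D @ E)" for v
    unfolding words_distinct(2)[OF w] unfolding words_distinct(2)[OF w1, symmetric] by auto
  show "set A1 \<subseteq> set A"
    using mem ex(1) words_locate(4)[OF w] by fastforce
  show "set (D1 @ E1) \<subseteq> set (D @ E)"
    using mem ex(2,3) words_locate(2,3)[OF w] by fastforce
qed

lemma words_length:
  assumes "(A, B, D, E) \<in> words p q"
  shows "card (set A) + card (set (D @ E)) + p = card rest"
proof -
  have "card (set (A @ B @ D @ E)) = length (A @ B @ D @ E)"
    using words_distinct(1)[OF assms] by (rule distinct_card)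
  moreover have "card (set A) = length A" "card (set (D @ E)) = length (D @ E)"
    using words_distinct(1)[OF assms] distinct_card[of A] distinct_card[of "D @ E"] by auto
  ultimately show ?thesis unfolding words_distinct(2)[OF assms] using wordsD(3)[OF assms] by simp
qed

text \<open>With one letter fewer between \<open>x\<close> and \<open>y\<close>, the outer parts
  exceed \<open>A1\<close> and \<open>D1 @ E1\<close> by exactly one letter in total. The letter
  \<open>a\<close> is not in \<open>A1\<close>, so it accounts for the excess.\<close>

lemma words_near_extremal:
  assumes w1: "(A1, B1, D1, E1) \<in> words (Suc p) q"
    and max: "words (Suc (Suc p)) q = {}" and ne: "words (Suc p) (Suc q) \<noteq> {}"
    and w: "(A, B, D, E) \<in> words p q'" and a: "a \<in> set A" "\<not> prec a x"
  shows "\<forall>v\<in>set A. v \<noteq> a \<longrightarrow> prec v x" "\<forall>d\<in>set D. prec y d"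
proof -
  note ex = words_extremal[OF w1 max ne]
  note sub = words_extremal_subset[OF w1 max ne w]
  have aA1: "a \<notin> set A1" using ex(1) a by blast
  have "card (insert a (set A1)) \<le> card (set A)" using sub(1) a by (intro card_mono) auto
  moreover have "card (set (D1 @ E1)) \<le> card (set (D @ E))" using sub(2) by (intro card_mono) auto
  ultimately have "card (insert a (set A1)) = card (set A)" "card (set (D1 @ E1)) = card (set (D @ E))"
    using words_length[OF w] words_length[OF w1] aA1 by auto
  then have "insert a (set A1) = set A" "set (D1 @ E1) = set (D @ E)"
    using sub a card_subset_eq[of "set A" "insert a (set A1)"] card_subset_eq[of "set (D @ E)" "set (D1 @ E1)"]
    by blast+
  then show "\<forall>v\<in>set A. v \<noteq> a \<longrightarrow> prec v x" "\<forall>d\<in>set D. prec y d"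
    using ex words_locate(3)[OF w] by (blast, fastforce)
qed

text \<open>Here \<open>D\<close> lies above \<open>y\<close>, which leaves room for fewer elements below \<open>y\<close>: this saves the factor 2
  against \<open>flat_inc\<close>.\<close>

lemma flat_inc_extremal:
  assumes flat: "flat_wrt X prec t {x, y, z}" and ne: "words p (Suc (Suc q)) \<noteq> {}"
    and w1: "(A1, B1, D1, E1) \<in> words (Suc p) q"
    and max: "words (Suc (Suc p)) q = {}" and ne1: "words (Suc p) (Suc q) \<noteq> {}"
  shows "card (words p (Suc q)) \<le> (t + 1) * (t + 1) * card (words p (Suc (Suc q)))"
proof -
  note 1 = flat_inc_case1[OF flat, of p "Suc q"]
  \<comment> \<open>\<open>a\<close> is the only letter of its block not below
    \<open>x\<close>.\<close>
  have A2: "length A2 \<le> t"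
    if w: "(A1 @ a # A2, B, D, E) \<in> words p (Suc q)" and a: "\<not> prec a x" for A1 a A2 B D E
  proof (rule flat_length[OF flat w, of x])
    show "\<forall>v\<in>set A2. prec v x \<or> prec x v"
      using words_near_extremal(1)[OF w1 max ne1 w _ a] words_distinct(1)[OF w] by auto
  qed (use words_distinct(1)[OF w] in auto)
  \<comment> \<open>The \<open>q + 1\<close> letters of \<open>D\<close> are above \<open>y\<close>
    and share the bound \<open>t\<close> with the letters below \<open>y\<close>.\<close>
  have Dy: "length ys + q + 1 \<le> t"
    if w: "(A1 @ a # A2, B, D, E) \<in> words p (Suc q)" and a: "\<not> prec a x"
      and ys: "distinct ys" "set ys \<subseteq> set B" "\<forall>b\<in>set ys. prec b y" for A1 a A2 B D E ys
  proof -
    have "length (ys @ D) \<le> t"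
      by (rule flat_length[OF flat w, of y])
        (use words_near_extremal(2)[OF w1 max ne1 w _ a] words_distinct(1)[OF w] ys in auto)
    then show ?thesis using wordsD(4)[OF w] by simp
  qed
  show ?thesis
  proof (cases "p + q + 1 \<le> t")
    case True
    have 2: "card {(A, B, D, E) \<in> words p (Suc q). (\<forall>e\<in>set E. prec z e) \<and> (\<exists>b\<in>set B. \<not> prec b y)}
        \<le> ((t + 1) * (t - 1)) * card (words p (Suc (Suc q)))"
    proof (rule inc_case2[OF ne])
      fix A1 a A2 B1 b B2 D E assume w: "(A1 @ a # A2, B1 @ b # B2, D, E) \<in> words p (Suc q)" and a: "\<not> prec a x"
      show "length A2 < t + 1 \<and> length B2 < t - 1"
        using A2[OF w a] wordsD(3)[OF w] True by auto
    qed
    have 3: "card {(A, B, D, E) \<in> words p (Suc q). (\<forall>e\<in>set E. prec z e) \<and> (\<forall>b\<in>set B. prec b y)}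
        \<le> (t + 1) * card (words p (Suc (Suc q)))"
      using A2 by (intro inc_case3[OF ne]) fastforce
    have "card (words p (Suc q)) \<le> (t + 1) * card (words p (Suc (Suc q)))
        + (t + 1) * (t - 1) * card (words p (Suc (Suc q))) + (t + 1) * card (words p (Suc (Suc q)))"
      using card_words_split_inc[of p "Suc q"] 1 2 3 by linarith
    also have "\<dots> = (t + 1) * (t - 1 + 2) * card (words p (Suc (Suc q)))" by (simp add: algebra_simps)
    also have "t - 1 + 2 = t + 1" using True by simp
    finally show ?thesis .
  next
    case False
    have 2: "card {(A, B, D, E) \<in> words p (Suc q). (\<forall>e\<in>set E. prec z e) \<and> (\<exists>b\<in>set B. \<not> prec b y)}
        \<le> ((t + 1) * t) * card (words p (Suc (Suc q)))"
    proof (rule inc_case2[OF ne])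
      fix A1 a A2 B1 b B2 D E assume w: "(A1 @ a # A2, B1 @ b # B2, D, E) \<in> words p (Suc q)" and a: "\<not> prec a x"
        and B2: "\<forall>v\<in>set B2. prec v y"
      show "length A2 < t + 1 \<and> length B2 < t"
      proof -
        have "length B2 + q + 1 \<le> t"
          by (rule Dy[OF w a _ _ B2]) (use words_distinct(1)[OF w] in auto)
        then show ?thesis using A2[OF w a] by simp
      qed
    qed
    \<comment> \<open>The factor 0 says that this case is void: \<open>B\<close> below
      \<open>y\<close> and \<open>D\<close> above \<open>y\<close> would give more than
      \<open>t\<close> letters comparable to \<open>y\<close>.\<close>
    have 3: "card {(A, B, D, E) \<in> words p (Suc q). (\<forall>e\<in>set E. prec z e) \<and> (\<forall>b\<in>set B. prec b y)}
        \<le> 0 * card (words p (Suc (Suc q)))"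
    proof (rule inc_case3[OF ne])
      fix A1 a A2 B D E assume w: "(A1 @ a # A2, B, D, E) \<in> words p (Suc q)" and a: "\<not> prec a x"
        and B: "\<forall>b\<in>set B. prec b y"
      show "length A2 < 0"
        using Dy[OF w a, of B] B words_distinct(1)[OF w] wordsD(3)[OF w] False by auto
    qed
    have "card (words p (Suc q)) \<le> (t + 1) * card (words p (Suc (Suc q)))
        + (t + 1) * t * card (words p (Suc (Suc q)))"
      using card_words_split_inc[of p "Suc q"] 1 2 3 by simp
    then show ?thesis by (simp add: algebra_simps)
  qed
qed

text \<open>If two words have the same letters before \<open>y\<close>, and hence the same after it,
  the beginning of one can be followed by the end of the other: relations across \<open>y\<close>
  depend only on these sets.\<close>

lemma words_cross:
  assumes w: "(A, B, D, E) \<in> words p q" and w': "(A', B', D', E') \<in> words p' q'"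
    and eq: "set (A @ B) = set (A' @ B')" "set (D @ E) = set (D' @ E')"
  shows "(A', B', D, E) \<in> words p' q"
proof (rule wordsI)
  show "length B' = p'" "length D = q" using wordsD[OF w] wordsD[OF w'] by auto
  show "set (A' @ x # B' @ y # D @ z # E) = X" using wordsD(2)[OF w] eq by auto
  have d: "distinct (A' @ x # B' @ y # D @ z # E)"
  proof -
    have "set (A' @ B') \<inter> set (D @ E) = {}" unfolding eq(1)[symmetric] using words_distinct(1)[OF w] by auto
    moreover have "x \<notin> set (A' @ B' @ D @ E)" "y \<notin> set (A' @ B' @ D @ E)" "z \<notin> set (A' @ B' @ D @ E)"
      using words_distinct(2)[OF w] words_distinct(2)[OF w'] by auto
    ultimately show ?thesis using words_distinct(1)[OF w] words_distinct(1)[OF w'] markers by auto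
  qed
  have "\<forall>u\<in>set (A @ B). \<forall>v\<in>set (D @ E). \<not> prec v u" "\<forall>u\<in>set (A @ B). \<not> prec y u \<and> \<not> prec z u"
    using words_order[OF w] by (auto simp: sorted_wrt_append)
  then have "\<forall>u\<in>set (A' @ B'). \<forall>v\<in>set (D @ E). \<not> prec v u" "\<forall>u\<in>set (A' @ B'). \<not> prec y u \<and> \<not> prec z u"
    unfolding eq(1) by blast+
  then have "sorted_wrt (\<lambda>u v. \<not> prec v u) (A' @ x # B' @ y # D @ z # E)"
    using words_order[OF w] words_order[OF w'] by (auto simp: sorted_wrt_append)
  with d show "linear_list (A' @ x # B' @ y # D @ z # E)" by (simp add: linear_list_def)
qed

section \<open>Reversal of the order and the case in which both distances are maximal\<close>

lemma dual: "marked_poset (\<lambda>u v. prec v u) X z y x"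
  using irrefl trans finX markers by unfold_locales auto

lemma dual_words:
  "marked_poset.words (\<lambda>u v. prec v u) X z y x q p = (\<lambda>(A, B, D, E). (rev E, rev D, rev B, rev A)) ` words p q"
proof -
  interpret dual: marked_poset "\<lambda>u v. prec v u" X z y x by (rule dual)
  have lin: "dual.linear_list (rev xs) \<longleftrightarrow> linear_list xs" for xs
    by (simp add: dual.linear_list_def linear_list_def sorted_wrt_rev)
  have *: "(rev E, rev D, rev B, rev A) \<in> dual.words q p \<longleftrightarrow> (A, B, D, E) \<in> words p q" for A B D E
    using lin[of "A @ x # B @ y # D @ z # E"] unfolding dual.words_def words_def by auto
  show ?thesis
  proof (intro set_eqI iffI)
    fix s assume s: "s \<in> dual.words q p"
    obtain A B D E where "s = (A, B, D, E)" by (cases s)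
    then show "s \<in> (\<lambda>(A, B, D, E). (rev E, rev D, rev B, rev A)) ` words p q"
      using s *[of "rev A" "rev B" "rev D" "rev E"]
      by (intro image_eqI[of _ _ "(rev E, rev D, rev B, rev A)"]) auto
  qed (use * in auto)
qed

lemma card_dual_words: "card (marked_poset.words (\<lambda>u v. prec v u) X z y x q p) = card (words p q)"
  unfolding dual_words by (rule card_image) (auto simp: inj_on_def)

lemma dual_words_empty_iff: "marked_poset.words (\<lambda>u v. prec v u) X z y x q p = {} \<longleftrightarrow> words p q = {}"
  unfolding dual_words by simp

text \<open>Maximality of the first distance forces \<open>D1 @ E1\<close> behind \<open>y\<close>
  in every word; dually, maximality of the second forces \<open>A2 @ B2\<close> in front of it. As
  these sets exhaust the letters, exchanging the ends of two words at \<open>y\<close> is always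
  possible, and it is injective.\<close>

lemma cross_product_extremal:
  assumes max: "words (Suc (Suc p)) q = {}" "words p (Suc (Suc q)) = {}"
    and ne: "words (Suc p) (Suc q) \<noteq> {}" "words (Suc p) q \<noteq> {}" "words p (Suc q) \<noteq> {}"
  shows "card (words p q) * card (words (Suc p) (Suc q)) \<le> card (words (Suc p) q) * card (words p (Suc q))"
proof -
  obtain A1 B1 D1 E1 where w1: "(A1, B1, D1, E1) \<in> words (Suc p) q" using ne(2) by fastforce
  obtain A2 B2 D2 E2 where w2: "(A2, B2, D2, E2) \<in> words p (Suc q)" using ne(3) by fastforce
  have up: "set (D1 @ E1) \<subseteq> set (D @ E)" if "(A, B, D, E) \<in> words p' q'" for A B D E p' q'
    using words_extremal_subset[OF w1 max(1) ne(1) that] by blast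
  interpret dual: marked_poset "\<lambda>u v. prec v u" X z y x by (rule dual)
  have w2': "(rev E2, rev D2, rev B2, rev A2) \<in> dual.words (Suc q) p"
    unfolding dual_words using w2 by force
  have low: "set (A2 @ B2) \<subseteq> set (A @ B)" if "(A, B, D, E) \<in> words p' q'" for A B D E p' q'
  proof -
    have "(rev E, rev D, rev B, rev A) \<in> dual.words q' p'" unfolding dual_words using that by force
    then show ?thesis
      using dual.words_extremal_subset(2)[OF w2' _ _ \<open>(rev E, rev D, rev B, rev A) \<in> dual.words q' p'\<close>] max(2) ne(1)
      by (auto simp: dual_words_empty_iff)
  qed
  \<comment> \<open>For a word realizing both larger distances, comparing cardinalities turns the
    inclusions on both sides of \<open>y\<close> into equalities.\<close>
  have part: "set (A2 @ B2) \<union> set (D1 @ E1) = rest"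
  proof -
    obtain A B D E where w: "(A, B, D, E) \<in> words (Suc p) (Suc q)" using ne(1) by fastforce
    have d: "card (set A) + card (set (D @ E)) + Suc p = card rest" using words_length[OF w] .
    have d1: "card (set A1) + card (set (D1 @ E1)) + Suc p = card rest" using words_length[OF w1] .
    have "set A1 \<subseteq> set A" using words_extremal_subset[OF w1 max(1) ne(1) w] by blast
    then have "card (set A1) \<le> card (set A)" by (intro card_mono) auto
    moreover have "card (set (D1 @ E1)) \<le> card (set (D @ E))" using up[OF w] by (intro card_mono) auto
    ultimately have "card (set (D1 @ E1)) = card (set (D @ E))" using d d1 by linarith
    then have U: "set (D1 @ E1) = set (D @ E)" using up[OF w] by (intro card_subset_eq) auto
    have w': "(rev E, rev D, rev B, rev A) \<in> dual.words (Suc q) (Suc p)" unfolding dual_words using w by force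
    have e: "card (set (rev E)) + card (set (rev B @ rev A)) + Suc q = card rest"
      using dual.words_length[OF w'] by (simp add: insert_commute)
    have e2: "card (set (rev E2)) + card (set (rev B2 @ rev A2)) + Suc q = card rest"
      using dual.words_length[OF w2'] by (simp add: insert_commute)
    have "set (rev E2) \<subseteq> set (rev E)"
      using dual.words_extremal_subset(1)[OF w2' _ _ w'] max(2) ne(1) by (simp add: dual_words_empty_iff)
    then have "card (set (rev E2)) \<le> card (set (rev E))" by (intro card_mono) auto
    moreover have "card (set (rev B2 @ rev A2)) \<le> card (set (rev B @ rev A))" using low[OF w] by (intro card_mono) auto
    ultimately have "card (set (rev B2 @ rev A2)) = card (set (rev B @ rev A))" using e e2 by linarith
    then have "set (rev B2 @ rev A2) = set (rev B @ rev A)" using low[OF w] by (intro card_subset_eq) auto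
    then show ?thesis using U words_distinct(2)[OF w] by auto
  qed
  have eq: "set (A @ B) = set (A2 @ B2)" "set (D @ E) = set (D1 @ E1)"
    if w: "(A, B, D, E) \<in> words p' q'" for A B D E p' q'
  proof -
    have "set (A @ B) \<inter> set (D @ E) = {}" using words_distinct(1)[OF w] by auto
    moreover have "set (A @ B) \<union> set (D @ E) = set (A2 @ B2) \<union> set (D1 @ E1)"
      unfolding part using words_distinct(2)[OF w] by auto
    ultimately show "set (A @ B) = set (A2 @ B2)" "set (D @ E) = set (D1 @ E1)"
      using up[OF w] low[OF w] by blast+
  qed
  define f where "f = (\<lambda>((A :: 'a list, B :: 'a list, D :: 'a list, E :: 'a list), (A' :: 'a list, B' :: 'a list, D' :: 'a list, E' :: 'a list)).
    ((A', B', D, E), (A, B, D', E')))"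
  have "inj f" by (auto simp: inj_def f_def)
  moreover have "f ` (words p q \<times> words (Suc p) (Suc q)) \<subseteq> words (Suc p) q \<times> words p (Suc q)"
  proof (rule image_subsetI)
    fix s assume s: "s \<in> words p q \<times> words (Suc p) (Suc q)"
    obtain A B D E A' B' D' E' where sE: "s = ((A, B, D, E), (A', B', D', E'))" by (metis prod_cases4 surj_pair)
    have w: "(A, B, D, E) \<in> words p q" and w': "(A', B', D', E') \<in> words (Suc p) (Suc q)" using s sE by auto
    show "f s \<in> words (Suc p) q \<times> words p (Suc q)"
      using words_cross[OF w w'] words_cross[OF w' w] eq[OF w] eq[OF w'] by (simp add: sE f_def)
  qed
  ultimately have "card (words p q \<times> words (Suc p) (Suc q)) \<le> card (words (Suc p) q \<times> words p (Suc q))"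
    using finite_words by (intro card_inj_on_le[of f]) (auto intro: inj_on_subset)
  then show ?thesis by (simp add: card_cartesian_product)
qed

end

section \<open>The cross-product inequality\<close>

text \<open>The quadratic inequality makes the symmetric matrix of \<open>G11\<close>,
  \<open>G12\<close>, \<open>G22\<close> positive semidefinite, so its determinant is nonnegative.
  The ratios \<open>d\<close> and \<open>e\<close> bound the diagonal, and the inequality of
  arithmetic and geometric means combines them.\<close>

lemma cross_product_of_hyperbolic:
  fixes f00 f10 f01 f20 f02 f11 s d e :: real
  assumes hyp: "\<And>\<alpha> \<beta>. (\<alpha>\<^sup>2 * f20 + 2 * \<alpha> * \<beta> * f11 + \<beta>\<^sup>2 * f02) * f00 \<le> (\<alpha> * f10 + \<beta> * f01)\<^sup>2"
    and nn: "0 \<le> f10" "0 \<le> f01"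
    and d: "0 \<le> d" "d \<le> 1" "d * f10\<^sup>2 \<le> f20 * f00" and e: "0 \<le> e" "e \<le> 1" "e * f01\<^sup>2 \<le> f02 * f00"
    and s: "2 * s \<le> d + e"
  shows "f00 * f11 \<le> (2 - s) * (f10 * f01)"
proof -
  define G11 G22 G12 where "G11 = f10\<^sup>2 - f20 * f00" and "G22 = f01\<^sup>2 - f02 * f00" and "G12 = f10 * f01 - f11 * f00"
  have G: "0 \<le> \<alpha>\<^sup>2 * G11 + 2 * \<alpha> * \<beta> * G12 + \<beta>\<^sup>2 * G22" for \<alpha> \<beta>
    using hyp[of \<alpha> \<beta>] by (simp add: G11_def G22_def G12_def power2_eq_square algebra_simps)
  have G22: "0 \<le> G22" using G[of 0 1] by simp
  have "G12\<^sup>2 \<le> G11 * G22"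
  proof (cases "G22 = 0")
    case True
    have "G12 = 0"
    proof (rule ccontr)
      assume "G12 \<noteq> 0"
      \<comment> \<open>At this vector the form takes the value -1.\<close>
      then show False using G[of 1 "- (G11 + 1) / (2 * G12)"] True by (simp add: field_simps)
    qed
    then show ?thesis using True by simp
  next
    case False
    have "0 \<le> G22 * (G11 * G22 - G12\<^sup>2)"
      using G[of G22 "- G12"] by (simp add: power2_eq_square algebra_simps)
    then show ?thesis using False G22 by (simp add: zero_le_mult_iff)
  qed
  also have "\<dots> \<le> ((1 - d) * f10\<^sup>2) * ((1 - e) * f01\<^sup>2)"
  proof (rule mult_mono)
    show "G11 \<le> (1 - d) * f10\<^sup>2" "G22 \<le> (1 - e) * f01\<^sup>2"
      using d e by (simp_all add: G11_def G22_def algebra_simps)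
    show "0 \<le> (1 - d) * f10\<^sup>2" using d by simp
  qed (rule G22)
  also have "\<dots> = ((1 - d) * (1 - e)) * (f10 * f01)\<^sup>2" by (simp add: power2_eq_square)
  also have "\<dots> \<le> (1 - (d + e) / 2)\<^sup>2 * (f10 * f01)\<^sup>2"
  proof (rule mult_right_mono)
    have "0 \<le> (d - e)\<^sup>2" by simp
    then show "(1 - d) * (1 - e) \<le> (1 - (d + e) / 2)\<^sup>2" by (simp add: power2_eq_square field_simps)
  qed simp
  also have "\<dots> = ((1 - (d + e) / 2) * (f10 * f01))\<^sup>2" by (simp add: power_mult_distrib)
  finally have "\<bar>G12\<bar> \<le> \<bar>(1 - (d + e) / 2) * (f10 * f01)\<bar>" by (simp add: abs_le_square_iff)
  moreover have "0 \<le> (1 - (d + e) / 2) * (f10 * f01)" using d e nn by simp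
  ultimately have "- G12 \<le> (1 - (d + e) / 2) * (f10 * f01)" by linarith
  also have "\<dots> \<le> (1 - s) * (f10 * f01)"
    using s nn by (intro mult_right_mono) auto
  finally show ?thesis by (simp add: G12_def algebra_simps)
qed

context marked_poset
begin

text \<open>Product of the bounds \<open>2 * t * (t + 1)\<close> for shortening and
  \<open>2 * (t + 1) * (t + 1)\<close> for lengthening.\<close>

lemma words_ratio:
  assumes tf: "thin_wrt X prec t {x, y, z} \<or> flat_wrt X prec t {x, y, z}" and t: "1 \<le> t"
    and ne: "words p q \<noteq> {}" "words p (Suc (Suc q)) \<noteq> {}"
  shows "card (words p (Suc q)) * card (words p (Suc q))
    \<le> 4 * t * (t + 1) ^ 3 * (card (words p q) * card (words p (Suc (Suc q))))"
proof -
  have 1: "card (words p (Suc q)) \<le> 2 * t * (t + 1) * card (words p q)"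
    using tf thin_dec flat_dec t ne(1) by blast
  have "card (words p (Suc q)) \<le> (t + 1) * (t + 1) * card (words p (Suc (Suc q)))
      \<or> card (words p (Suc q)) \<le> 2 * (t + 1) * (t + 1) * card (words p (Suc (Suc q)))"
    using tf thin_inc flat_inc t ne(2) by blast
  moreover have "(t + 1) * (t + 1) * card (words p (Suc (Suc q))) \<le> 2 * (t + 1) * (t + 1) * card (words p (Suc (Suc q)))"
    by (intro mult_right_mono) auto
  ultimately have 2: "card (words p (Suc q)) \<le> 2 * (t + 1) * (t + 1) * card (words p (Suc (Suc q)))" by linarith
  show ?thesis
    using mult_le_mono[OF 1 2] by (simp add: power3_eq_cube algebra_simps)
qed

lemma words_ratio_extremal:
  assumes tf: "thin_wrt X prec t {x, y, z} \<or> flat_wrt X prec t {x, y, z}" and t: "1 \<le> t"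
    and ne: "words p q \<noteq> {}" "words p (Suc (Suc q)) \<noteq> {}"
    and max: "words (Suc (Suc p)) q = {}" "words (Suc p) q \<noteq> {}" "words (Suc p) (Suc q) \<noteq> {}"
  shows "card (words p (Suc q)) * card (words p (Suc q))
    \<le> 2 * t * (t + 1) ^ 3 * (card (words p q) * card (words p (Suc (Suc q))))"
proof -
  have 1: "card (words p (Suc q)) \<le> 2 * t * (t + 1) * card (words p q)"
    using tf thin_dec flat_dec t ne(1) by blast
  obtain A B D E where "(A, B, D, E) \<in> words (Suc p) q" using max(2) by fastforce
  then have 2: "card (words p (Suc q)) \<le> (t + 1) * (t + 1) * card (words p (Suc (Suc q)))"
    using tf thin_inc flat_inc_extremal ne(2) max by blast
  show ?thesis
    using mult_le_mono[OF 1 2] by (simp add: power3_eq_cube algebra_simps)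
qed

lemma dual_thin_flat:
  "thin_wrt X (\<lambda>u v. prec v u) t {z, y, x} = thin_wrt X prec t {x, y, z}"
  "flat_wrt X (\<lambda>u v. prec v u) t {z, y, x} = flat_wrt X prec t {x, y, z}"
  by (simp_all add: thin_wrt_def flat_wrt_def incomparable_def comparable_def disj_commute insert_commute)

text \<open>With \<open>K = 4 * t * (t + 1) ^ 3\<close> the ratios are \<open>d = e = 1 / K\<close>
  if both distances can grow. If only one can, the other ratio is 0, but
  \<open>words_ratio_extremal\<close> doubles the remaining one, so their sum is
  \<open>2 / K\<close> again. If neither can, \<open>cross_product_extremal\<close> applies.\<close>

theorem words_cross_product:
  assumes tf: "thin_wrt X prec t {x, y, z} \<or> flat_wrt X prec t {x, y, z}" and t: "1 \<le> t"
  shows "(1 / 2 + 1 / (16 * real t * (real t + 1) ^ 3)) * card (words p q) * card (words (Suc p) (Suc q))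
    \<le> real (card (words (Suc p) q)) * card (words p (Suc q))"
proof (cases "words p q = {} \<or> words (Suc p) (Suc q) = {}")
  case True
  then show ?thesis by auto
next
  case False
  then have ne: "words p q \<noteq> {}" "words (Suc p) (Suc q) \<noteq> {}" by auto
  interpret dual: marked_poset "\<lambda>u v. prec v u" X z y x by (rule dual)
  define f where "f i j = real (card (words (i + p) (j + q)))" for i j
  have f: "f 0 0 = card (words p q)" "f 1 0 = card (words (Suc p) q)" "f 0 1 = card (words p (Suc q))"
    "f 1 1 = card (words (Suc p) (Suc q))" "f 2 0 = card (words (Suc (Suc p)) q)" "f 0 2 = card (words p (Suc (Suc q)))"
    by (simp_all add: f_def numeral_2_eq_2)
  have pos: "0 < f 0 0" "0 < f 1 1" unfolding f using ne finite_words by (simp_all add: card_gt_0_iff)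
  have hyp: "(\<alpha>\<^sup>2 * f 2 0 + 2 * \<alpha> * \<beta> * f 1 1 + \<beta>\<^sup>2 * f 0 2) * f 0 0 \<le> (\<alpha> * f 1 0 + \<beta> * f 0 1)\<^sup>2" for \<alpha> \<beta>
    using words_hyperbolic[OF ne(2), of \<alpha> \<beta>] by (simp only: f)
  have nn: "0 \<le> f i j" for i j by (simp add: f_def)
  \<comment> \<open>The constant 1/2 is available without any ratios and shows that both mixed
    counts are positive.\<close>
  have "f 0 0 * f 1 1 \<le> (2 - 0) * (f 1 0 * f 0 1)"
    by (rule cross_product_of_hyperbolic[OF hyp nn nn, of 0 0]) (use nn in auto)
  then have "f 0 0 * f 1 1 \<le> 2 * (f 1 0 * f 0 1)" by simp
  then have "0 < f 1 0 * f 0 1" using mult_pos_pos[OF pos] by linarith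
  then have "f 1 0 \<noteq> 0" "f 0 1 \<noteq> 0" by (simp_all only: mult_eq_0_iff less_le de_Morgan_disj) auto
  then have ne1: "words (Suc p) q \<noteq> {}" "words p (Suc q) \<noteq> {}" unfolding f by auto
  define K where "K = 4 * real t * (real t + 1) ^ 3"
  have "1 \<le> (real t + 1) ^ 3" by (intro one_le_power) simp
  then have "4 * 1 * 1 \<le> K" unfolding K_def using t by (intro mult_mono) auto
  then have K: "4 \<le> K" by simp
  have K4: "1 / (16 * real t * (real t + 1) ^ 3) = 1 / (4 * K)" by (simp add: K_def)
  have "(1 / 2 + 1 / (4 * K)) * (f 0 0 * f 1 1) \<le> f 1 0 * f 0 1"
  proof (cases "words (Suc (Suc p)) q = {} \<and> words p (Suc (Suc q)) = {}")
    case True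
    then have "card (words p q) * card (words (Suc p) (Suc q)) \<le> card (words (Suc p) q) * card (words p (Suc q))"
      using cross_product_extremal ne(2) ne1 by blast
    then have "f 0 0 * f 1 1 \<le> f 1 0 * f 0 1" unfolding f by (simp flip: of_nat_mult)
    moreover have "(1 / 2 + 1 / (4 * K)) * (f 0 0 * f 1 1) \<le> 1 * (f 0 0 * f 1 1)"
      using K pos by (intro mult_right_mono) (auto simp: field_simps)
    ultimately show ?thesis by simp
  next
    case False
    have "\<exists>d e. 0 \<le> d \<and> d \<le> 1 \<and> d * (f 1 0)\<^sup>2 \<le> f 2 0 * f 0 0
      \<and> 0 \<le> e \<and> e \<le> 1 \<and> e * (f 0 1)\<^sup>2 \<le> f 0 2 * f 0 0 \<and> 2 * (1 / K) \<le> d + e"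
    proof -
      have real_bound: "1 / C * (real i)\<^sup>2 \<le> real j * real k"
        if "i * i \<le> c * (k * j)" "C = real c" "0 < C" for i j k c :: nat and C
      proof -
        have "real i * real i \<le> C * (real k * real j)"
          unfolding that(2) using that(1) by (metis of_nat_le_iff of_nat_mult)
        then show ?thesis using that(3) by (simp add: field_simps power2_eq_square)
      qed
      have KN: "K = real (4 * t * (t + 1) ^ 3)" "K / 2 = real (2 * t * (t + 1) ^ 3)" by (simp_all add: K_def add.commute)
      have K1: "0 \<le> 1 / K" "1 / K \<le> 1" "0 \<le> 1 / (K / 2)" "1 / (K / 2) \<le> 1"
        using K by (simp_all add: divide_le_eq)
      have K2: "2 * (1 / K) \<le> 1 / K + 1 / K" "2 * (1 / K) \<le> 0 + 1 / (K / 2)" "2 * (1 / K) \<le> 1 / (K / 2) + 0"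
        by simp_all
      have K0: "0 < K" "0 < K / 2" using K by simp_all
      have f0: "0 * (f 1 0)\<^sup>2 \<le> f 2 0 * f 0 0" "0 * (f 0 1)\<^sup>2 \<le> f 0 2 * f 0 0" using nn by simp_all
      have dtf: "thin_wrt X (\<lambda>u v. prec v u) t {z, y, x} \<or> flat_wrt X (\<lambda>u v. prec v u) t {z, y, x}"
        using tf unfolding dual_thin_flat .
      consider "words (Suc (Suc p)) q \<noteq> {}" "words p (Suc (Suc q)) \<noteq> {}"
        | "words (Suc (Suc p)) q = {}" "words p (Suc (Suc q)) \<noteq> {}"
        | "words (Suc (Suc p)) q \<noteq> {}" "words p (Suc (Suc q)) = {}" using False by blast
      then show ?thesis
      proof cases
        case 1
        have d: "1 / K * (f 1 0)\<^sup>2 \<le> f 2 0 * f 0 0"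
          using real_bound[OF dual.words_ratio[OF dtf t, of q p,
              unfolded card_dual_words dual_words_empty_iff, OF ne(1) 1(1)] KN(1) K0(1)]
          unfolding f .
        have e: "1 / K * (f 0 1)\<^sup>2 \<le> f 0 2 * f 0 0"
          using real_bound[OF words_ratio[OF tf t ne(1) 1(2)] KN(1) K0(1)] unfolding f .
        show ?thesis using K1(1,2) d e K2(1) by blast
      next
        case 2
        have "1 / (K / 2) * (f 0 1)\<^sup>2 \<le> f 0 2 * f 0 0"
          using real_bound[OF words_ratio_extremal[OF tf t ne(1) 2(2) 2(1) ne1(1) ne(2)] KN(2) K0(2)]
          unfolding f .
        then show ?thesis using K1(3,4) K2(2) f0(1) zero_le_one order_refl by blast
      next
        case 3
        have "1 / (K / 2) * (f 1 0)\<^sup>2 \<le> f 2 0 * f 0 0"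
          using real_bound[OF dual.words_ratio_extremal[OF dtf t, of q p,
              unfolded card_dual_words dual_words_empty_iff, OF ne(1) 3(1) 3(2) ne1(2) ne(2)] KN(2) K0(2)]
          unfolding f .
        then show ?thesis using K1(3,4) K2(3) f0(2) zero_le_one order_refl by blast
      qed
    qed
    then obtain d e where "0 \<le> d" "d \<le> 1" "d * (f 1 0)\<^sup>2 \<le> f 2 0 * f 0 0"
      "0 \<le> e" "e \<le> 1" "e * (f 0 1)\<^sup>2 \<le> f 0 2 * f 0 0" "2 * (1 / K) \<le> d + e" by blast
    then have "f 0 0 * f 1 1 \<le> (2 - 1 / K) * (f 1 0 * f 0 1)"
      by (intro cross_product_of_hyperbolic[OF hyp nn nn, of d e])
    then have "(1 / 2 + 1 / (4 * K)) * (f 0 0 * f 1 1) \<le> (1 / 2 + 1 / (4 * K)) * ((2 - 1 / K) * (f 1 0 * f 0 1))"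
      using K by (intro mult_left_mono) auto
    \<comment> \<open>The first factor is the expansion of the reciprocal of
      \<open>2 - 1 / K\<close> to first order in \<open>1 / K\<close>, and falls slightly short of
      it.\<close>
    also have "\<dots> = (1 - 1 / (4 * K\<^sup>2)) * (f 1 0 * f 0 1)"
      using K by (simp add: field_simps power2_eq_square)
    also have "\<dots> \<le> 1 * (f 1 0 * f 0 1)"
      using nn by (intro mult_right_mono) auto
    finally show ?thesis by simp
  qed
  then show ?thesis unfolding K4 f by (simp add: mult_ac)
qed

section \<open>Linear extensions as words\<close>

definition pos :: "'a list \<Rightarrow> 'a \<Rightarrow> nat" where
  "pos xs v = length (takeWhile (\<lambda>u. u \<noteq> v) xs)"

lemma pos_append: "v \<notin> set xs \<Longrightarrow> pos (xs @ v # ys) v = length xs"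
  by (simp add: pos_def takeWhile_append)

lemma nth_pos: "v \<in> set xs \<Longrightarrow> pos xs v < length xs \<and> xs ! pos xs v = v"
  by (induction xs) (auto simp: pos_def)

lemma pos_nth: "\<lbrakk>distinct xs; i < length xs\<rbrakk> \<Longrightarrow> pos xs (xs ! i) = i"
  using nth_pos[of "xs ! i" xs] nth_eq_iff_index_eq[of xs "pos xs (xs ! i)" i] by simp

text \<open>Positions in a list start at 0, values of linear extensions at 1;
  \<open>restrict\<close> provides the value \<open>undefined\<close> outside
  \<open>X\<close>.\<close>

definition extension_of_list :: "'a list \<Rightarrow> 'a \<Rightarrow> nat" where
  "extension_of_list xs = restrict (\<lambda>v. Suc (pos xs v)) X"

lemma extension_of_list:
  assumes "linear_list xs" "set xs = X"
  shows "extension_of_list xs \<in> linear_extensions X prec"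
proof -
  have d: "distinct xs" and len: "length xs = card X"
    using assms distinct_card[of xs] by (auto simp: linear_list_def)
  have "bij_betw (extension_of_list xs) X {1..card X}"
  proof (rule bij_betwI[where g = "\<lambda>i. xs ! (i - 1)"])
    show "extension_of_list xs \<in> X \<rightarrow> {1..card X}"
      using nth_pos[of _ xs] assms(2) len by (auto simp: extension_of_list_def Suc_le_eq)
    show "(\<lambda>i. xs ! (i - 1)) \<in> {1..card X} \<rightarrow> X" using assms(2) len by auto
    show "xs ! (extension_of_list xs v - 1) = v" if "v \<in> X" for v
      using that nth_pos[of v xs] assms(2) by (simp add: extension_of_list_def)
    show "extension_of_list xs (xs ! (i - 1)) = i" if "i \<in> {1..card X}" for i
    proof -
      have "xs ! (i - 1) \<in> X" using that assms(2) len by auto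
      then show ?thesis using that len pos_nth[OF d, of "i - 1"] by (auto simp: extension_of_list_def)
    qed
  qed
  moreover have "pos xs u < pos xs v" if "u \<in> X" "v \<in> X" "prec u v" for u v
  proof (rule ccontr)
    assume "\<not> pos xs u < pos xs v"
    moreover have "pos xs u \<noteq> pos xs v"
      using that nth_pos[of u xs] nth_pos[of v xs] assms(2) irrefl by metis
    ultimately have "pos xs v < pos xs u" by simp
    then have "\<not> prec (xs ! pos xs u) (xs ! pos xs v)"
      using assms nth_pos[of u xs] that sorted_wrt_nth_less[of _ xs "pos xs v" "pos xs u"]
      unfolding linear_list_def by blast
    then show False using that nth_pos[of u xs] nth_pos[of v xs] assms(2) by simp
  qed
  ultimately show ?thesis by (auto simp: linear_extensions_def extension_of_list_def)
qed

lemma extension_of_list_inj: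
  assumes "linear_list xs" "set xs = X" "linear_list ys" "set ys = X" "extension_of_list xs = extension_of_list ys"
  shows "xs = ys"
proof (rule nth_equalityI)
  have d: "distinct xs" "distinct ys" using assms by (auto simp: linear_list_def)
  show len: "length xs = length ys" using d assms(2,4) distinct_card by metis
  fix i assume i: "i < length xs"
  then have v: "xs ! i \<in> X" using assms(2) by auto
  have "pos ys (xs ! i) = pos xs (xs ! i)"
    using fun_cong[OF assms(5), of "xs ! i"] v by (simp add: extension_of_list_def)
  then show "xs ! i = ys ! i" using pos_nth[OF d(1) i] nth_pos[of "xs ! i" ys] v assms(4) by simp
qed

lemma linear_extension_list:
  assumes "L \<in> linear_extensions X prec"
  obtains xs where "linear_list xs" "set xs = X" "\<And>v. v \<in> X \<Longrightarrow> L v - 1 < length xs \<and> xs ! (L v - 1) = v"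
    "\<And>v. v \<in> X \<Longrightarrow> 1 \<le> L v" "extension_of_list xs = L"
proof -
  have L: "L \<in> extensional X" "bij_betw L X {1..card X}" and mono: "\<And>u v. \<lbrakk>u \<in> X; v \<in> X; prec u v\<rbrakk> \<Longrightarrow> L u < L v"
    using assms by (auto simp: linear_extensions_def)
  define xs where "xs = map (inv_into X L) [1..<Suc (card X)]"
  have len: "length xs = card X" by (simp add: xs_def)
  have inv: "inv_into X L i \<in> X" "L (inv_into X L i) = i" if "1 \<le> i" "i \<le> card X" for i
    using that L(2) by (auto simp: bij_betw_def intro!: inv_into_into f_inv_into_f)
  have nth: "xs ! i = inv_into X L (Suc i)" if "i < card X" for i
    using that by (simp add: xs_def del: upt_Suc)
  have Lv: "1 \<le> L v" "L v \<le> card X" if "v \<in> X" for v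
    using bij_betwE[OF L(2)] that by auto
  have nthL: "L v - 1 < length xs \<and> xs ! (L v - 1) = v" if "v \<in> X" for v
    using Lv[OF that] nth[of "L v - 1"] L(2) that by (auto simp: len bij_betw_def)
  have d: "distinct xs"
    unfolding distinct_conv_nth len by (metis Suc_inject Suc_leI inv(2) le_add1 nth plus_1_eq_Suc)
  have X: "set xs = X"
  proof
    show "set xs \<subseteq> X" using inv by (auto simp: xs_def)
    show "X \<subseteq> set xs"
    proof
      fix v assume "v \<in> X"
      then show "v \<in> set xs" using nthL[of v] nth_mem[of "L v - 1" xs] by simp
    qed
  qed
  have "linear_list xs"
    unfolding linear_list_def sorted_wrt_iff_nth_less
  proof (intro conjI d allI impI notI)
    fix i j assume ij: "i < j" "j < length xs" and "prec (xs ! j) (xs ! i)"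
    moreover have "xs ! i \<in> X" "xs ! j \<in> X" using ij X nth_mem[of i xs] nth_mem[of j xs] by simp_all
    ultimately have "L (xs ! j) < L (xs ! i)" using mono by blast
    then show False using ij inv(2) by (simp add: nth len)
  qed
  moreover have "extension_of_list xs = L"
  proof
    fix v
    show "extension_of_list xs v = L v"
    proof (cases "v \<in> X")
      case True
      then have "pos xs v = L v - 1" using pos_nth[OF d, of "L v - 1"] nthL[OF True] by simp
      then show ?thesis using True Lv(1)[OF True] by (simp add: extension_of_list_def)
    next
      case False
      then show ?thesis using L(1) by (simp add: extension_of_list_def extensional_def)
    qed
  qed
  ultimately show ?thesis using that X nthL Lv(1) by blast
qed

text \<open>Positions differing by \<open>Suc p\<close> have \<open>p\<close> letters strictly
  between them, so cutting the list of a linear extension at the three markers yields blocks of the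
  right lengths.\<close>

lemma F_eq_card_words: "F X prec x y z (int (Suc p)) (int (Suc q)) = card (words p q)"
proof -
  define f where "f = (\<lambda>(A, B, D, E). extension_of_list (A @ x # B @ y # D @ z # E))"
  let ?S = "{L \<in> linear_extensions X prec. int (L y) - int (L x) = int (Suc p) \<and> int (L z) - int (L y) = int (Suc q)}"
  have "bij_betw f (words p q) ?S"
  proof (rule bij_betwI')
    fix s t assume st: "s \<in> words p q" "t \<in> words p q"
    obtain A B D E where s: "s = (A, B, D, E)" by (cases s)
    obtain A' B' D' E' where t: "t = (A', B', D', E')" by (cases t)
    note ws = st(1)[unfolded s] and wt = st(2)[unfolded t]
    show "f s = f t \<longleftrightarrow> s = t"
    proof
      assume "f s = f t"
      then have "A @ x # B @ y # D @ z # E = A' @ x # B' @ y # D' @ z # E'"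
        using extension_of_list_inj[OF wordsD(1,2)[OF ws] wordsD(1,2)[OF wt]] by (simp add: f_def s t)
      moreover from this have "A = A' \<and> B @ y # D @ z # E = B' @ y # D' @ z # E'"
        using wordsD(1)[OF ws] by (subst (asm) append_Cons_eq_iff) (auto simp: linear_list_def)
      ultimately show "s = t" using wordsD[OF ws] wordsD[OF wt] by (simp add: s t)
    qed simp
  next
    fix s assume "s \<in> words p q"
    moreover obtain A B D E where s: "s = (A, B, D, E)" by (cases s)
    ultimately have w: "(A, B, D, E) \<in> words p q" by simp
    let ?xs = "A @ x # B @ y # D @ z # E"
    have "distinct ?xs" using wordsD(1)[OF w] by (simp add: linear_list_def)
    then have "pos ?xs x = length A" "pos ((A @ x # B) @ y # D @ z # E) y = length (A @ x # B)"
      "pos ((A @ x # B @ y # D) @ z # E) z = length (A @ x # B @ y # D)"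
      by (intro pos_append; auto)+
    then show "f s \<in> ?S"
      using extension_of_list[OF wordsD(1,2)[OF w]] wordsD(3,4)[OF w] markers
      by (simp add: f_def s extension_of_list_def)
  next
    fix L assume L: "L \<in> ?S"
    then obtain xs where xs: "linear_list xs" "set xs = X" "\<And>v. v \<in> X \<Longrightarrow> L v - 1 < length xs \<and> xs ! (L v - 1) = v"
      "\<And>v. v \<in> X \<Longrightarrow> 1 \<le> L v" "extension_of_list xs = L"
      using linear_extension_list[of L] by blast
    define i where "i = L x - 1"
    have Li: "L x = Suc i" "L y = i + p + 2" "L z = i + p + q + 3"
      using L xs(4)[OF markers(1)] by (auto simp: i_def)
    have n: "xs ! i = x" "xs ! (i + p + 1) = y" "xs ! (i + p + q + 2) = z" "i + p + q + 2 < length xs"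
    proof -
      have "L x - 1 = i" "L y - 1 = i + p + 1" "L z - 1 = i + p + q + 2" using Li by simp_all
      then show "xs ! i = x" "xs ! (i + p + 1) = y" "xs ! (i + p + q + 2) = z" "i + p + q + 2 < length xs"
        using xs(3)[OF markers(1)] xs(3)[OF markers(2)] xs(3)[OF markers(3)] by metis+
    qed
    define R1 where "R1 = drop (Suc i) xs"
    define R2 where "R2 = drop (Suc p) R1"
    have 1: "xs = take i xs @ x # R1"
      using n id_take_nth_drop[of i xs] by (simp add: R1_def)
    have 2: "R1 = take p R1 @ y # R2"
      using n id_take_nth_drop[of p R1] by (simp add: R1_def R2_def)
    have "R2 ! q = z" "q < length R2" using n by (simp_all add: R1_def R2_def algebra_simps)
    then have 3: "R2 = take q R2 @ z # drop (Suc q) R2" using id_take_nth_drop[of q R2] by simp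
    have eq: "take i xs @ x # take p R1 @ y # take q R2 @ z # drop (Suc q) R2 = xs"
      using 1 2 3 by metis
    have "(take i xs, take p R1, take q R2, drop (Suc q) R2) \<in> words p q"
    proof (rule wordsI)
      show "linear_list (take i xs @ x # take p R1 @ y # take q R2 @ z # drop (Suc q) R2)" unfolding eq by (rule xs)
      show "set (take i xs @ x # take p R1 @ y # take q R2 @ z # drop (Suc q) R2) = X" unfolding eq by (rule xs)
    qed (use n in \<open>simp_all add: R1_def R2_def\<close>)
    moreover have "f (take i xs, take p R1, take q R2, drop (Suc q) R2) = L"
      by (simp add: f_def eq xs(5))
    ultimately show "\<exists>s\<in>words p q. L = f s" by metis
  qed
  then show ?thesis unfolding F_def by (metis (no_types, lifting) bij_betw_same_card)
qed

end

theorem theorem1p3: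
  fixes X :: "'a set" and prec :: "'a \<Rightarrow> 'a \<Rightarrow> bool"
    and x y z :: 'a and t :: nat and k l :: int
  assumes "finite X"
    and "irreflp_on X prec"
    and "transp_on X prec"
    and "x \<in> X" "y \<in> X" "z \<in> X"
    and "x \<noteq> y" "y \<noteq> z" "x \<noteq> z"
    and "t \<ge> 1"
    and "thin_wrt X prec t {x, y, z} \<or> flat_wrt X prec t {x, y, z}"
    and "k \<ge> 1" "l \<ge> 1"
  shows "real (F X prec x y z (k + 1) l) * real (F X prec x y z k (l + 1))
    \<ge> (1 / 2 + 1 / (16 * real t * (real t + 1) ^ 3))
       * real (F X prec x y z k l) * real (F X prec x y z (k + 1) (l + 1))"
proof -
  \<comment> \<open>The order axioms are assumed on \<open>X\<close> only, whereas the locale wants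
    them for the whole type; restricting the relation to \<open>X\<close> changes none of the
    quantities involved.\<close>
  define prec' where "prec' u v \<longleftrightarrow> u \<in> X \<and> v \<in> X \<and> prec u v" for u v
  interpret marked_poset prec' X x y z
  proof
    show "\<not> prec' u u" for u using assms(2) by (auto simp: prec'_def irreflp_on_def)
    show "prec' u w" if "prec' u v" "prec' v w" for u v w
      using that assms(3) by (auto simp: prec'_def dest: transp_onD)
  qed (use assms in auto)
  have "linear_extensions X prec = linear_extensions X prec'"
    by (auto simp: linear_extensions_def prec'_def)
  then have F: "F X prec x y z a b = F X prec' x y z a b" for a b
    by (simp add: F_def)
  have "{v \<in> X. comparable prec u v} = {v \<in> X. comparable prec' u v}"
    "{v \<in> X. incomparable prec u v} = {v \<in> X. incomparable prec' u v}" if "u \<in> X" for u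
    using that by (auto simp: prec'_def comparable_def incomparable_def)
  then have tf: "thin_wrt X prec' t {x, y, z} \<or> flat_wrt X prec' t {x, y, z}"
    using assms(4-6,11) by (auto simp: thin_wrt_def flat_wrt_def)
  define p q where "p = nat (k - 1)" and "q = nat (l - 1)"
  have kl: "k = int (Suc p)" "l = int (Suc q)" "k + 1 = int (Suc (Suc p))" "l + 1 = int (Suc (Suc q))"
    using assms(12,13) by (simp_all add: p_def q_def)
  show ?thesis
    using words_cross_product[OF tf assms(10), of p q]
    unfolding F kl(3,4) unfolding kl(1,2) F_eq_card_words .
qed

end
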